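(* Let $m\ge3$ be an integer, $0\le\alpha<1$, $\omega_0\in\mathcal C^\omega_{-\alpha}$, and let $\omega\in C([0,T_* ),\mathcal C^\omega_{-\alpha})$ be the unique solution of the 2d Euler equation $$\partial_t\omega+u\cdot\nabla\omega=0,\qquad u=\nabla^\perp\psi,\qquad\Delta\psi=\omega,\qquad\omega(0,\cdot)=\omega_0,$$ with maximal time of existence $T_*$. Then for all $t\in[0,T_* )$ the limit $g(t,\theta)=\lim_{r\to0}\omega(t,r,\theta)$ exists for $\theta\in(0,\frac{\pi}{m})$; the function $g(t,\cdot)$ is odd and $\frac{2\pi}{m}$-periodic in $\theta$, $|\theta|^\alpha g(t,\theta)\in L^\infty(0,\frac{\pi}{m})$, and $g$ solves on $[0,T_* )$ $$\partial_tg+2G\,\partial_\theta g=0,\qquad(4+\partial_{\theta\theta})G=g,\qquad g(0,\cdot)=g_0,$$ where $g_0(\theta)=\lim_{r\to0}\omega_0(r,\theta)$.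
   Context: Polar coordinates $(r,\theta)$ on $\mathbb R^2$ are used; $\nabla^\perp=(-\partial_y,\partial_x)$. All vorticities are odd in $\theta$ and $m$-fold symmetric (i.e. $\frac{2\pi}{m}$-periodic in $\theta$), hence determined by their values on the sector $r\ge0$, $0\le\theta\le\frac{\pi}{m}$. For $\lambda>0$, $$\|f\|_{C^\omega_{-\alpha,\lambda}}=\sum_{k=0}^{+\infty}\frac{\lambda^k}{k!}\Big(\|(r+\theta)^{k+\alpha}\partial_r^kf\|_{L^\infty(\mathbb R_+\times(0,\frac{\pi}{m}))}+\|(r+\theta)^{k+\alpha}\partial_\theta^kf\|_{L^\infty(\mathbb R_+\times(0,\frac{\pi}{m}))}\Big),$$ and $\mathcal C^\omega_{-\alpha}$ is the space of odd, $m$-fold symmetric functions with $\|f\|_{C^\omega_{-\alpha,\lambda}}<\infty$ for some $\lambda>0$. Membership in $C([0,T),\mathcal C^\omega_{-\alpha})$ means that for every $T'<T$ there is $\lambda>0$ such that $\omega$ is continuous from $[0,T']$ into the space with norm $\|\cdot\|_{C^\omega_{-\alpha,\lambda}}$. The stream function $\psi$ is the unique odd, $m$-fold symmetric solution of $\Delta\psi=\omega$ with $\sup_{x\ne0}|\psi(x)|/|x|^2<\infty$. The transport equation is understood in the open sector $r>0$, $0<\theta<\frac{\pi}{m}$ (and extended by symmetry). For data in $\mathcal C^\omega_{-\alpha}$ a unique local-in-time solution exists in this class; $T_*$ is the supremum of the $T>0$ such that a solution in $C([0,T),\mathcal C^\omega_{-\alpha})$ exists. $G$ denotes the unique odd,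 $\frac{2\pi}{m}$-periodic solution of $4G+\partial_{\theta\theta}G=g$. The equation for $g$ is understood via characteristics: $g(t,\chi(t,\theta))=g_0(\theta)$, where $\frac{d}{dt}\chi(t,\theta)=2G(t,\chi(t,\theta))$, $\chi(0,\theta)=\theta$. *)

theory Defs
  imports "HOL-Analysis.Analysis"
begin

definition dderiv :: "'a \<Rightarrow> ('a::euclidean_space \<Rightarrow> real) \<Rightarrow> 'a \<Rightarrow> real" where
  "dderiv v f x = frechet_derivative f (at x) v"

text \<open>\<open>C\<^sup>\<infinity>\<close> on an open set: every iterated partial derivative exists and is differentiable.\<close>

definition smooth_on :: "'a::euclidean_space set \<Rightarrow> ('a \<Rightarrow> real) \<Rightarrow> bool" where
  "smooth_on S f \<longleftrightarrow>
     (\<forall>vs. set vs \<subseteq> Basis \<longrightarrow> (\<forall>x\<in>S. (foldr dderiv vs f) differentiable (at x)))"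

definition test_function :: "('a::euclidean_space \<Rightarrow> real) \<Rightarrow> bool" where
  "test_function \<phi> \<longleftrightarrow> smooth_on UNIV \<phi> \<and> bounded {x. \<phi> x \<noteq> 0}"

definition locally_integrable :: "('a::euclidean_space \<Rightarrow> real) \<Rightarrow> bool" where
  "locally_integrable f \<longleftrightarrow> (\<forall>R. set_integrable lborel (cball 0 R) f)"

definition laplacian :: "('a::euclidean_space \<Rightarrow> real) \<Rightarrow> 'a \<Rightarrow> real" where
  "laplacian f x = (\<Sum>b\<in>Basis. dderiv b (dderiv b f) x)"

text \<open>\<open>\<Delta>\<psi> = w\<close> in the sense of distributions on the whole space. (In the application \<open>w\<close> may jump
  across the rays bounding the sectors, so a pointwise Laplacian need not exist there.)\<close>

definition distr_laplacian_eq :: "('a::euclidean_space \<Rightarrow> real) \<Rightarrow> ('a \<Rightarrow> real) \<Rightarrow> bool" where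
  "distr_laplacian_eq \<psi> w \<longleftrightarrow>
     locally_integrable \<psi> \<and> locally_integrable w \<and>
     (\<forall>\<phi>. test_function \<phi> \<longrightarrow>
        (LINT x|lborel. \<psi> x * laplacian \<phi> x) = (LINT x|lborel. w x * \<phi> x))"

text \<open>The plane is identified with the complex numbers, \<open>x + iy = rcis r \<theta>\<close>.\<close>

definition grad :: "(complex \<Rightarrow> real) \<Rightarrow> complex \<Rightarrow> complex" where
  "grad f z = Complex (dderiv 1 f z) (dderiv \<i> f z)"

definition perp_grad :: "(complex \<Rightarrow> real) \<Rightarrow> complex \<Rightarrow> complex" where
  "perp_grad f z = Complex (- dderiv \<i> f z) (dderiv 1 f z)"

definition polar :: "(complex \<Rightarrow> real) \<Rightarrow> real \<times> real \<Rightarrow> real" where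
  "polar f = (\<lambda>(r, \<theta>). f (rcis r \<theta>))"

definition odd_fun :: "(real \<Rightarrow> real) \<Rightarrow> bool" where
  "odd_fun h \<longleftrightarrow> (\<forall>\<theta>. h (- \<theta>) = - h \<theta>)"

definition periodic_with :: "real \<Rightarrow> (real \<Rightarrow> real) \<Rightarrow> bool" where
  "periodic_with p h \<longleftrightarrow> (\<forall>\<theta>. h (\<theta> + p) = h \<theta>)"

definition odd_mfold :: "nat \<Rightarrow> (complex \<Rightarrow> real) \<Rightarrow> bool" where
  "odd_mfold m f \<longleftrightarrow>
     (\<forall>r\<ge>0. odd_fun (\<lambda>\<theta>. polar f (r, \<theta>)) \<and> periodic_with (2 * pi / m) (\<lambda>\<theta>. polar f (r, \<theta>)))"

definition polar_sector :: "nat \<Rightarrow> (real \<times> real) set" where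
  "polar_sector m = {0<..} \<times> {0<..<pi / m}"

text \<open>The \<open>L\<^sup>\<infinity>\<close> norms are written as suprema: the norm is only used for functions that are
  smooth on the open sector, where supremum and essential supremum agree.\<close>

definition weighted_sup :: "nat \<Rightarrow> real \<Rightarrow> (real \<times> real \<Rightarrow> real) \<Rightarrow> ennreal" where
  "weighted_sup m a F =
     (SUP (r, \<theta>)\<in>polar_sector m. ennreal \<bar>(r + \<theta>) powr a * F (r, \<theta>)\<bar>)"

definition Comega_norm :: "nat \<Rightarrow> real \<Rightarrow> real \<Rightarrow> (complex \<Rightarrow> real) \<Rightarrow> ennreal" where
  "Comega_norm m \<alpha> lam f =
     (\<Sum>k. ennreal (lam ^ k / fact k) *
        (weighted_sup m (real k + \<alpha>) ((dderiv (1, 0) ^^ k) (polar f)) +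
         weighted_sup m (real k + \<alpha>) ((dderiv (0, 1) ^^ k) (polar f))))"

definition Comega_lam :: "nat \<Rightarrow> real \<Rightarrow> real \<Rightarrow> (complex \<Rightarrow> real) set" where
  "Comega_lam m \<alpha> lam =
     {f. odd_mfold m f \<and> smooth_on (polar_sector m) (polar f) \<and> Comega_norm m \<alpha> lam f < \<infinity>}"

definition Comega :: "nat \<Rightarrow> real \<Rightarrow> (complex \<Rightarrow> real) set" where
  "Comega m \<alpha> = (\<Union>lam\<in>{0<..}. Comega_lam m \<alpha> lam)"

definition time_interval :: "ereal \<Rightarrow> real set" where
  "time_interval T = {t. 0 \<le> t \<and> ereal t < T}"

text \<open>Membership in \<open>C([0,T), \<C>)\<close>: on each \<open>[0,T']\<close> with \<open>T' < T\<close>, norm-continuity for one common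
  \<open>lam\<close>.\<close>

definition continuous_Comega :: "nat \<Rightarrow> real \<Rightarrow> ereal \<Rightarrow> (real \<Rightarrow> complex \<Rightarrow> real) \<Rightarrow> bool" where
  "continuous_Comega m \<alpha> T \<omega> \<longleftrightarrow>
     (\<forall>T'\<in>time_interval T. \<exists>lam>0. \<forall>t\<in>{0..T'}.
        \<omega> t \<in> Comega_lam m \<alpha> lam \<and>
        ((\<lambda>s. Comega_norm m \<alpha> lam (\<lambda>z. \<omega> s z - \<omega> t z)) \<longlongrightarrow> 0) (at t within {0..T'}))"

text \<open>Differentiability away from the origin (automatic up to modification on a null set, by elliptic
  regularity) selects the representative whose gradient defines the velocity.\<close>

definition stream_function :: "nat \<Rightarrow> (complex \<Rightarrow> real) \<Rightarrow> (complex \<Rightarrow> real) \<Rightarrow> bool" where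
  "stream_function m w \<psi> \<longleftrightarrow>
     odd_mfold m \<psi> \<and> (\<forall>z. z \<noteq> 0 \<longrightarrow> \<psi> differentiable (at z)) \<and>
     distr_laplacian_eq \<psi> w \<and> (\<exists>C. \<forall>z. z \<noteq> 0 \<longrightarrow> \<bar>\<psi> z\<bar> / (cmod z)\<^sup>2 \<le> C)"

definition euler_solution ::
  "nat \<Rightarrow> real \<Rightarrow> ereal \<Rightarrow> (complex \<Rightarrow> real) \<Rightarrow> (real \<Rightarrow> complex \<Rightarrow> real) \<Rightarrow> bool" where
  "euler_solution m \<alpha> T \<omega>\<^sub>0 \<omega> \<longleftrightarrow>
     continuous_Comega m \<alpha> T \<omega> \<and> \<omega> 0 = \<omega>\<^sub>0 \<and>
     (\<exists>\<psi>. \<forall>t\<in>time_interval T. stream_function m (\<omega> t) (\<psi> t) \<and>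
        (\<forall>(r, \<theta>)\<in>polar_sector m.
           ((\<lambda>s. \<omega> s (rcis r \<theta>)) has_real_derivative
              - (perp_grad (\<psi> t) (rcis r \<theta>) \<bullet> grad (\<omega> t) (rcis r \<theta>)))
             (at t within time_interval T)))"

definition max_time :: "nat \<Rightarrow> real \<Rightarrow> (complex \<Rightarrow> real) \<Rightarrow> ereal" where
  "max_time m \<alpha> \<omega>\<^sub>0 = Sup {T. 0 < T \<and> (\<exists>\<omega>. euler_solution m \<alpha> T \<omega>\<^sub>0 \<omega>)}"

text \<open>\<open>4G + G'' = g\<close> for \<open>g\<close> odd and \<open>2\<pi>/m\<close>-periodic, possibly discontinuous or singular on
  \<open>(\<pi>/m)\<int>\<close>. There the equation is expressed by \<open>G \<in> C\<^sup>1\<close>, i.e. \<open>G''\<close> has no singular part.\<close>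

definition angular_stream :: "nat \<Rightarrow> (real \<Rightarrow> real) \<Rightarrow> (real \<Rightarrow> real) \<Rightarrow> bool" where
  "angular_stream m g G \<longleftrightarrow>
     odd_fun G \<and> periodic_with (2 * pi / m) G \<and>
     (\<exists>G'. continuous_on UNIV G' \<and> (\<forall>\<theta>. (G has_real_derivative G' \<theta>) (at \<theta>)) \<and>
        (\<forall>\<theta>. (\<forall>j::int. \<theta> \<noteq> j * pi / m) \<longrightarrow>
           (G' has_real_derivative g \<theta> - 4 * G \<theta>) (at \<theta>)))"

text \<open>\<open>\<partial>\<^sub>t g + 2 G \<partial>\<^sub>\<theta> g = 0\<close>, \<open>g(0,\<cdot>) = g\<^sub>0\<close> on \<open>(0, \<pi>/m)\<close>, via characteristics.\<close>

definition solves_by_characteristics ::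
  "nat \<Rightarrow> ereal \<Rightarrow> (real \<Rightarrow> real \<Rightarrow> real) \<Rightarrow> (real \<Rightarrow> real) \<Rightarrow> (real \<Rightarrow> real \<Rightarrow> real) \<Rightarrow> bool" where
  "solves_by_characteristics m T G g\<^sub>0 g \<longleftrightarrow>
     (\<exists>X :: real \<Rightarrow> real \<Rightarrow> real. \<forall>\<theta>\<in>{0<..<pi / m}.
        X 0 \<theta> = \<theta> \<and>
        (\<forall>t\<in>time_interval T.
           X t \<theta> \<in> {0<..<pi / m} \<and>
           ((\<lambda>s. X s \<theta>) has_real_derivative 2 * G t (X t \<theta>)) (at t within time_interval T) \<and>
           g t (X t \<theta>) = g\<^sub>0 \<theta>))"

end

theory Submission
  imports Defs
begin

text \<open>Near the origin the Euler equation sees only the radial limit of the vorticity. The weights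
\<open>(r + \<theta>)\<^sup>k\<^sup>+\<^sup>\<alpha>\<close> of the norm make \<open>\<partial>\<^sub>r \<omega>\<close> bounded up to \<open>r = 0\<close> at each fixed angle, so the limit
\<open>g(t,\<theta>)\<close> exists, is continuous in the open sector and is of size \<open>\<theta>\<^sup>-\<^sup>\<alpha>\<close>. The function \<open>r\<^sup>2 G(\<theta>)\<close> has Laplacian
\<open>4 G + G'' = g\<close>, so it should be the leading part of \<open>\<psi>\<close>. If that is true to first order in the
derivatives, then \<open>u \<cdot> \<nabla>\<omega> = 2 G \<partial>\<^sub>\<theta>\<omega> + o(1)\<close> as \<open>r \<rightarrow> 0\<close>. Along a characteristic \<open>X\<close> of the
one-dimensional field \<open>2 G\<close> the function \<open>s \<mapsto> \<omega>(s, r, X(s))\<close> therefore has derivative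
\<open>O(r\<^sup>\<kappa>)\<close>, and \<open>r \<rightarrow> 0\<close> gives \<open>g(t, X(t)) = g\<^sub>0(X(0))\<close> (\<open>transport_rate\<close>,
\<open>radial_limit_transported\<close>).

The substance is the claim about \<open>\<psi>\<close> (\<open>stream_asymptotics\<close>). The difference
\<open>D = \<psi> - r\<^sup>2 G\<close> vanishes on the two rays bounding the sector, is \<open>O(r\<^sup>2)\<close>, and has Laplacian
\<open>\<omega> - g\<close>, which by interpolation is \<open>O(r\<^sup>\<kappa> \<theta>\<^sup>-\<^sup>\<beta>)\<close> with \<open>\<beta> = \<alpha> + \<kappa> < 1\<close> (\<open>radial_limit_rate\<close>).
A barrier of the form \<open>r\<^sup>2\<^sup>+\<^sup>\<kappa> Q(\<theta>)\<close> then gives \<open>D = O(r\<^sup>2\<^sup>+\<^sup>\<kappa>)\<close> (\<open>sector_bound\<close>). Growth of order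
exactly \<open>r\<^sup>2\<close> at the origin and at infinity is excluded by a Phragmen-Lindelof argument
(\<open>sector_comparison\<close>), which is where \<open>m \<ge> 3\<close> is used: for an opening angle
\<open>b = \<pi>/m \<le> \<pi>/3\<close> the homogeneous harmonic functions vanishing on the rays have degree \<open>\<plusminus> k \<pi>/b\<close>, of modulus
at least \<open>3 > 2 + \<kappa>\<close>.
An interior gradient estimate turns this into \<open>\<nabla>D = O(r\<^sup>1\<^sup>+\<^sup>\<kappa>)\<close> away from the rays
(\<open>weak_lap_gradient_le\<close>).

Since \<open>\<Delta>\<psi> = \<omega>\<close> is assumed only as distributions, with \<open>\<psi>\<close> once differentiable, both estimates
rest on a maximum principle for distributional Laplacians (\<open>weak_lap_no_max\<close>). It is
proved by testing with one explicit family of functions, a convex function of the logarithm of the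
distance, smoothed at the pole.\<close>

section \<open>Explicit test functions\<close>

text \<open>The flat function \<open>e\<^sup>-\<^sup>1\<^sup>/\<^sup>x\<close> together with its quotients by powers of \<open>x\<close>: the family is
closed under differentiation up to linear combinations, so one derivative formula, valid at \<open>0\<close> too,
covers all orders.\<close>

definition flat_exp :: "nat \<Rightarrow> real \<Rightarrow> real" where
  "flat_exp n x = (if 0 < x then exp (- 1 / x) / x ^ n else 0)"

lemma flat_exp_nonneg: "0 \<le> flat_exp n x"
  by (simp add: flat_exp_def)

lemma flat_exp_tendsto_0: "(flat_exp n \<longlongrightarrow> 0) (at 0)"
proof (subst filterlim_at_split, intro conjI)
  have "eventually (\<lambda>x. 0 = flat_exp n x) (at_left (0::real))"
    by (simp add: flat_exp_def eventually_at_filter)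
  then show "(flat_exp n \<longlongrightarrow> 0) (at_left 0)"
    using Lim_transform_eventually[of "\<lambda>_. 0"] by auto
  have "((\<lambda>x::real. inverse x ^ n / exp (inverse x)) \<longlongrightarrow> 0) (at_right 0)"
    by (rule filterlim_compose[OF tendsto_power_div_exp_0 filterlim_inverse_at_top_right])
  moreover have "eventually (\<lambda>x. inverse x ^ n / exp (inverse x) = flat_exp n x) (at_right 0)"
    unfolding eventually_at_filter
    by (intro always_eventually) (simp add: flat_exp_def exp_minus field_simps)
  ultimately show "(flat_exp n \<longlongrightarrow> 0) (at_right 0)"
    by (rule Lim_transform_eventually)
qed

lemma flat_exp_deriv: "(flat_exp n has_real_derivative (flat_exp (n + 2) x - real n * flat_exp (n + 1) x)) (at x)"
proof -
  consider "x < 0" | "x = 0" | "x > 0" by linarith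
  then show ?thesis
  proof cases
    case 1
    have "((\<lambda>_. 0) has_real_derivative 0) (at x)" by simp
    then have "(flat_exp n has_real_derivative 0) (at x)"
      by (rule DERIV_cong_ev[THEN iffD1, rotated -1])
         (use 1 in \<open>auto simp: flat_exp_def eventually_nhds intro!: exI[of _ "{..<0}"]\<close>)
    then show ?thesis using 1 by (simp add: flat_exp_def)
  next
    case 2
    have "((\<lambda>h. flat_exp n h / h) \<longlongrightarrow> 0) (at 0)"
      by (rule Lim_transform_eventually[OF flat_exp_tendsto_0[of "n + 1"]])
         (auto simp: flat_exp_def eventually_at_filter)
    then have "(flat_exp n has_real_derivative 0) (at 0)"
      by (simp add: has_field_derivative_iff flat_exp_def)
    then show ?thesis using 2 by (simp add: flat_exp_def)
  next
    case 3
    have "((\<lambda>x. exp (- 1 / x) / x ^ n) has_real_derivative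
            (exp (- 1 / x) * (1 / x\<^sup>2) * x ^ n - exp (- 1 / x) * (real n * x ^ (n - 1))) / (x ^ n)\<^sup>2) (at x)"
      using 3 by (auto intro!: derivative_eq_intros simp: power2_eq_square)
    moreover have "(exp (- 1 / x) * (1 / x\<^sup>2) * x ^ n - exp (- 1 / x) * (real n * x ^ (n - 1))) / (x ^ n)\<^sup>2
        = flat_exp (n + 2) x - real n * flat_exp (n + 1) x"
      using 3 by (cases n) (auto simp: flat_exp_def field_simps power2_eq_square power_add)
    ultimately have *: "((\<lambda>x. exp (- 1 / x) / x ^ n) has_real_derivative
        (flat_exp (n + 2) x - real n * flat_exp (n + 1) x)) (at x)" by simp
    show ?thesis
      by (rule DERIV_cong_ev[THEN iffD1, OF _ _ _ *])
         (use 3 in \<open>auto simp: flat_exp_def eventually_nhds intro!: exI[of _ "{0<..}"]\<close>)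
  qed
qed

text \<open>With \<open>\<Phi>(x) = x e\<^sup>-\<^sup>1\<^sup>/\<^sup>x\<close> one has \<open>\<Phi>' = flat_exp 0 + flat_exp 1\<close> and \<open>\<Phi>'' = flat_exp 3\<close>.
So \<open>\<Phi>\<close> is convex, and its slope increases to the value \<open>1\<close> at infinity.\<close>

lemma flat_exp_slope_le_1: "flat_exp 0 x + flat_exp 1 x \<le> 1"
proof (cases "x > 0")
  case True
  then have "exp (- 1 / x) * (1 + 1 / x) \<le> exp (- 1 / x) * exp (1 / x)"
    using exp_ge_add_one_self[of "1 / x"] by (intro mult_left_mono) auto
  also have "\<dots> = 1" by (simp add: exp_minus)
  finally show ?thesis using True by (simp add: flat_exp_def algebra_simps)
qed (simp add: flat_exp_def)

text \<open>Regularising the squared distance by \<open>\<eta>\<^sup>2\<close> removes the logarithmic pole at \<open>p\<close>.\<close>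

definition reg_sq :: "'a::euclidean_space \<Rightarrow> real \<Rightarrow> 'a \<Rightarrow> real" where
  "reg_sq p \<eta> z = (norm (z - p))\<^sup>2 + \<eta>\<^sup>2"

definition log_ratio :: "'a::euclidean_space \<Rightarrow> real \<Rightarrow> real \<Rightarrow> 'a \<Rightarrow> real" where
  "log_ratio p \<rho> \<eta> z = ln (\<rho>\<^sup>2) - ln (reg_sq p \<eta> z)"

text \<open>This is \<open>\<Phi>(l)\<close> for \<open>\<Phi>(x) = x e\<^sup>-\<^sup>1\<^sup>/\<^sup>x\<close> and \<open>l = ln (\<rho>\<^sup>2 / (|z - p|\<^sup>2 + \<eta>\<^sup>2))\<close>, a smoothed multiple of
the fundamental solution cut off at radius \<open>\<rho>\<close>.\<close>

definition bump :: "'a::euclidean_space \<Rightarrow> real \<Rightarrow> real \<Rightarrow> 'a \<Rightarrow> real" where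
  "bump p \<rho> \<eta> z = log_ratio p \<rho> \<eta> z * flat_exp 0 (log_ratio p \<rho> \<eta> z)"

definition bump_pder :: "'a::euclidean_space \<Rightarrow> real \<Rightarrow> real \<Rightarrow> 'a \<Rightarrow> 'a \<Rightarrow> real" where
  "bump_pder p \<rho> \<eta> b z = (flat_exp 0 (log_ratio p \<rho> \<eta> z) + flat_exp 1 (log_ratio p \<rho> \<eta> z)) * (- 2 * ((z - p) \<bullet> b) / reg_sq p \<eta> z)"

definition bump_pder2 :: "'a::euclidean_space \<Rightarrow> real \<Rightarrow> real \<Rightarrow> 'a \<Rightarrow> 'a \<Rightarrow> real" where
  "bump_pder2 p \<rho> \<eta> b z = flat_exp 3 (log_ratio p \<rho> \<eta> z) * (4 * ((z - p) \<bullet> b)\<^sup>2 / (reg_sq p \<eta> z)\<^sup>2)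
     + (flat_exp 0 (log_ratio p \<rho> \<eta> z) + flat_exp 1 (log_ratio p \<rho> \<eta> z)) * (4 * ((z - p) \<bullet> b)\<^sup>2 / (reg_sq p \<eta> z)\<^sup>2 - 2 / reg_sq p \<eta> z)"

text \<open>In the plane \<open>\<Delta>\<Phi>(l) = \<Phi>''(l) |\<nabla>l|\<^sup>2 + \<Phi>'(l) \<Delta>l\<close>, and \<open>-\<Delta>l\<close> is an approximate identity of total mass
\<open>4 \<pi>\<close> at scale \<open>\<eta>\<close>. The first term is nonnegative by convexity of \<open>\<Phi>\<close>; as \<open>\<eta> \<rightarrow> 0\<close> the second
one concentrates at \<open>p\<close>.\<close>

definition bump_lap :: "complex \<Rightarrow> real \<Rightarrow> real \<Rightarrow> complex \<Rightarrow> real" where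
  "bump_lap p \<rho> \<eta> z = flat_exp 3 (log_ratio p \<rho> \<eta> z) * (4 * (norm (z - p))\<^sup>2 / (reg_sq p \<eta> z)\<^sup>2)
     - (flat_exp 0 (log_ratio p \<rho> \<eta> z) + flat_exp 1 (log_ratio p \<rho> \<eta> z)) * (4 * \<eta>\<^sup>2 / (reg_sq p \<eta> z)\<^sup>2)"

lemma reg_sq_pos: "\<eta> > 0 \<Longrightarrow> reg_sq p \<eta> z > 0"
  by (simp add: reg_sq_def add_nonneg_pos)

lemma reg_sq_deriv: "(reg_sq p \<eta> has_derivative (\<lambda>h. 2 * ((z - p) \<bullet> h))) (at z)"
  unfolding reg_sq_def power2_norm_eq_inner
  by (auto intro!: derivative_eq_intros simp: inner_commute)

lemma log_ratio_deriv:
  assumes "\<eta> > 0"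
  shows "(log_ratio p \<rho> \<eta> has_derivative (\<lambda>h. - 2 * ((z - p) \<bullet> h) / reg_sq p \<eta> z)) (at z)"
proof -
  have "((\<lambda>z. ln (reg_sq p \<eta> z)) has_derivative (\<lambda>h. 2 * ((z - p) \<bullet> h) * inverse (reg_sq p \<eta> z))) (at z)"
    using DERIV_compose_FDERIV[OF DERIV_ln[OF reg_sq_pos[OF assms, of p z]] reg_sq_deriv] .
  then show ?thesis
    using has_derivative_diff[OF has_derivative_const[of "ln (\<rho>\<^sup>2)"]]
    unfolding log_ratio_def by (force simp: divide_inverse)
qed

lemma flat_exp_comp_deriv:
  assumes "(f has_derivative f') (at z)"
  shows "((\<lambda>z. flat_exp n (f z)) has_derivative (\<lambda>h. (flat_exp (n + 2) (f z) - real n * flat_exp (n + 1) (f z)) * f' h)) (at z)"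
  using has_derivative_compose[OF assms, of "flat_exp n"] flat_exp_deriv[of n "f z"]
  unfolding has_field_derivative_def by (simp add: o_def)

text \<open>All iterated partial derivatives of the bump lie in this ring of functions. Smoothness then
follows from closure under a single differentiation, without any formula for higher derivatives.\<close>

inductive_set bump_ring :: "'a::euclidean_space \<Rightarrow> real \<Rightarrow> real \<Rightarrow> ('a \<Rightarrow> real) set" for p \<rho> \<eta> where
  const: "(\<lambda>_. c) \<in> bump_ring p \<rho> \<eta>"
| coord: "(\<lambda>z. (z - p) \<bullet> v) \<in> bump_ring p \<rho> \<eta>"
| inv: "(\<lambda>z. inverse (reg_sq p \<eta> z)) \<in> bump_ring p \<rho> \<eta>"
| log_ratio: "log_ratio p \<rho> \<eta> \<in> bump_ring p \<rho> \<eta>"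
| flat_exp: "(\<lambda>z. flat_exp n (log_ratio p \<rho> \<eta> z)) \<in> bump_ring p \<rho> \<eta>"
| add: "f \<in> bump_ring p \<rho> \<eta> \<Longrightarrow> g \<in> bump_ring p \<rho> \<eta> \<Longrightarrow> (\<lambda>z. f z + g z) \<in> bump_ring p \<rho> \<eta>"
| mul: "f \<in> bump_ring p \<rho> \<eta> \<Longrightarrow> g \<in> bump_ring p \<rho> \<eta> \<Longrightarrow> (\<lambda>z. f z * g z) \<in> bump_ring p \<rho> \<eta>"

lemma bump_ring_deriv:
  assumes "\<eta> > 0" "f \<in> bump_ring p \<rho> \<eta>"
  shows "\<exists>f'. (\<forall>z. (f has_derivative f' z) (at z)) \<and> (\<forall>b. (\<lambda>z. f' z b) \<in> bump_ring p \<rho> \<eta>)"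
  using assms(2)
proof induction
  case (const c)
  show ?case by (rule exI[of _ "\<lambda>_ _. 0"]) (auto intro: bump_ring.const)
next
  case (coord v)
  show ?case
    by (rule exI[of _ "\<lambda>_ h. h \<bullet> v"])
       (use bump_ring.const in \<open>auto intro!: has_derivative_eq_rhs[OF
          has_derivative_inner_left[OF has_derivative_diff[OF has_derivative_ident has_derivative_const]]]\<close>)
next
  case inv
  let ?d = "\<lambda>z h. (-2) * (((z - p) \<bullet> h) * (inverse (reg_sq p \<eta> z) * inverse (reg_sq p \<eta> z)))"
  have "((\<lambda>z. inverse (reg_sq p \<eta> z)) has_derivative ?d z) (at z)" for z
    using Deriv.has_derivative_inverse[OF _ reg_sq_deriv, of p \<eta> z] reg_sq_pos[OF assms(1), of p z]
    by (simp add: mult_ac)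
  moreover have "(\<lambda>z. ?d z b) \<in> bump_ring p \<rho> \<eta>" for b
    by (intro bump_ring.intros)
  ultimately show ?case by (intro exI[of _ ?d] conjI allI)
next
  case log_ratio
  let ?d = "\<lambda>z h. (-2) * (((z - p) \<bullet> h) * inverse (reg_sq p \<eta> z))"
  have "(log_ratio p \<rho> \<eta> has_derivative ?d z) (at z)" for z
    using log_ratio_deriv[OF assms(1)] by (simp add: divide_inverse mult.assoc)
  moreover have "(\<lambda>z. ?d z b) \<in> bump_ring p \<rho> \<eta>" for b
    by (intro bump_ring.intros)
  ultimately show ?case by (intro exI[of _ ?d] conjI allI)
next
  case (flat_exp n)
  let ?d = "\<lambda>z h. (flat_exp (n + 2) (log_ratio p \<rho> \<eta> z) + (- real n) * flat_exp (n + 1) (log_ratio p \<rho> \<eta> z)) *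
       ((-2) * (((z - p) \<bullet> h) * inverse (reg_sq p \<eta> z)))"
  have "((\<lambda>z. flat_exp n (log_ratio p \<rho> \<eta> z)) has_derivative ?d z) (at z)" for z
    using flat_exp_comp_deriv[OF log_ratio_deriv[OF assms(1)], of n] by (simp add: divide_inverse mult.assoc)
  moreover have "(\<lambda>z. ?d z b) \<in> bump_ring p \<rho> \<eta>" for b
    by (intro bump_ring.intros)
  ultimately show ?case by (intro exI[of _ ?d] conjI allI)
next
  case (add f g)
  then obtain f' g' where "\<forall>z. (f has_derivative f' z) (at z)" "\<forall>b. (\<lambda>z. f' z b) \<in> bump_ring p \<rho> \<eta>"
    "\<forall>z. (g has_derivative g' z) (at z)" "\<forall>b. (\<lambda>z. g' z b) \<in> bump_ring p \<rho> \<eta>" by auto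
  then show ?case
    by (intro exI[of _ "\<lambda>z h. f' z h + g' z h"]) (auto intro!: bump_ring.intros has_derivative_add)
next
  case (mul f g)
  then obtain f' g' where "\<forall>z. (f has_derivative f' z) (at z)" "\<forall>b. (\<lambda>z. f' z b) \<in> bump_ring p \<rho> \<eta>"
    "\<forall>z. (g has_derivative g' z) (at z)" "\<forall>b. (\<lambda>z. g' z b) \<in> bump_ring p \<rho> \<eta>" by auto
  then show ?case using mul.hyps
    by (intro exI[of _ "\<lambda>z h. f z * g' z h + f' z h * g z"])
       (auto intro!: bump_ring.intros has_derivative_mult)
qed

lemma dderiv_eqI: "(f has_derivative f') (at z) \<Longrightarrow> dderiv b f z = f' b"
  unfolding dderiv_def using frechet_derivative_at by metis

lemma bump_ring_smooth:
  assumes "\<eta> > 0" "f \<in> bump_ring p \<rho> \<eta>"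
  shows "smooth_on S f"
proof -
  have "foldr dderiv vs f \<in> bump_ring p \<rho> \<eta>" for vs
  proof (induction vs)
    case (Cons b vs)
    obtain f' where f': "\<forall>z. (foldr dderiv vs f has_derivative f' z) (at z)"
       "(\<lambda>z. f' z b) \<in> bump_ring p \<rho> \<eta>"
      using bump_ring_deriv[OF assms(1) Cons] by blast
    have "dderiv b (foldr dderiv vs f) = (\<lambda>z. f' z b)"
      using f'(1) dderiv_eqI by blast
    then show ?case using f'(2) by simp
  qed (use assms in simp)
  then show ?thesis
    unfolding smooth_on_def differentiable_def using bump_ring_deriv[OF assms(1)] by blast
qed

lemma log_ratio_nonpos: "\<eta> > 0 \<Longrightarrow> \<rho> > 0 \<Longrightarrow> \<rho> \<le> norm (z - p) \<Longrightarrow> log_ratio p \<rho> \<eta> z \<le> 0"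
  unfolding log_ratio_def reg_sq_def
  by (simp, intro ln_mono) (auto simp: add_increasing2 power_mono intro: add_pos_nonneg)

lemma bump_outside:
  assumes "\<eta> > 0" "\<rho> > 0" "\<rho> \<le> norm (z - p)"
  shows "bump p \<rho> \<eta> z = 0" "bump_pder p \<rho> \<eta> b z = 0" "bump_pder2 p \<rho> \<eta> b z = 0"
  using log_ratio_nonpos[OF assms] by (simp_all add: bump_def bump_pder_def bump_pder2_def flat_exp_def)

lemma bump_lap_outside:
  assumes "\<eta> > 0" "\<rho> > 0" "\<rho> \<le> norm (z - p)"
  shows "bump_lap p \<rho> \<eta> z = 0"
  using log_ratio_nonpos[OF assms] by (simp add: bump_lap_def flat_exp_def)

lemma bump_nonneg: "0 \<le> bump p \<rho> \<eta> z"
  by (simp add: bump_def flat_exp_def)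

lemma bump_has_derivative:
  assumes "\<eta> > 0"
  shows "(bump p \<rho> \<eta> has_derivative (\<lambda>h. bump_pder p \<rho> \<eta> h z)) (at z)"
proof -
  have e: "x * flat_exp 2 x = flat_exp 1 x" for x by (simp add: flat_exp_def power2_eq_square)
  have "(bump p \<rho> \<eta> has_derivative (\<lambda>h. log_ratio p \<rho> \<eta> z * ((flat_exp (0 + 2) (log_ratio p \<rho> \<eta> z) - real 0 * flat_exp (0+1) (log_ratio p \<rho> \<eta> z)) * (- 2 * ((z - p) \<bullet> h) / reg_sq p \<eta> z))
      + - 2 * ((z - p) \<bullet> h) / reg_sq p \<eta> z * flat_exp 0 (log_ratio p \<rho> \<eta> z))) (at z)"
    unfolding bump_def
    by (rule has_derivative_mult[OF log_ratio_deriv[OF assms] flat_exp_comp_deriv[OF log_ratio_deriv[OF assms]]])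
  also have "(\<lambda>h. log_ratio p \<rho> \<eta> z * ((flat_exp (0 + 2) (log_ratio p \<rho> \<eta> z) - real 0 * flat_exp (0+1) (log_ratio p \<rho> \<eta> z)) * (- 2 * ((z - p) \<bullet> h) / reg_sq p \<eta> z))
      + - 2 * ((z - p) \<bullet> h) / reg_sq p \<eta> z * flat_exp 0 (log_ratio p \<rho> \<eta> z)) = (\<lambda>h. bump_pder p \<rho> \<eta> h z)"
    unfolding bump_pder_def e[symmetric] by (simp add: numeral_2_eq_2[symmetric] fun_eq_iff algebra_simps)
  finally show ?thesis .
qed

lemma bump_pder_has_derivative:
  assumes "\<eta> > 0"
  shows "\<exists>D. (bump_pder p \<rho> \<eta> b has_derivative D) (at z) \<and> (norm b = 1 \<longrightarrow> D b = bump_pder2 p \<rho> \<eta> b z)"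
proof -
  let ?l = "log_ratio p \<rho> \<eta> z" and ?q = "reg_sq p \<eta> z"
  have q: "?q \<noteq> 0" using reg_sq_pos[OF assms, of p z] by simp
  have A: "((\<lambda>z. flat_exp 0 (log_ratio p \<rho> \<eta> z) + flat_exp 1 (log_ratio p \<rho> \<eta> z)) has_derivative
     (\<lambda>h. (flat_exp (0 + 2) ?l - real 0 * flat_exp (0+1) ?l) * (- 2 * ((z - p) \<bullet> h) / ?q)
        + (flat_exp (1 + 2) ?l - real 1 * flat_exp (1+1) ?l) * (- 2 * ((z - p) \<bullet> h) / ?q))) (at z)"
    by (intro has_derivative_add flat_exp_comp_deriv log_ratio_deriv assms)
  have B: "((\<lambda>z. - 2 * ((z - p) \<bullet> b) / reg_sq p \<eta> z) has_derivative
     (\<lambda>h. (- 2 * (h \<bullet> b) * ?q - (- 2 * ((z - p) \<bullet> b)) * (2 * ((z - p) \<bullet> h))) / (?q * ?q))) (at z)"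
    by (rule has_derivative_divide'[OF _ reg_sq_deriv q]) (auto intro!: derivative_eq_intros)
  have num: "(1::nat) + 1 = 2" "(1::nat) + 2 = 3" by simp_all
  show ?thesis
    apply (intro exI conjI impI)
     apply (unfold bump_pder_def)[1]
     apply (rule has_derivative_mult[OF A B])
    apply (unfold num)
    using q norm_eq_1[of b] by (simp add: numeral_2_eq_2[symmetric] bump_pder2_def power2_eq_square field_simps)
qed

lemma laplacian_bump:
  assumes "\<eta> > 0"
  shows "laplacian (bump p \<rho> \<eta>) z = (\<Sum>b\<in>Basis. bump_pder2 p \<rho> \<eta> b z)"
proof -
  have "dderiv b (bump p \<rho> \<eta>) = bump_pder p \<rho> \<eta> b" for b
    using dderiv_eqI[OF bump_has_derivative[OF assms]] by blast
  moreover have "dderiv b (bump_pder p \<rho> \<eta> b) z = bump_pder2 p \<rho> \<eta> b z" if "b \<in> Basis" for b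
    using bump_pder_has_derivative[OF assms, of p \<rho> b z] norm_Basis[OF that] dderiv_eqI[of _ _ z b] by fastforce
  ultimately show ?thesis unfolding laplacian_def by simp
qed

lemma bump_lap_eq:
  assumes "\<eta> > 0"
  shows "(\<Sum>b\<in>Basis. bump_pder2 p \<rho> \<eta> b z) = bump_lap p \<rho> \<eta> z"
proof -
  have n: "(norm (z - p))\<^sup>2 = (Re z - Re p)\<^sup>2 + (Im z - Im p)\<^sup>2" by (simp add: cmod_power2)
  have q: "reg_sq p \<eta> z \<noteq> 0" using reg_sq_pos[OF assms, of p z] by simp
  have *: "4 * (x\<^sup>2 + y\<^sup>2) / (reg_sq p \<eta> z)\<^sup>2 - 4 / reg_sq p \<eta> z = - 4 * \<eta>\<^sup>2 / (reg_sq p \<eta> z)\<^sup>2"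
    if "x = Re z - Re p" "y = Im z - Im p" for x y
  proof -
    have "x\<^sup>2 + y\<^sup>2 = reg_sq p \<eta> z - \<eta>\<^sup>2" using that n by (simp add: reg_sq_def)
    then show ?thesis unfolding \<open>x\<^sup>2 + y\<^sup>2 = _\<close> using q by (simp add: field_simps power2_eq_square)
  qed
  have "(\<Sum>b\<in>Basis. bump_pder2 p \<rho> \<eta> b z) =
     flat_exp 3 (log_ratio p \<rho> \<eta> z) * (4 * (norm (z - p))\<^sup>2 / (reg_sq p \<eta> z)\<^sup>2) +
     (flat_exp 0 (log_ratio p \<rho> \<eta> z) + flat_exp 1 (log_ratio p \<rho> \<eta> z)) * (4 * ((Re z - Re p)\<^sup>2 + (Im z - Im p)\<^sup>2) / (reg_sq p \<eta> z)\<^sup>2 - 4 / reg_sq p \<eta> z)"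
    unfolding n by (simp add: Basis_complex_def bump_pder2_def add_divide_distrib algebra_simps)
  also have "\<dots> = bump_lap p \<rho> \<eta> z"
    unfolding *[OF refl refl] bump_lap_def by simp
  finally show ?thesis .
qed

lemma test_function_bump:
  assumes "\<eta> > 0" "\<rho> > 0"
  shows "test_function (bump p \<rho> \<eta>)"
  unfolding test_function_def
proof
  have "bump p \<rho> \<eta> \<in> bump_ring p \<rho> \<eta>"
    unfolding bump_def by (intro bump_ring.intros)
  then show "smooth_on UNIV (bump p \<rho> \<eta>)" by (rule bump_ring_smooth[OF assms(1)])
  have "{x. bump p \<rho> \<eta> x \<noteq> 0} \<subseteq> ball p \<rho>"
    using bump_outside(1)[OF assms] by (force simp: dist_norm norm_minus_commute)
  then show "bounded {x. bump p \<rho> \<eta> x \<noteq> 0}"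
    using bounded_subset bounded_ball by blast
qed

lemma bump_ring_continuous:
  assumes "\<eta> > 0" "f \<in> bump_ring p \<rho> \<eta>"
  shows "continuous_on S f"
  using bump_ring_deriv[OF assms] has_derivative_continuous
  by (metis continuous_at_imp_continuous_on)

lemma bump_cont:
  assumes "\<eta> > 0"
  shows "continuous_on S (bump p \<rho> \<eta>)" "continuous_on S (bump_pder p \<rho> \<eta> b)"
    "continuous_on S (bump_pder2 p \<rho> \<eta> b)" "continuous_on S (bump_lap q \<rho> \<eta>)"
proof -
  note [simp] = reg_sq_pos[OF assms, THEN less_imp_neq, THEN not_sym]
  have [continuous_intros]: "continuous_on S (\<lambda>z. flat_exp n (log_ratio p \<rho> \<eta> z))" for n and p :: "'b::euclidean_space" and S
    by (rule bump_ring_continuous[OF assms bump_ring.flat_exp])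
  have [continuous_intros]: "continuous_on S (log_ratio p \<rho> \<eta>)" for p :: "'b::euclidean_space" and S
    by (rule bump_ring_continuous[OF assms bump_ring.log_ratio])
  have [continuous_intros]: "continuous_on S (reg_sq p \<eta>)" for p :: "'b::euclidean_space" and S
    unfolding reg_sq_def by (intro continuous_intros)
  show "continuous_on S (bump p \<rho> \<eta>)" "continuous_on S (bump_pder p \<rho> \<eta> b)"
    "continuous_on S (bump_pder2 p \<rho> \<eta> b)" "continuous_on S (bump_lap q \<rho> \<eta>)"
    unfolding bump_def bump_pder_def bump_pder2_def bump_lap_def
    by (intro continuous_intros; simp)+
qed

section \<open>A weak Laplacian\<close>

text \<open>Derivative along the line through \<open>z\<close> in direction \<open>b\<close>. Integration by parts proceeds one direction
at a time, so products are differentiated as functions of one real variable.\<close>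

definition has_pder :: "'a::euclidean_space \<Rightarrow> ('a \<Rightarrow> real) \<Rightarrow> real \<Rightarrow> 'a \<Rightarrow> bool" where
  "has_pder b f d z \<longleftrightarrow> ((\<lambda>t. f (z + t *\<^sub>R b)) has_real_derivative d) (at 0)"

lemma has_pder_line:
  assumes "has_pder b f d (z + t *\<^sub>R b)"
  shows "((\<lambda>s. f (z + s *\<^sub>R b)) has_real_derivative d) (at t)"
proof -
  have "((\<lambda>s. f (z + t *\<^sub>R b + s *\<^sub>R b)) has_real_derivative d) (at (t - t))"
    using assms by (simp add: has_pder_def)
  then have "((\<lambda>s. f (z + t *\<^sub>R b + (s - t) *\<^sub>R b)) has_real_derivative d * 1) (at t)"
    by (rule DERIV_chain2) (auto intro!: derivative_eq_intros)
  then show ?thesis by (simp add: algebra_simps)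
qed

lemma has_derivative_pder:
  assumes "(f has_derivative f') (at z)"
  shows "has_pder b f (f' b) z"
proof -
  have "((\<lambda>t. z + t *\<^sub>R b) has_derivative (\<lambda>t. t *\<^sub>R b)) (at 0)"
    by (auto intro!: derivative_eq_intros)
  moreover have "(f has_derivative f') (at (z + 0 *\<^sub>R b))" using assms by simp
  ultimately have "((\<lambda>t. f (z + t *\<^sub>R b)) has_derivative (\<lambda>t. f' (t *\<^sub>R b))) (at 0)"
    using has_derivative_compose by blast
  moreover have "f' (t *\<^sub>R b) = f' b * t" for t
    using linear_scale[OF has_derivative_linear[OF assms]] by simp
  ultimately show ?thesis unfolding has_pder_def has_field_derivative_def by simp
qed

text \<open>By translation invariance of Lebesgue measure every difference quotient of \<open>F\<close> integrates to zero;
the mean value theorem bounds the quotients by \<open>M\<close> on a fixed ball, so dominated convergence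
passes to the limit.\<close>

lemma integral_pder_eq_0:
  fixes F :: "'a::euclidean_space \<Rightarrow> real"
  assumes der: "\<And>z. has_pder b F (D z) z" and supp: "\<And>z. F z \<noteq> 0 \<Longrightarrow> norm z \<le> R"
    and bd: "\<And>z. \<bar>D z\<bar> \<le> M" and int: "integrable lborel F"
  shows "(LINT z|lborel. D z) = 0"
proof -
  define h where "h n = 1 / (real n + 1)" for n
  have h0: "h n > 0" "h n \<le> 1" for n by (auto simp: h_def)
  have hlim: "h \<longlonglongrightarrow> 0" unfolding h_def by real_asymp
  define s where "s n z = (F (z + h n *\<^sub>R b) - F z) / h n" for n z
  have shift: "integrable lborel (\<lambda>z. F (z + c))" "(LINT z|lborel. F (z + c)) = (LINT z|lborel. F z)" for c
  proof -
    have "integrable (distr lborel borel ((+) c)) F" using int lborel_distr_plus[of c] by simp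
    then show "integrable lborel (\<lambda>z. F (z + c))"
      by (subst (asm) integrable_distr_eq) (use int in \<open>auto simp: add.commute\<close>)
    have "(LINT z|lborel. F z) = (LINT z|distr lborel borel ((+) c). F z)" using lborel_distr_plus[of c] by simp
    also have "\<dots> = (LINT z|lborel. F (c + z))"
      by (rule integral_distr) (use int in auto)
    finally show "(LINT z|lborel. F (z + c)) = (LINT z|lborel. F z)" by (simp add: add.commute)
  qed
  have s_int: "integrable lborel (s n)" for n
    unfolding s_def using shift(1) int by auto
  have s0: "(LINT z|lborel. s n z) = 0" for n
    unfolding s_def using shift int by simp
  have slim: "(\<lambda>n. s n z) \<longlonglongrightarrow> D z" for z
  proof -
    have "((\<lambda>t. (F (z + t *\<^sub>R b) - F z) / t) \<longlongrightarrow> D z) (at 0)"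
      using der[of z] by (simp add: has_pder_def has_field_derivative_iff)
    moreover have "filterlim h (at 0) sequentially"
      using hlim h0(1) by (intro filterlim_atI) (auto simp: less_le)
    ultimately show ?thesis unfolding s_def by (rule filterlim_compose)
  qed
  have meas: "D \<in> borel_measurable lborel"
    by (rule borel_measurable_LIMSEQ_real[OF slim]) (use s_int in auto)
  have dom: "norm (s n z) \<le> \<bar>M\<bar> * indicator (cball 0 (\<bar>R\<bar> + norm b)) z" for n z
  proof (cases "norm z \<le> \<bar>R\<bar> + norm b")
    case True
    obtain \<xi> where "0 < \<xi>" "\<xi> < h n" "F (z + h n *\<^sub>R b) - F (z + 0 *\<^sub>R b) = (h n - 0) * D (z + \<xi> *\<^sub>R b)"
      using MVT2[of 0 "h n" "\<lambda>t. F (z + t *\<^sub>R b)" "\<lambda>t. D (z + t *\<^sub>R b)"] h0(1)[of n] has_pder_line[OF der] by blast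
    then have "s n z = D (z + \<xi> *\<^sub>R b)" using h0(1)[of n] by (simp add: s_def)
    then show ?thesis using bd[of "z + \<xi> *\<^sub>R b"] True by simp
  next
    case False
    have "norm (h n *\<^sub>R b) \<le> norm b" using h0[of n] by (simp add: mult_left_le_one_le)
    then have "norm (z + h n *\<^sub>R b) > \<bar>R\<bar>" using False norm_diff_ineq[of z "h n *\<^sub>R b"] by linarith
    then have "F (z + h n *\<^sub>R b) = 0" "F z = 0" using supp[of z] supp[of "z + h n *\<^sub>R b"] False norm_ge_zero[of b]
      by linarith+
    then show ?thesis by (simp add: s_def)
  qed
  have "(\<lambda>n. LINT z|lborel. s n z) \<longlonglongrightarrow> (LINT z|lborel. D z)"
  proof (rule integral_dominated_convergence)
    show "integrable lborel (\<lambda>z::'a. \<bar>M\<bar> * indicator (cball 0 (\<bar>R\<bar> + norm b)) z)"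
      by (intro integrable_mult_right integrable_real_indicator emeasure_bounded_finite) auto
  qed (use meas s_int slim dom in auto)
  then show ?thesis using LIMSEQ_unique s0 by (simp add: tendsto_const LIMSEQ_const_iff)
qed

lemma integrable_mult_compact_supp:
  fixes f \<phi> :: "'a::euclidean_space \<Rightarrow> real"
  assumes "continuous_on S f" "cball p \<rho> \<subseteq> S" "continuous_on UNIV \<phi>" "\<And>z. \<rho> \<le> norm (z - p) \<Longrightarrow> \<phi> z = 0"
  shows "integrable lborel (\<lambda>z. f z * \<phi> z)"
proof -
  have "integrable lborel (\<lambda>z. indicator (cball p \<rho>) z *\<^sub>R (f z * \<phi> z))"
    using assms by (intro borel_integrable_compact continuous_intros) (auto intro: continuous_on_subset)
  moreover have "indicator (cball p \<rho>) z *\<^sub>R (f z * \<phi> z) = f z * \<phi> z" for z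
    using assms(4)[of z] by (cases "z \<in> cball p \<rho>") (auto simp: dist_norm norm_minus_commute)
  ultimately show ?thesis by (simp only: o_def)
qed

text \<open>The distributional equation \<open>\<Delta> f = F\<close> on \<open>S\<close>, tested only against the bumps supported in \<open>S\<close>. The class is
closed under linear combinations and reflections, contains both the twice differentiable
functions and the distributional solutions, and still satisfies the maximum principle.\<close>

definition weak_lap :: "complex set \<Rightarrow> (complex \<Rightarrow> real) \<Rightarrow> (complex \<Rightarrow> real) \<Rightarrow> bool" where
  "weak_lap S f F \<longleftrightarrow> continuous_on S f \<and> continuous_on S F \<and>
     (\<forall>p \<rho> \<eta>. 0 < \<rho> \<longrightarrow> 0 < \<eta> \<longrightarrow> cball p \<rho> \<subseteq> S \<longrightarrow>
        (LINT z|lborel. f z * bump_lap p \<rho> \<eta> z) = (LINT z|lborel. F z * bump p \<rho> \<eta> z))"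

lemma weak_lap_subset: "weak_lap S f F \<Longrightarrow> T \<subseteq> S \<Longrightarrow> weak_lap T f F"
  unfolding weak_lap_def using continuous_on_subset by blast

lemma weak_lap_integrable:
  assumes "weak_lap S f F" "0 < \<rho>" "0 < \<eta>" "cball p \<rho> \<subseteq> S"
  shows "integrable lborel (\<lambda>z. f z * bump_lap p \<rho> \<eta> z)" "integrable lborel (\<lambda>z. F z * bump p \<rho> \<eta> z)"
proof -
  have c: "continuous_on S f" "continuous_on S F" using assms(1) by (auto simp: weak_lap_def)
  show "integrable lborel (\<lambda>z. f z * bump_lap p \<rho> \<eta> z)"
    by (rule integrable_mult_compact_supp[OF c(1) assms(4) bump_cont(4)[OF assms(3)] bump_lap_outside[OF assms(3,2)]])
  show "integrable lborel (\<lambda>z. F z * bump p \<rho> \<eta> z)"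
    by (rule integrable_mult_compact_supp[OF c(2) assms(4) bump_cont(1)[OF assms(3)] bump_outside(1)[OF assms(3,2)]])
qed

lemma weak_lap_lincomb:
  assumes "weak_lap S f F" "weak_lap S g G"
  shows "weak_lap S (\<lambda>z. f z + c * g z) (\<lambda>z. F z + c * G z)"
  unfolding weak_lap_def
proof (intro conjI allI impI)
  fix p :: complex and \<rho> \<eta> :: real assume pos: "0 < \<rho>" "0 < \<eta>" "cball p \<rho> \<subseteq> S"
  show "(LINT z|lborel. (f z + c * g z) * bump_lap p \<rho> \<eta> z) = (LINT z|lborel. (F z + c * G z) * bump p \<rho> \<eta> z)"
    using assms pos weak_lap_integrable[OF assms(1) pos] weak_lap_integrable[OF assms(2) pos]
    by (simp add: weak_lap_def distrib_right mult.assoc)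
qed (use assms in \<open>auto simp: weak_lap_def intro!: continuous_intros\<close>)

lemma weak_lap_diff:
  assumes "weak_lap S f F" "weak_lap S g G"
  shows "weak_lap S (\<lambda>z. f z - g z) (\<lambda>z. F z - G z)"
  using weak_lap_lincomb[OF assms, of "-1"] by simp

lemma weak_lap_minus:
  assumes "weak_lap S f F"
  shows "weak_lap S (\<lambda>z. - f z) (\<lambda>z. - F z)"
  using weak_lap_lincomb[OF assms assms, of "-2"] by (simp add: algebra_simps)

text \<open>Integration by parts twice: \<open>E \<partial>\<^sup>2 \<phi> - \<phi> \<partial>\<^sup>2 E\<close> is the derivative of the compactly supported
\<open>E \<partial> \<phi> - \<phi> \<partial> E\<close>. The function \<open>E\<close> is uncontrolled outside \<open>S\<close>, where the bump vanishes identically.\<close>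

lemma weak_lap_C2:
  fixes E :: "complex \<Rightarrow> real" and E1 E2 :: "complex \<Rightarrow> complex \<Rightarrow> real"
  assumes S: "open S"
    and 1: "\<And>b z. b \<in> Basis \<Longrightarrow> z \<in> S \<Longrightarrow> has_pder b E (E1 b z) z"
    and 2: "\<And>b z. b \<in> Basis \<Longrightarrow> z \<in> S \<Longrightarrow> has_pder b (E1 b) (E2 b z) z"
    and c0: "continuous_on S E" and c1: "\<And>b. b \<in> Basis \<Longrightarrow> continuous_on S (E1 b)"
    and c2: "\<And>b. b \<in> Basis \<Longrightarrow> continuous_on S (E2 b)"
  shows "weak_lap S E (\<lambda>z. \<Sum>b\<in>Basis. E2 b z)"
  unfolding weak_lap_def
proof (intro conjI allI impI)
  fix p :: complex and \<rho> \<eta> :: real assume pos: "0 < \<rho>" "0 < \<eta>" "cball p \<rho> \<subseteq> S"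
  note out = bump_outside[OF pos(2,1), where p = p]
  have *: "(LINT z|lborel. E z * bump_pder2 p \<rho> \<eta> b z) = (LINT z|lborel. E2 b z * bump p \<rho> \<eta> z)"
     and ints: "integrable lborel (\<lambda>z. E z * bump_pder2 p \<rho> \<eta> b z)" "integrable lborel (\<lambda>z. E2 b z * bump p \<rho> \<eta> z)"
    if b: "b \<in> Basis" for b
  proof -
    define F where "F z = E z * bump_pder p \<rho> \<eta> b z - E1 b z * bump p \<rho> \<eta> z" for z
    define D where "D z = E z * bump_pder2 p \<rho> \<eta> b z - E2 b z * bump p \<rho> \<eta> z" for z
    have nb: "norm b = 1" using b by (rule norm_Basis)
    note ints = integrable_mult_compact_supp[OF c0 pos(3) bump_cont(3)[OF pos(2)] out(3), of b]
        integrable_mult_compact_supp[OF c2[OF b] pos(3) bump_cont(1)[OF pos(2)] out(1)]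
    show "integrable lborel (\<lambda>z. E z * bump_pder2 p \<rho> \<eta> b z)" "integrable lborel (\<lambda>z. E2 b z * bump p \<rho> \<eta> z)"
      using ints by simp_all
      have "continuous_on (cball p \<rho>) D" unfolding D_def
        using pos(3) bump_cont(1,3)[OF pos(2)] c0 c2[OF b] by (intro continuous_intros) (auto intro: continuous_on_subset)
      then have "bounded (D ` cball p \<rho>)" by (intro compact_imp_bounded compact_continuous_image) auto
      then obtain M where M: "\<forall>z\<in>cball p \<rho>. norm (D z) \<le> M" unfolding bounded_iff by auto
    have "(LINT z|lborel. D z) = 0"
    proof (rule integral_pder_eq_0[where F = F and b = b])
      show "integrable lborel F" unfolding F_def
        by (intro Bochner_Integration.integrable_diff integrable_mult_compact_supp[OF c0 pos(3) bump_cont(2)[OF pos(2)] out(2)]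
            integrable_mult_compact_supp[OF c1[OF b] pos(3) bump_cont(1)[OF pos(2)] out(1)])
      show "norm z \<le> norm p + \<rho>" if "F z \<noteq> 0" for z
        using that out[of z] norm_triangle_sub[of z p] by (cases "\<rho> \<le> norm (z - p)") (auto simp: F_def)
      show "has_pder b F (D z) z" for z
      proof (cases "z \<in> S")
        case True
        have B: "has_pder b (bump p \<rho> \<eta>) (bump_pder p \<rho> \<eta> b z) z"
          by (rule has_derivative_pder[OF bump_has_derivative[OF pos(2)]])
        have B1: "has_pder b (bump_pder p \<rho> \<eta> b) (bump_pder2 p \<rho> \<eta> b z) z"
          using bump_pder_has_derivative[OF pos(2), of p \<rho> b z] has_derivative_pder nb by metis
        show ?thesis
          using 1[OF b True] 2[OF b True] B B1 unfolding has_pder_def F_def D_def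
          by (auto intro!: derivative_eq_intros)
      next
        case False
        then have "z \<in> - cball p \<rho>" using pos(3) by auto
        then obtain e where e: "e > 0" "ball z e \<subseteq> - cball p \<rho>"
          using openE[of "- cball p \<rho>" z] by (auto simp: closed_cball open_Compl)
        have z0: "F w = 0 \<and> D w = 0" if "w \<in> ball z e" for w
        proof -
          have "w \<notin> cball p \<rho>" using e that by auto
          then have "\<rho> \<le> norm (w - p)" by (simp add: dist_norm norm_minus_commute)
          then show ?thesis using out[of w] by (simp add: F_def D_def)
        qed
        have "((\<lambda>t. F (z + t *\<^sub>R b)) has_real_derivative 0) (at 0)"
        proof (rule DERIV_cong_ev[THEN iffD1, OF refl _ refl DERIV_const[of 0]])
          show "\<forall>\<^sub>F t in nhds 0. 0 = F (z + t *\<^sub>R b)"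
            unfolding eventually_nhds_metric
            by (rule exI[of _ e]) (use e z0 nb in \<open>auto simp: dist_norm\<close>)
        qed
        then show ?thesis using z0[of z] e by (simp add: has_pder_def)
      qed
      show "\<bar>D z\<bar> \<le> \<bar>M\<bar>" for z
      proof (cases "z \<in> cball p \<rho>")
        case False
        then show ?thesis using out[of z] by (simp add: D_def dist_norm norm_minus_commute)
      qed (use M in force)
    qed
    then show "(LINT z|lborel. E z * bump_pder2 p \<rho> \<eta> b z) = (LINT z|lborel. E2 b z * bump p \<rho> \<eta> z)"
      using ints unfolding D_def by simp
  qed
  have "(LINT z|lborel. E z * bump_lap p \<rho> \<eta> z) = (LINT z|lborel. (\<Sum>b\<in>Basis. E z * bump_pder2 p \<rho> \<eta> b z))"
    using bump_lap_eq[OF \<open>0 < \<eta>\<close>] by (simp flip: sum_distrib_left)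
  also have "\<dots> = (\<Sum>b\<in>Basis. LINT z|lborel. E z * bump_pder2 p \<rho> \<eta> b z)"
    using ints by (intro Bochner_Integration.integral_sum) auto
  also have "\<dots> = (\<Sum>b\<in>Basis. LINT z|lborel. E2 b z * bump p \<rho> \<eta> z)"
    using * by simp
  also have "\<dots> = (LINT z|lborel. (\<Sum>b\<in>Basis. E2 b z * bump p \<rho> \<eta> z))"
    using ints by (intro Bochner_Integration.integral_sum[symmetric]) auto
  finally show "(LINT z|lborel. E z * bump_lap p \<rho> \<eta> z) = (LINT z|lborel. (\<Sum>b\<in>Basis. E2 b z) * bump p \<rho> \<eta> z)"
    by (simp add: sum_distrib_right)
qed (use c0 c2 in \<open>auto intro!: continuous_intros\<close>)

lemma weak_lap_of_distr:
  assumes "distr_laplacian_eq \<psi> w" "continuous_on S \<psi>" "continuous_on S w"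
  shows "weak_lap S \<psi> w"
proof -
  have "laplacian (bump p \<rho> \<eta>) = bump_lap p \<rho> \<eta>" if "\<eta> > 0" for p :: complex and \<rho> \<eta> :: real
    using laplacian_bump[OF that, of p \<rho>] bump_lap_eq[OF that, of p \<rho>] by (intro ext) simp
  then show ?thesis using assms test_function_bump unfolding weak_lap_def distr_laplacian_eq_def by metis
qed

section \<open>The strong maximum principle\<close>

lemma lborel_integral_affine:
  fixes p :: "'a::euclidean_space" and \<phi> :: "'a \<Rightarrow> real"
  assumes "\<eta> > 0" "\<phi> \<in> borel_measurable borel"
  shows "(LINT z|lborel. \<phi> z) = (LINT y|lborel. \<eta> ^ DIM('a) * \<phi> (p + \<eta> *\<^sub>R y))"
proof -
  have "(LINT z|lborel. \<phi> z) = (LINT z|density (distr lborel borel (\<lambda>x. p + \<eta> *\<^sub>R x)) (\<lambda>_. \<bar>\<eta>\<bar>^DIM('a)). \<phi> z)"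
    using lborel_affine[of \<eta> p] assms(1) by simp
  also have "\<dots> = (LINT z|distr lborel borel (\<lambda>x. p + \<eta> *\<^sub>R x). \<bar>\<eta>\<bar>^DIM('a) * \<phi> z)"
    by (subst integral_density) (use assms in auto)
  also have "\<dots> = (LINT y|lborel. \<bar>\<eta>\<bar> ^ DIM('a) * \<phi> (p + \<eta> *\<^sub>R y))"
    by (subst integral_distr) (use assms in auto)
  finally show ?thesis using assms(1) by simp
qed

lemma nn_integral_inverse_1_plus_square: "(\<integral>\<^sup>+(x::real). ennreal (1 / (1 + x\<^sup>2)) \<partial>lborel) < \<infinity>"
proof -
  let ?f = "\<lambda>x::real. ennreal (1 / (1 + x\<^sup>2))"
  have half: "(\<integral>\<^sup>+x. ?f x * indicator {0..} x \<partial>lborel) = ennreal (pi / 2 - arctan 0)"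
    by (rule nn_integral_FTC_atLeast[OF _ _ _ tendsto_arctan_at_top])
       (auto intro!: derivative_eq_intros simp: inverse_eq_divide)
  have "(\<integral>\<^sup>+x. ?f x \<partial>lborel) \<le> (\<integral>\<^sup>+x. ?f x * indicator {0..} x + ?f x * indicator {..0} x \<partial>lborel)"
    by (intro nn_integral_mono) (auto simp: indicator_def)
  also have "\<dots> = (\<integral>\<^sup>+x. ?f x * indicator {0..} x \<partial>lborel) + (\<integral>\<^sup>+x. ?f x * indicator {..0} x \<partial>lborel)"
    by (rule nn_integral_add) auto
  also have "(\<integral>\<^sup>+x. ?f x * indicator {..0} x \<partial>lborel) = (\<integral>\<^sup>+x. ?f x * indicator {0..} x \<partial>lborel)"
    by (subst nn_integral_real_affine[where c = "-1" and t = 0])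
       (auto intro!: nn_integral_cong simp: indicator_def)
  finally have "(\<integral>\<^sup>+x. ?f x \<partial>lborel) \<le> ennreal (pi / 2) + ennreal (pi / 2)" by (simp add: half)
  also have "\<dots> < \<infinity>" by simp
  finally show ?thesis .
qed

text \<open>Bounding the kernel by \<open>4 / ((1 + x\<^sup>2) (1 + y\<^sup>2))\<close> reduces the claim to the one-dimensional integral
of \<open>1 / (1 + x\<^sup>2)\<close> and avoids polar coordinates.\<close>

lemma integrable_planar_kernel: "integrable lborel (\<lambda>y::complex. 4 / (1 + (norm y)\<^sup>2)\<^sup>2)"
proof (rule integrableI_bounded)
  have "(\<integral>\<^sup>+(y::complex). ennreal (norm (4 / (1 + (norm y)\<^sup>2)\<^sup>2)) \<partial>lborel)
     \<le> (\<integral>\<^sup>+(y::complex). ennreal 4 * (\<Prod>b\<in>Basis. ennreal (1 / (1 + (y \<bullet> b)\<^sup>2))) \<partial>lborel)"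
  proof (intro nn_integral_mono)
    fix y :: complex
    let ?a = "(Re y)\<^sup>2" and ?b = "(Im y)\<^sup>2"
    have "(1 + s) * (1 + t) \<le> (1 + (s + t))\<^sup>2" if "0 \<le> s" "0 \<le> t" for s t :: real
      using that by (simp add: power2_eq_square algebra_simps)
    then have "(1 + ?a) * (1 + ?b) \<le> (1 + (?a + ?b))\<^sup>2" by simp
    moreover have "0 < (1 + ?a) * (1 + ?b)" by (intro mult_pos_pos add_pos_nonneg) auto
    ultimately have "4 / (1 + (?a + ?b))\<^sup>2 \<le> 4 / ((1 + ?a) * (1 + ?b))"
      by (intro divide_left_mono mult_pos_pos) (auto intro: add_pos_nonneg)
    then show "ennreal (norm (4 / (1 + (norm y)\<^sup>2)\<^sup>2)) \<le> ennreal 4 * (\<Prod>b\<in>Basis. ennreal (1 / (1 + (y \<bullet> b)\<^sup>2)))"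
      by (simp add: Basis_complex_def cmod_power2 ennreal_mult'[symmetric] ennreal_leI del: ennreal_numeral)
  qed
  also have "\<dots> = ennreal 4 * (\<Prod>b\<in>(Basis::complex set). (\<integral>\<^sup>+x. ennreal (1 / (1 + x\<^sup>2)) \<partial>lborel))"
    using nn_integral_lborel_prod[of "\<lambda>(b::complex) x. ennreal (1 / (1 + x\<^sup>2))"]
    by (subst nn_integral_cmult) auto
  also have "\<dots> < \<infinity>"
    using nn_integral_inverse_1_plus_square by (auto simp: Basis_complex_def ennreal_mult_less_top)
  finally show "(\<integral>\<^sup>+(y::complex). ennreal (norm (4 / (1 + (norm y)\<^sup>2)\<^sup>2)) \<partial>lborel) < \<infinity>" .
qed auto

text \<open>Substituting \<open>z = p + \<eta> y\<close> turns the kernel into a fixed integrable function of \<open>y\<close>, while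
\<open>h(p + \<eta> y) \<rightarrow> h(p) = 0\<close> pointwise.\<close>

lemma approx_identity_vanishes:
  fixes h :: "complex \<Rightarrow> real"
  assumes meas: "h \<in> borel_measurable borel" and bd: "\<And>z. \<bar>h z\<bar> \<le> M" and cont: "isCont h p" "h p = 0"
    and \<eta>: "\<And>n. \<eta> n > 0" "\<eta> \<longlonglongrightarrow> 0"
  shows "(\<lambda>n. LINT z|lborel. h z * (4 * (\<eta> n)\<^sup>2 / (reg_sq p (\<eta> n) z)\<^sup>2)) \<longlonglongrightarrow> 0"
proof -
  have [measurable]: "reg_sq p c \<in> borel_measurable borel" for c :: real and p :: complex
    unfolding reg_sq_def by measurable
  have q: "reg_sq p \<eta> (p + \<eta> *\<^sub>R y) = \<eta>\<^sup>2 * (1 + (norm y)\<^sup>2)" for y and \<eta> :: real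
    by (simp add: reg_sq_def power_mult_distrib algebra_simps)
  have eq: "(LINT z|lborel. h z * (4 * (\<eta> n)\<^sup>2 / (reg_sq p (\<eta> n) z)\<^sup>2))
      = (LINT y|lborel. h (p + \<eta> n *\<^sub>R y) * (4 / (1 + (norm y)\<^sup>2)\<^sup>2))" for n
    by (subst lborel_integral_affine[OF \<eta>(1)[of n], where p = p])
       (use meas \<eta>(1)[of n] in \<open>auto simp: q power_mult_distrib power2_eq_square intro!: Bochner_Integration.integral_cong\<close>)
  have "(\<lambda>n. LINT y|lborel. h (p + \<eta> n *\<^sub>R y) * (4 / (1 + (norm y)\<^sup>2)\<^sup>2)) \<longlonglongrightarrow> (LINT (y::complex)|lborel. 0)"
  proof (rule integral_dominated_convergence)
    show "integrable lborel (\<lambda>y::complex. \<bar>M\<bar> * (4 / (1 + (norm y)\<^sup>2)\<^sup>2))"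
      using integrable_planar_kernel by (rule integrable_mult_right)
    have "(\<lambda>n. h (p + \<eta> n *\<^sub>R y) * (4 / (1 + (norm y)\<^sup>2)\<^sup>2)) \<longlonglongrightarrow> 0 * (4 / (1 + (norm y)\<^sup>2)\<^sup>2)" for y
    proof (intro tendsto_mult tendsto_const)
      have "(\<lambda>n. p + \<eta> n *\<^sub>R y) \<longlonglongrightarrow> p + 0 *\<^sub>R y" by (intro tendsto_intros \<eta>)
      then have "(\<lambda>n. p + \<eta> n *\<^sub>R y) \<longlonglongrightarrow> p" by simp
      from isCont_tendsto_compose[OF cont(1) this] show "(\<lambda>n. h (p + \<eta> n *\<^sub>R y)) \<longlonglongrightarrow> 0" using cont(2) by simp
    qed
    then show "AE y in lborel. (\<lambda>n. h (p + \<eta> n *\<^sub>R y) * (4 / (1 + (norm y)\<^sup>2)\<^sup>2)) \<longlonglongrightarrow> 0" by simp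
    show "AE y in lborel. norm (h (p + \<eta> n *\<^sub>R y) * (4 / (1 + (norm y)\<^sup>2)\<^sup>2)) \<le> \<bar>M\<bar> * (4 / (1 + (norm y)\<^sup>2)\<^sup>2)" for n
      unfolding norm_mult using bd order_trans[OF bd abs_ge_self]
      by (intro AE_I2 mult_mono) auto
  qed (use meas in auto)
  then show ?thesis unfolding eq by simp
qed

lemma weak_lap_paraboloid:
  "weak_lap UNIV (\<lambda>z. a + c * (norm (z - p))\<^sup>2) (\<lambda>_. 4 * c)"
proof -
  have "weak_lap UNIV (\<lambda>z. a + c * (norm (z - p))\<^sup>2) (\<lambda>z. \<Sum>b\<in>(Basis::complex set). 2 * c)"
    by (rule weak_lap_C2[where ?E1.0 = "\<lambda>b z. 2 * c * ((z - p) \<bullet> b)"])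
       (auto intro!: continuous_intros derivative_eq_intros simp: has_pder_def power2_norm_eq_inner inner_Basis inner_commute algebra_simps)
  then show ?thesis by (simp add: Basis_complex_def)
qed

lemma flat_exp_lower_bound:
  assumes "0 < a" "a \<le> x" "x \<le> b"
  shows "exp (- 1 / a) / b ^ n \<le> flat_exp n x"
proof -
  have "1 / x \<le> 1 / a" using assms by (intro frac_le) auto
  then have "exp (- 1 / a) \<le> exp (- 1 / x)" by simp
  then have "exp (- 1 / a) / b ^ n \<le> exp (- 1 / x) / x ^ n"
    using assms by (intro frac_le power_mono) auto
  then show ?thesis using assms by (simp add: flat_exp_def)
qed

text \<open>Strong maximum principle. Subtract a small paraboloid, \<open>h(z) = f(z) - f(p) - c |z - p|\<^sup>2\<close>, such that
\<open>\<Delta> h \<ge> 0\<close> near \<open>p\<close> still holds while \<open>h(p) = 0\<close> and \<open>h < 0\<close> elsewhere. Testing with the bump gives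
\<open>0 \<le> \<integral> h \<Delta>bump\<close>. The part of \<open>\<Delta>bump\<close> concentrating at \<open>p\<close> contributes nothing in the limit because
\<open>h(p) = 0\<close>; the convexity part is positive on an annulus, uniformly in \<open>\<eta>\<close>, and makes the limit
negative.\<close>

lemma weak_lap_no_max:
  assumes wk: "weak_lap S f F" and S: "open S" "p \<in> S" and pos: "F p > 0"
    and max: "\<And>z. z \<in> S \<Longrightarrow> f z \<le> f p"
  shows False
proof -
  define c where "c = F p / 8"
  have c: "c > 0" using pos by (simp add: c_def)
  have contF: "continuous_on S F" and contf: "continuous_on S f" using wk by (auto simp: weak_lap_def)
  obtain \<rho> where \<rho>: "\<rho> > 0" "cball p \<rho> \<subseteq> S" "\<And>z. z \<in> cball p \<rho> \<Longrightarrow> F z \<ge> 4 * c"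
  proof -
    have "isCont F p" using contF S continuous_on_eq_continuous_at by blast
    then have "\<forall>\<^sub>F z in nhds p. F z > 4 * c"
      using pos unfolding isCont_def by (intro eventually_nhds_conv_at[THEN iffD2] conjI order_tendstoD) (auto simp: c_def)
    moreover have "\<forall>\<^sub>F z in nhds p. z \<in> S" using S by (simp add: eventually_nhds_in_open)
    ultimately have "\<forall>\<^sub>F z in nhds p. F z > 4 * c \<and> z \<in> S" by eventually_elim auto
    then obtain e where e: "e > 0" "\<forall>z. dist z p < e \<longrightarrow> F z > 4 * c \<and> z \<in> S"
      unfolding eventually_nhds_metric by blast
    show ?thesis
      by (rule that[of "e / 2"]) (use e in \<open>auto simp: dist_commute intro: less_imp_le\<close>)
  qed
  define h where "h z = f z - (f p + c * (norm (z - p))\<^sup>2)" for z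
  have h: "h z \<le> - c * (norm (z - p))\<^sup>2" if "z \<in> S" for z using max[OF that] by (simp add: h_def)
  have wkh: "weak_lap S h (\<lambda>z. F z - 4 * c)"
    unfolding h_def using weak_lap_diff[OF wk weak_lap_subset[OF weak_lap_paraboloid subset_UNIV]] by simp
  have conth: "continuous_on (cball p \<rho>) h" using wkh \<rho>(2) by (auto simp: weak_lap_def intro: continuous_on_subset)
  define H where "H z = indicator (cball p \<rho>) z *\<^sub>R \<bar>h z\<bar>" for z
  have Hint: "integrable lborel H" unfolding H_def
    by (intro borel_integrable_compact continuous_intros conth) auto
  have "compact (h ` cball p \<rho>)" by (intro compact_continuous_image conth) auto
  then obtain M where "\<forall>z\<in>cball p \<rho>. \<bar>h z\<bar> \<le> M"
    using compact_imp_bounded[of "h ` cball p \<rho>"] by (auto simp: bounded_iff)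
  note M = this[rule_format]
  have HM: "\<bar>H z\<bar> \<le> M" for z using M[of z] M[of p] \<rho>(1) by (auto simp: H_def indicator_def)
  define \<eta> where "\<eta> n = \<rho> / (4 * (real n + 1))" for n
  have \<eta>: "\<eta> n > 0" "\<eta> n \<le> \<rho> / 4" for n using \<rho>(1) by (auto simp: \<eta>_def field_simps)
  have \<eta>lim: "\<eta> \<longlonglongrightarrow> 0" unfolding \<eta>_def by real_asymp
  have "isCont H p"
  proof -
    have "isCont h p" using conth continuous_on_interior[of "cball p \<rho>" h p] \<rho>(1) by (simp add: interior_cball)
    then have "isCont (\<lambda>z. \<bar>h z\<bar>) p" by simp
    moreover have "\<forall>\<^sub>F z in nhds p. \<bar>h z\<bar> = H z"
      unfolding eventually_nhds_metric by (rule exI[of _ \<rho>]) (use \<rho>(1) in \<open>auto simp: H_def dist_commute\<close>)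
    ultimately show ?thesis using isCont_cong[of "\<lambda>z. \<bar>h z\<bar>" H p] by simp
  qed
  moreover have "H p = 0" by (simp add: H_def h_def)
  ultimately have lim: "(\<lambda>n. LINT z|lborel. H z * (4 * (\<eta> n)\<^sup>2 / (reg_sq p (\<eta> n) z)\<^sup>2)) \<longlonglongrightarrow> 0"
    using Hint HM \<eta>(1) \<eta>lim by (intro approx_identity_vanishes[where M = M]) auto
  \<comment> \<open>On the disc \<open>A\<close>, which lies in the annulus \<open>\<rho>/4 \<le> |z - p| \<le> \<rho>/2\<close>, and for \<open>\<eta> \<le> \<rho>/4\<close> the logarithm lies
between \<open>ln (16/5)\<close> and \<open>ln 16\<close>; thus \<open>e0\<close> bounds \<open>\<Phi>''\<close> from below and \<open>- \<kappa>\<close> bounds the convexity part from above.\<close>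
  define e0 :: real where "e0 = exp (- 1 / ln (16 / 5)) / ln 16 ^ 3"
  have e0: "e0 > 0" by (auto simp: e0_def)
  define A where "A = ball (p + of_real (3 * \<rho> / 8)) (\<rho> / 8)"
  define \<kappa> where "\<kappa> = e0 * (4 * c / 25)"
  have \<kappa>: "\<kappa> > 0" using e0 c by (simp add: \<kappa>_def)
  have A: "\<rho> / 4 \<le> norm (z - p)" "norm (z - p) \<le> \<rho> / 2" if "z \<in> A" for z
  proof -
    have d: "norm (z - p - of_real (3 * \<rho> / 8)) < \<rho> / 8"
      using that by (simp add: A_def dist_norm norm_minus_commute algebra_simps)
    have n: "norm (complex_of_real (3 * \<rho> / 8)) = 3 * \<rho> / 8" using \<rho>(1) by (simp only: norm_of_real)
    show "\<rho> / 4 \<le> norm (z - p)" using norm_triangle_sub[of "complex_of_real (3 * \<rho> / 8)" "z - p"] d n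
      by (simp add: norm_minus_commute)
    show "norm (z - p) \<le> \<rho> / 2" using norm_triangle_sub[of "z - p" "complex_of_real (3 * \<rho> / 8)"] d n by simp
  qed
  have bound: "h z * bump_lap p \<rho> (\<eta> n) z \<le> H z * (4 * (\<eta> n)\<^sup>2 / (reg_sq p (\<eta> n) z)\<^sup>2) - \<kappa> * indicator A z" for z n
  proof (cases "z \<in> cball p \<rho>")
    case False
    then have "z \<notin> A" using A(2)[of z] \<rho>(1) by (auto simp: dist_norm norm_minus_commute)
    moreover have "bump_lap p \<rho> (\<eta> n) z = 0"
      using False by (intro bump_lap_outside \<eta> \<rho>) (auto simp: dist_norm norm_minus_commute)
    ultimately show ?thesis using False by (simp add: H_def)
  next
    case True
    let ?q = "reg_sq p (\<eta> n) z" and ?l = "log_ratio p \<rho> (\<eta> n) z" and ?r = "norm (z - p)"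
    have q: "?q > 0" using \<eta> reg_sq_pos by blast
    have hz: "h z \<le> - c * ?r\<^sup>2" using h True \<rho>(2) by blast
    have "0 \<le> c * ?r\<^sup>2" using c by simp
    with hz have h0: "h z \<le> 0" by simp
    have "h z * (flat_exp 3 ?l * (4 * ?r\<^sup>2 / ?q\<^sup>2)) \<le> - \<kappa> * indicator A z"
    proof (cases "z \<in> A")
      case True
      note r = A[OF True]
      have "?r\<^sup>2 \<le> (\<rho> / 2)\<^sup>2" "(\<rho> / 4)\<^sup>2 \<le> ?r\<^sup>2" "(\<eta> n)\<^sup>2 \<le> (\<rho> / 4)\<^sup>2"
        using r \<rho>(1) \<eta>[of n] by (intro power_mono; simp)+
      then have q1: "?q \<le> 5 * \<rho>\<^sup>2 / 16" and q2: "\<rho>\<^sup>2 / 16 \<le> ?q" and r2: "\<rho>\<^sup>2 / 16 \<le> ?r\<^sup>2"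
        by (auto simp: reg_sq_def power_divide add_increasing2)
      have l: "?l = ln (\<rho>\<^sup>2 / ?q)" using q \<rho>(1) by (simp add: log_ratio_def ln_div)
      have "16 / 5 \<le> \<rho>\<^sup>2 / ?q" "\<rho>\<^sup>2 / ?q \<le> 16" using q1 q2 q by (auto simp: field_simps)
      then have l1: "ln (16 / 5) \<le> ?l" "?l \<le> ln 16" unfolding l using q \<rho>(1) by (auto intro!: ln_mono divide_pos_pos)
      have l0: "ln (16 / 5 :: real) > 0" by simp
      have e: "e0 \<le> flat_exp 3 ?l"
        unfolding e0_def by (rule flat_exp_lower_bound[OF l0 l1])
      have "4 * c / 25 * ?q\<^sup>2 \<le> 4 * c / 25 * (5 * \<rho>\<^sup>2 / 16)\<^sup>2"
        using q1 q c by (intro mult_left_mono power_mono) auto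
      also have "\<dots> = 4 * c * ((\<rho>\<^sup>2 / 16) * (\<rho>\<^sup>2 / 16))" by (simp add: power2_eq_square)
      also have "\<dots> \<le> 4 * c * (?r\<^sup>2 * ?r\<^sup>2)" using r2 c by (intro mult_left_mono mult_mono) auto
      finally have "4 * c / 25 \<le> c * ?r\<^sup>2 * (4 * ?r\<^sup>2 / ?q\<^sup>2)" using q by (simp add: field_simps)
      then have "\<kappa> \<le> flat_exp 3 ?l * (c * ?r\<^sup>2 * (4 * ?r\<^sup>2 / ?q\<^sup>2))"
        unfolding \<kappa>_def using e e0 c by (intro mult_mono) auto
      moreover have "h z * (flat_exp 3 ?l * (4 * ?r\<^sup>2 / ?q\<^sup>2)) \<le> - c * ?r\<^sup>2 * (flat_exp 3 ?l * (4 * ?r\<^sup>2 / ?q\<^sup>2))"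
        using hz by (intro mult_right_mono mult_nonneg_nonneg flat_exp_nonneg) auto
      ultimately show ?thesis using True by (simp add: mult_ac)
    next
      case False
      have "0 \<le> flat_exp 3 ?l * (4 * ?r\<^sup>2 / ?q\<^sup>2)" using flat_exp_nonneg by simp
      have "indicat_real A z = 0" using False by simp
      with mult_nonpos_nonneg[OF h0 \<open>0 \<le> flat_exp 3 ?l * _\<close>] show ?thesis by (simp only: mult_zero_right)
    qed
    moreover have "- h z * ((flat_exp 0 ?l + flat_exp 1 ?l) * (4 * (\<eta> n)\<^sup>2 / ?q\<^sup>2)) \<le> H z * (4 * (\<eta> n)\<^sup>2 / ?q\<^sup>2)"
    proof -
      have "(flat_exp 0 ?l + flat_exp 1 ?l) * (4 * (\<eta> n)\<^sup>2 / ?q\<^sup>2) \<le> 1 * (4 * (\<eta> n)\<^sup>2 / ?q\<^sup>2)"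
        using flat_exp_slope_le_1[of ?l] by (rule mult_right_mono) simp
      then have "- h z * ((flat_exp 0 ?l + flat_exp 1 ?l) * (4 * (\<eta> n)\<^sup>2 / ?q\<^sup>2)) \<le> - h z * (1 * (4 * (\<eta> n)\<^sup>2 / ?q\<^sup>2))"
        using h0 by (intro mult_left_mono) auto
      moreover have "H z = - h z" using True h0 by (simp add: H_def)
      ultimately show ?thesis by simp
    qed
    ultimately show ?thesis unfolding bump_lap_def by (simp only: right_diff_distrib mult_minus_left)
  qed
  have le: "\<kappa> * measure lborel A \<le> (LINT z|lborel. H z * (4 * (\<eta> n)\<^sup>2 / (reg_sq p (\<eta> n) z)\<^sup>2))" for n
  proof -
    have Aint: "integrable lborel (\<lambda>z. \<kappa> * indicator A z)"
      unfolding A_def by (intro integrable_mult_right integrable_real_indicator emeasure_bounded_finite) auto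
    have "integrable lborel (\<lambda>z. indicator (cball p \<rho>) z *\<^sub>R (\<bar>h z\<bar> * (4 * (\<eta> n)\<^sup>2 / (reg_sq p (\<eta> n) z)\<^sup>2)))"
      using reg_sq_pos[OF \<eta>(1)] unfolding reg_sq_def
      by (intro borel_integrable_compact continuous_intros conth) (auto simp: less_le)
    then have Hqint: "integrable lborel (\<lambda>z. H z * (4 * (\<eta> n)\<^sup>2 / (reg_sq p (\<eta> n) z)\<^sup>2))"
      by (simp add: H_def mult.assoc)
    have "0 \<le> (LINT z|lborel. (F z - 4 * c) * bump p \<rho> (\<eta> n) z)"
    proof (intro Bochner_Integration.integral_nonneg)
      show "0 \<le> (F z - 4 * c) * bump p \<rho> (\<eta> n) z" for z
        using \<rho>(3)[of z] bump_nonneg[of p \<rho> "\<eta> n" z] bump_outside(1)[OF \<eta>(1) \<rho>(1), of z p n]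
        by (cases "z \<in> cball p \<rho>") (auto simp: dist_norm norm_minus_commute)
    qed
    also have "\<dots> = (LINT z|lborel. h z * bump_lap p \<rho> (\<eta> n) z)"
      using wkh \<eta>(1) \<rho> unfolding weak_lap_def by simp
    also have "\<dots> \<le> (LINT z|lborel. H z * (4 * (\<eta> n)\<^sup>2 / (reg_sq p (\<eta> n) z)\<^sup>2) - \<kappa> * indicator A z)"
      using bound Aint Hqint weak_lap_integrable(1)[OF wkh \<rho>(1) \<eta>(1) \<rho>(2)] by (intro integral_mono) auto
    also have "\<dots> = (LINT z|lborel. H z * (4 * (\<eta> n)\<^sup>2 / (reg_sq p (\<eta> n) z)\<^sup>2)) - \<kappa> * measure lborel A"
      using Aint Hqint by (simp add: A_def)
    finally show ?thesis by simp
  qed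
  have "\<kappa> * measure lborel A \<le> 0"
    using LIMSEQ_le_const[OF lim] le by blast
  moreover have "measure lborel A > 0" unfolding A_def using content_ball_pos[of "\<rho> / 8"] \<rho>(1) by simp
  ultimately show False using \<kappa> by (simp add: mult_le_0_iff)
qed

section \<open>Interior gradient estimate by reflection\<close>

lemma weak_lap_compact_max:
  assumes "weak_lap S f F" "open S" "compact K" "S \<subseteq> K" "continuous_on K f"
    and "\<And>z. z \<in> S \<Longrightarrow> F z > 0" "\<And>z. z \<in> K - S \<Longrightarrow> f z \<le> 0" "z \<in> K"
  shows "f z \<le> 0"
proof (rule ccontr)
  assume "\<not> f z \<le> 0"
  obtain p where p: "p \<in> K" "\<And>y. y \<in> K \<Longrightarrow> f y \<le> f p"
    using continuous_attains_sup[OF assms(3) _ assms(5)] assms(8) by blast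
  then have "f p > 0" using \<open>\<not> f z \<le> 0\<close> assms(8) by force
  then have "p \<in> S" using assms(7)[of p] p(1) by force
  then show False using weak_lap_no_max[OF assms(1,2)] assms(4,6) p(2) by blast
qed

definition reflect :: "'a::euclidean_space \<Rightarrow> 'a \<Rightarrow> 'a \<Rightarrow> 'a" where
  "reflect b z0 z = z - (2 * ((z - z0) \<bullet> b)) *\<^sub>R b"

lemma reflect_involution: "b \<in> Basis \<Longrightarrow> reflect b z0 (reflect b z0 z) = z"
  by (simp add: reflect_def inner_diff_left algebra_simps flip: scaleR_add_left)

lemma reflect_isometry:
  assumes "b \<in> Basis"
  shows "norm (reflect b z0 z - reflect b z0 w) = norm (z - w)"
proof -
  have "(norm (reflect b z0 z - reflect b z0 w))\<^sup>2 = (norm (z - w))\<^sup>2"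
    unfolding power2_norm_eq_inner reflect_def using assms
    by (simp add: inner_diff_left inner_diff_right inner_commute algebra_simps)
  then show ?thesis by simp
qed

lemma lborel_distr_reflect:
  fixes z0 :: "'a::euclidean_space"
  assumes "b \<in> Basis"
  shows "distr lborel borel (reflect b z0) = lborel"
proof -
  define c where "c j = (if j = b then - 1 else 1 :: real)" for j
  have "(2 * (z0 \<bullet> b)) *\<^sub>R b + (\<Sum>j\<in>Basis. (c j * (x \<bullet> j)) *\<^sub>R j) = reflect b z0 x" for x
  proof (rule euclidean_eqI)
    fix i :: 'a assume i: "i \<in> Basis"
    have "(\<Sum>j\<in>Basis. (c j * (x \<bullet> j)) *\<^sub>R j) \<bullet> i = c i * (x \<bullet> i)"
      using i by (rule inner_sum_left_Basis)
    then show "((2 * (z0 \<bullet> b)) *\<^sub>R b + (\<Sum>j\<in>Basis. (c j * (x \<bullet> j)) *\<^sub>R j)) \<bullet> i = reflect b z0 x \<bullet> i"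
      using i assms by (auto simp: reflect_def c_def inner_diff_left inner_add_left inner_Basis algebra_simps)
  qed
  then have T: "(\<lambda>x. (2 * (z0 \<bullet> b)) *\<^sub>R b + (\<Sum>j\<in>Basis. (c j * (x \<bullet> j)) *\<^sub>R j)) = reflect b z0" by auto
  have "lborel = density (distr lborel borel (reflect b z0)) (\<lambda>_. \<Prod>j\<in>Basis. \<bar>c j\<bar>)"
    using lborel_affine_euclidean[of c "(2 * (z0 \<bullet> b)) *\<^sub>R b"] unfolding T by (simp add: c_def)
  moreover have "(\<Prod>j\<in>(Basis::'a set). \<bar>c j\<bar>) = 1" by (intro prod.neutral) (auto simp: c_def)
  ultimately show ?thesis by (simp add: density_1)
qed

text \<open>The Laplacian commutes with reflections because the bump depends on \<open>|z - p|\<close> only.\<close>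

lemma weak_lap_reflect:
  assumes wk: "weak_lap S f F" and b: "b \<in> Basis"
  shows "weak_lap (reflect b z0 -` S) (\<lambda>z. f (reflect b z0 z)) (\<lambda>z. F (reflect b z0 z))"
proof -
  let ?R = "reflect b z0"
  have cR: "continuous_on X ?R" for X unfolding reflect_def by (intro continuous_intros)
  have [measurable]: "?R \<in> borel_measurable borel" using cR by (rule borel_measurable_continuous_onI)
  have q: "reg_sq p \<eta> z = reg_sq (?R p) \<eta> (?R z)" for p \<eta> z
    using reflect_isometry[OF b] by (simp add: reg_sq_def)
  have int: "(LINT z|lborel. g (?R z)) = (LINT z|lborel. g z)" if "integrable lborel g" for g :: "complex \<Rightarrow> real"
  proof -
    have "(LINT z|lborel. g z) = (LINT z|distr lborel borel ?R. g z)" using lborel_distr_reflect[OF b] by simp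
    also have "\<dots> = (LINT z|lborel. g (?R z))" by (rule integral_distr) (use that in auto)
    finally show ?thesis by simp
  qed
  show ?thesis
    unfolding weak_lap_def
  proof (intro conjI allI impI)
    show "continuous_on (?R -` S) (\<lambda>z. f (?R z))" "continuous_on (?R -` S) (\<lambda>z. F (?R z))"
      using wk cR unfolding weak_lap_def by (auto intro: continuous_on_compose2)
    fix p :: complex and \<rho> \<eta> :: real assume pos: "0 < \<rho>" "0 < \<eta>" and sub: "cball p \<rho> \<subseteq> ?R -` S"
    have sub': "cball (?R p) \<rho> \<subseteq> S"
    proof
      fix w assume "w \<in> cball (?R p) \<rho>"
      then have "norm (?R (?R p) - ?R w) \<le> \<rho>" unfolding reflect_isometry[OF b] by (simp add: dist_norm)
      then have "?R w \<in> cball p \<rho>" by (simp add: dist_norm reflect_involution[OF b])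
      then show "w \<in> S" using sub reflect_involution[OF b, of z0 w] by auto
    qed
    have "(LINT z|lborel. f (?R z) * bump_lap p \<rho> \<eta> z) = (LINT z|lborel. f (?R z) * bump_lap (?R p) \<rho> \<eta> (?R z))"
      unfolding bump_lap_def log_ratio_def q[of p] reflect_isometry[OF b, of z0 _ p, symmetric] ..
    also have "\<dots> = (LINT z|lborel. f z * bump_lap (?R p) \<rho> \<eta> z)"
      by (rule int[OF weak_lap_integrable(1)[OF wk pos sub']])
    also have "\<dots> = (LINT z|lborel. F z * bump (?R p) \<rho> \<eta> z)"
      using wk pos sub' by (simp add: weak_lap_def)
    also have "\<dots> = (LINT z|lborel. F (?R z) * bump (?R p) \<rho> \<eta> (?R z))"
      by (rule int[OF weak_lap_integrable(2)[OF wk pos sub'], symmetric])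
    also have "\<dots> = (LINT z|lborel. F (?R z) * bump p \<rho> \<eta> z)"
      unfolding bump_def log_ratio_def q[of p] ..
    finally show "(LINT z|lborel. f (?R z) * bump_lap p \<rho> \<eta> z) = (LINT z|lborel. F (?R z) * bump p \<rho> \<eta> z)" .
  qed
qed

text \<open>The odd part \<open>f(z) - f(reflect z)\<close> vanishes on the mirror, is at most \<open>2 M\<close> on the rest of the boundary
of the half square, and its Laplacian is at least \<open>-2 N\<close>. With \<open>X\<close> the distance to the mirror, the barrier
\<open>2 M |z - z0|\<^sup>2 / \<rho>\<^sup>2 + B X (\<rho> - X)\<close> dominates it: the first term handles the outer boundary, and \<open>B\<close> is
chosen such that the barrier has Laplacian \<open>8 M / \<rho>\<^sup>2 - 2 B = -4 N\<close>.\<close>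

lemma weak_lap_symmetric_difference_le:
  fixes z0 :: complex
  assumes wk: "weak_lap S f F" and b: "b \<in> Basis" and \<rho>: "\<rho> > 0" and N: "N > 0" and x: "0 \<le> x" "x \<le> \<rho>"
    and sub: "cbox (z0 - \<rho> *\<^sub>R One) (z0 + \<rho> *\<^sub>R One) \<subseteq> S"
    and M: "\<And>z. z \<in> cbox (z0 - \<rho> *\<^sub>R One) (z0 + \<rho> *\<^sub>R One) \<Longrightarrow> \<bar>f z\<bar> \<le> M"
    and F: "\<And>z. z \<in> cbox (z0 - \<rho> *\<^sub>R One) (z0 + \<rho> *\<^sub>R One) \<Longrightarrow> \<bar>F z\<bar> \<le> N"
  shows "f (z0 + x *\<^sub>R b) - f (z0 - x *\<^sub>R b) \<le> 2 * M / \<rho>\<^sup>2 * x\<^sup>2 + (4 * M / \<rho>\<^sup>2 + 2 * N) * x * \<rho>"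
proof -
  let ?Q = "cbox (z0 - \<rho> *\<^sub>R One) (z0 + \<rho> *\<^sub>R One)" and ?R = "reflect b z0"
  define B where "B = 4 * M / \<rho>\<^sup>2 + 2 * N"
  define X where "X z = (z - z0) \<bullet> b" for z
  define E where "E z = 0 + 2 * M / \<rho>\<^sup>2 * (norm (z - z0))\<^sup>2 + B * (X z * (\<rho> - X z))" for z
  define K where "K = ?Q \<inter> {z. z0 \<bullet> b \<le> z \<bullet> b}"
  \<comment> \<open>The open half square \<open>U\<close> lies in its compact closure \<open>K\<close>; \<open>K - U\<close> consists of the mirror and the outer sides.\<close>
  define U where "U = box (z0 - \<rho> *\<^sub>R One) (z0 + \<rho> *\<^sub>R One) \<inter> {z. z0 \<bullet> b < z \<bullet> b}"
  have memQ: "z \<in> ?Q \<longleftrightarrow> (\<forall>j\<in>Basis. \<bar>(z - z0) \<bullet> j\<bar> \<le> \<rho>)" for z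
    by (auto simp: mem_box inner_diff_left inner_add_left abs_le_iff algebra_simps)
  have membox: "z \<in> box (z0 - \<rho> *\<^sub>R One) (z0 + \<rho> *\<^sub>R One) \<longleftrightarrow> (\<forall>j\<in>Basis. \<bar>(z - z0) \<bullet> j\<bar> < \<rho>)" for z
    by (auto simp: mem_box inner_diff_left inner_add_left abs_less_iff algebra_simps)
  have RQ: "?R z \<in> ?Q" if "z \<in> ?Q" for z
    unfolding memQ
  proof
    fix j :: complex assume j: "j \<in> Basis"
    have "(?R z - z0) \<bullet> j = (if j = b then - ((z - z0) \<bullet> j) else (z - z0) \<bullet> j)"
      using j b by (auto simp: reflect_def inner_diff_left inner_Basis algebra_simps)
    then show "\<bar>(?R z - z0) \<bullet> j\<bar> \<le> \<rho>" using that j by (auto simp: memQ)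
  qed
  have z0Q: "z0 \<in> ?Q" using \<rho> by (auto simp: memQ)
  have M0: "M \<ge> 0" using M[OF z0Q] by linarith
  have B0: "B \<ge> 0" using M0 N \<rho> by (simp add: B_def)
  have UQ: "U \<subseteq> ?Q" using box_subset_cbox U_def by auto
  have UK: "U \<subseteq> K" using box_subset_cbox by (auto simp: U_def K_def intro: less_imp_le)
  have openU: "open U" unfolding U_def by (intro open_Int open_box open_halfspace_component_gt)
  have compK: "compact K" unfolding K_def by (intro compact_Int_closed compact_cbox closed_halfspace_component_ge)
  have wX: "weak_lap UNIV (\<lambda>z. X z * (\<rho> - X z)) (\<lambda>_. - 2)"
  proof -
    have "weak_lap UNIV (\<lambda>z. X z * (\<rho> - X z)) (\<lambda>z. \<Sum>j\<in>(Basis::complex set). if j = b then - 2 else 0)"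
    proof (rule weak_lap_C2[where ?E1.0 = "\<lambda>j z. (\<rho> - 2 * X z) * (if j = b then 1 else 0)"])
      fix j z :: complex assume j: "j \<in> Basis"
      have dX: "((\<lambda>t. X (z + t *\<^sub>R j)) has_real_derivative (if j = b then 1 else 0)) (at 0)"
        unfolding X_def inner_diff_left inner_add_left using j b
        by (auto intro!: derivative_eq_intros simp: inner_Basis)
      show "has_pder j (\<lambda>z. X z * (\<rho> - X z)) ((\<rho> - 2 * X z) * (if j = b then 1 else 0)) z"
        using DERIV_mult[OF dX DERIV_diff[OF DERIV_const[of \<rho>] dX]]
        by (cases "j = b") (simp_all add: has_pder_def algebra_simps)
      show "has_pder j (\<lambda>z. (\<rho> - 2 * X z) * (if j = b then 1 else 0)) (if j = b then - 2 else 0) z"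
        using DERIV_cmult_right[OF DERIV_diff[OF DERIV_const[of \<rho>] DERIV_cmult[OF dX, of 2]], of "if j = b then 1 else 0"]
        by (cases "j = b") (simp_all add: has_pder_def)
    qed (auto simp: X_def intro!: continuous_intros)
    then show ?thesis using b by simp
  qed
  have wE: "weak_lap UNIV E (\<lambda>_. - 4 * N)"
    using weak_lap_lincomb[OF weak_lap_paraboloid[of 0 "2 * M / \<rho>\<^sup>2" z0] wX, of B]
    unfolding E_def by (simp add: B_def)
  have wv: "weak_lap U (\<lambda>z. f z - f (?R z) - E z) (\<lambda>z. F z - F (?R z) - (- 4 * N))"
    using sub RQ UQ
    by (intro weak_lap_diff weak_lap_subset[OF wE] weak_lap_subset[OF wk] weak_lap_subset[OF weak_lap_reflect[OF wk b]]) auto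
  have cf: "continuous_on ?Q f" using wk sub by (auto simp: weak_lap_def intro: continuous_on_subset)
  have "f z - f (?R z) - E z \<le> 0" if "z \<in> K" for z
  proof (rule weak_lap_compact_max[OF wv openU compK UK _ _ _ that])
    have "continuous_on K (\<lambda>z. f (?R z))"
    proof (rule continuous_on_compose2[OF cf])
      show "continuous_on K ?R" unfolding reflect_def by (intro continuous_intros)
    qed (use RQ K_def in auto)
    moreover have "continuous_on K f" using cf by (rule continuous_on_subset) (auto simp: K_def)
    ultimately show "continuous_on K (\<lambda>z. f z - f (?R z) - E z)"
      unfolding E_def X_def by (intro continuous_intros)
    show "F z - F (?R z) - (- 4 * N) > 0" if "z \<in> U" for z
      using F[of z] F[of "?R z"] RQ UQ that N by fastforce
    fix z assume z: "z \<in> K - U"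
    have zQ: "z \<in> ?Q" using z by (simp add: K_def)
    have X: "0 \<le> X z" "X z \<le> \<rho>" using z b memQ[of z] by (auto simp: K_def X_def inner_diff_left)
    have "f z - f (?R z) \<le> E z"
    proof (cases "X z = 0")
      case True
      then have "?R z = z" by (simp add: reflect_def X_def)
      then show ?thesis using True M0 by (simp add: E_def)
    next
      case False
      then have "z0 \<bullet> b < z \<bullet> b" using X by (simp add: X_def inner_diff_left)
      then have "z \<notin> box (z0 - \<rho> *\<^sub>R One) (z0 + \<rho> *\<^sub>R One)" using z by (simp add: U_def)
      then obtain j where j: "j \<in> Basis" "\<rho> \<le> \<bar>(z - z0) \<bullet> j\<bar>" unfolding membox by force
      then have "\<rho> \<le> norm (z - z0)" using Basis_le_norm[OF j(1), of "z - z0"] by linarith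
      then have "\<rho>\<^sup>2 \<le> (norm (z - z0))\<^sup>2" using \<rho> by (intro power_mono) auto
      then have "2 * M / \<rho>\<^sup>2 * \<rho>\<^sup>2 \<le> 2 * M / \<rho>\<^sup>2 * (norm (z - z0))\<^sup>2" using M0 by (intro mult_left_mono) auto
      moreover have "0 \<le> B * (X z * (\<rho> - X z))" using B0 X by auto
      ultimately have "2 * M \<le> E z" using \<rho> by (simp add: E_def)
      then show ?thesis using M[OF zQ] M[OF RQ[OF zQ]] by linarith
    qed
    then show "f z - f (?R z) - E z \<le> 0" by simp
  qed
  moreover have "z0 + x *\<^sub>R b \<in> K"
    using x b by (auto simp: K_def memQ inner_add_left inner_Basis)
  moreover have "?R (z0 + x *\<^sub>R b) = z0 - x *\<^sub>R b" using b by (simp add: reflect_def algebra_simps flip: scaleR_add_left)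
  moreover have "E (z0 + x *\<^sub>R b) \<le> 2 * M / \<rho>\<^sup>2 * x\<^sup>2 + B * x * \<rho>"
    using b B0 x by (auto simp: E_def X_def algebra_simps)
  ultimately show ?thesis unfolding B_def by force
qed

text \<open>The classical estimate \<open>|\<nabla>f| \<le> C (sup |f| / \<rho> + \<rho> sup |\<Delta>f|)\<close>, obtained by letting the symmetric
difference quotient shrink to the centre. The stream function is merely
differentiable at each point, hence the pointwise form.\<close>

lemma weak_lap_gradient_le:
  fixes z0 :: complex
  assumes wk: "weak_lap S f F" and b: "b \<in> Basis" and \<rho>: "\<rho> > 0" and N: "N > 0"
    and sub: "cbox (z0 - \<rho> *\<^sub>R One) (z0 + \<rho> *\<^sub>R One) \<subseteq> S"
    and M: "\<And>z. z \<in> cbox (z0 - \<rho> *\<^sub>R One) (z0 + \<rho> *\<^sub>R One) \<Longrightarrow> \<bar>f z\<bar> \<le> M"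
    and F: "\<And>z. z \<in> cbox (z0 - \<rho> *\<^sub>R One) (z0 + \<rho> *\<^sub>R One) \<Longrightarrow> \<bar>F z\<bar> \<le> N"
    and der: "has_pder b f d z0"
  shows "\<bar>d\<bar> \<le> 2 * M / \<rho> + N * \<rho>"
proof -
  have one: "d \<le> 2 * M / \<rho> + N * \<rho>"
    if wk: "weak_lap S f F"
    and M: "\<And>z. z \<in> cbox (z0 - \<rho> *\<^sub>R One) (z0 + \<rho> *\<^sub>R One) \<Longrightarrow> \<bar>f z\<bar> \<le> M"
    and F: "\<And>z. z \<in> cbox (z0 - \<rho> *\<^sub>R One) (z0 + \<rho> *\<^sub>R One) \<Longrightarrow> \<bar>F z\<bar> \<le> N"
    and der: "has_pder b f d z0" for f F d
  proof -
    have d: "((\<lambda>t. f (z0 + t *\<^sub>R b)) has_real_derivative d) (at 0)" using der by (simp add: has_pder_def)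
    have "((\<lambda>t. f (z0 + (- t) *\<^sub>R b)) has_real_derivative d * (- 1)) (at 0)"
      by (rule DERIV_chain2[of "\<lambda>t. f (z0 + t *\<^sub>R b)"]) (use d in \<open>auto intro!: derivative_eq_intros\<close>)
    from DERIV_diff[OF d this]
    have "((\<lambda>t. (f (z0 + t *\<^sub>R b) - f (z0 - t *\<^sub>R b)) / t) \<longlongrightarrow> 2 * d) (at 0)"
      by (simp add: has_field_derivative_iff)
    then have l: "((\<lambda>t. (f (z0 + t *\<^sub>R b) - f (z0 - t *\<^sub>R b)) / t) \<longlongrightarrow> 2 * d) (at_right 0)"
      by (rule filterlim_mono) (simp_all add: at_le)
    have r: "((\<lambda>t. 2 * M / \<rho>\<^sup>2 * t + (4 * M / \<rho>\<^sup>2 + 2 * N) * \<rho>) \<longlongrightarrow> 2 * M / \<rho>\<^sup>2 * 0 + (4 * M / \<rho>\<^sup>2 + 2 * N) * \<rho>) (at_right 0)"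
      by (intro tendsto_intros)
    have "2 * d \<le> 2 * M / \<rho>\<^sup>2 * 0 + (4 * M / \<rho>\<^sup>2 + 2 * N) * \<rho>"
    proof (rule tendsto_le[OF _ r l])
      show "\<forall>\<^sub>F t in at_right 0. (f (z0 + t *\<^sub>R b) - f (z0 - t *\<^sub>R b)) / t \<le> 2 * M / \<rho>\<^sup>2 * t + (4 * M / \<rho>\<^sup>2 + 2 * N) * \<rho>"
        unfolding eventually_at_right_field
      proof (intro exI[of _ \<rho>] conjI allI impI)
        fix t assume t: "0 < t" "t < \<rho>"
        have "f (z0 + t *\<^sub>R b) - f (z0 - t *\<^sub>R b) \<le> 2 * M / \<rho>\<^sup>2 * t\<^sup>2 + (4 * M / \<rho>\<^sup>2 + 2 * N) * t * \<rho>"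
          by (rule weak_lap_symmetric_difference_le[OF wk b \<rho> N _ _ sub M F]) (use t in auto)
        also have "\<dots> = (2 * M / \<rho>\<^sup>2 * t + (4 * M / \<rho>\<^sup>2 + 2 * N) * \<rho>) * t"
          by (simp add: power2_eq_square algebra_simps)
        finally show "(f (z0 + t *\<^sub>R b) - f (z0 - t *\<^sub>R b)) / t \<le> 2 * M / \<rho>\<^sup>2 * t + (4 * M / \<rho>\<^sup>2 + 2 * N) * \<rho>"
          using t by (simp add: pos_divide_le_eq)
      qed (use \<rho> in auto)
    qed simp
    also have "\<dots> = 2 * (2 * M / \<rho> + N * \<rho>)" using \<rho> by (simp add: field_simps power2_eq_square)
    finally show ?thesis by simp
  qed
  have "has_pder b (\<lambda>z. - f z) (- d) z0" using der unfolding has_pder_def by (rule DERIV_minus)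
  then have "- d \<le> 2 * M / \<rho> + N * \<rho>"
    by (intro one[OF weak_lap_minus[OF wk]]) (use M F in auto)
  then show ?thesis using one[OF wk M F der] by linarith
qed

section \<open>Comparison in a sector\<close>

lemma weak_lap_cong:
  assumes "weak_lap S f F" "\<And>z. z \<in> S \<Longrightarrow> f z = g z" "\<And>z. z \<in> S \<Longrightarrow> F z = G z"
  shows "weak_lap S g G"
  unfolding weak_lap_def
proof (intro conjI allI impI)
  show "continuous_on S g" "continuous_on S G"
    using assms by (auto simp: weak_lap_def cong: continuous_on_cong)
  fix p :: complex and \<rho> \<eta> :: real assume pos: "0 < \<rho>" "0 < \<eta>" "cball p \<rho> \<subseteq> S"
  have in_S: "z \<in> S" if "\<not> \<rho> \<le> norm (z - p)" for z
    using pos(3) that by (auto simp: dist_norm norm_minus_commute)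
  have 1: "f z * bump_lap p \<rho> \<eta> z = g z * bump_lap p \<rho> \<eta> z" for z
    using in_S[of z] assms(2)[of z] bump_lap_outside[OF pos(2,1), of z p] by (cases "\<rho> \<le> norm (z - p)") auto
  have 2: "F z * bump p \<rho> \<eta> z = G z * bump p \<rho> \<eta> z" for z
    using in_S[of z] assms(3)[of z] bump_outside(1)[OF pos(2,1), of z p] by (cases "\<rho> \<le> norm (z - p)") auto
  have "(LINT z|lborel. f z * bump_lap p \<rho> \<eta> z) = (LINT z|lborel. F z * bump p \<rho> \<eta> z)"
    using assms(1) pos unfolding weak_lap_def by blast
  then show "(LINT z|lborel. g z * bump_lap p \<rho> \<eta> z) = (LINT z|lborel. G z * bump p \<rho> \<eta> z)"
    unfolding 1 2 .
qed

text \<open>The sector is described in logarithmic coordinates \<open>z = exp w\<close>, \<open>r = exp (Re w)\<close>, \<open>\<theta> = Im w\<close>: rays become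
horizontal lines, and powers of \<open>r\<close> become exponentials.\<close>

definition sector :: "real \<Rightarrow> complex set" where
  "sector b = exp ` {w. 0 < Im w \<and> Im w < b}"

lemma Ln_exp_strip: "0 \<le> Im w \<Longrightarrow> Im w < pi \<Longrightarrow> Ln (exp w) = w"
  by (rule Ln_exp) auto

lemma sector_not_nonpos:
  assumes "z \<in> sector b" "b \<le> pi"
  shows "z \<notin> \<real>\<^sub>\<le>\<^sub>0"
proof -
  obtain w where w: "z = exp w" "0 < Im w" "Im w < b" using assms(1) by (auto simp: sector_def)
  have "Im z > 0" using w assms(2) sin_gt_zero[of "Im w"] by (simp add: Im_exp)
  then show ?thesis by (auto simp: complex_nonpos_Reals_iff)
qed

lemma sector_Ln:
  assumes "z \<in> sector b" "b \<le> pi"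
  shows "0 < Im (Ln z)" "Im (Ln z) < b" "z \<noteq> 0" "exp (Ln z) = z"
  using assms by (auto simp: sector_def Ln_exp_strip)

lemma sector_eq:
  assumes "b \<le> pi"
  shows "sector b = (- \<real>\<^sub>\<le>\<^sub>0) \<inter> (\<lambda>z. Im (Ln z)) -` {0<..<b}"
proof (intro equalityI subsetI IntI)
  fix z assume "z \<in> (- \<real>\<^sub>\<le>\<^sub>0) \<inter> (\<lambda>z. Im (Ln z)) -` {0<..<b}"
  then have "z \<noteq> 0" "0 < Im (Ln z)" "Im (Ln z) < b" by auto
  then have "z = exp (Ln z)" "0 < Im (Ln z)" "Im (Ln z) < b" by simp_all
  then show "z \<in> sector b" unfolding sector_def by blast
qed (use assms sector_not_nonpos sector_Ln in auto)

lemma open_sector: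
  assumes "b \<le> pi"
  shows "open (sector b)"
  unfolding sector_eq[OF assms]
  by (intro continuous_open_preimage continuous_intros) (auto intro: open_Compl)

lemma Ln_line:
  assumes "z \<notin> \<real>\<^sub>\<le>\<^sub>0"
  shows "((\<lambda>t. Re (Ln (z + t *\<^sub>R j))) has_real_derivative Re (j / z)) (at 0)"
    and "((\<lambda>t. Im (Ln (z + t *\<^sub>R j))) has_real_derivative Im (j / z)) (at 0)"
    and "((\<lambda>t. Re (j / (z + t *\<^sub>R j))) has_real_derivative - Re ((j / z)\<^sup>2)) (at 0)"
    and "((\<lambda>t. Im (j / (z + t *\<^sub>R j))) has_real_derivative - Im ((j / z)\<^sup>2)) (at 0)"
proof -
  have z: "z \<noteq> 0" using assms by auto
  have l: "((\<lambda>t. z + t *\<^sub>R j) has_vector_derivative j) (at 0)"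
    by (auto intro!: derivative_eq_intros)
  have L: "((\<lambda>t. Ln (z + t *\<^sub>R j)) has_vector_derivative j / z) (at 0)"
    using field_vector_diff_chain_at[OF l, of Ln "inverse z"] has_field_derivative_Ln[OF assms]
    by (simp add: o_def divide_inverse)
  have "((\<lambda>w. j / w) has_field_derivative - j / z\<^sup>2) (at z)"
    using z by (auto intro!: derivative_eq_intros simp: power2_eq_square field_simps)
  then have I: "((\<lambda>t. j / (z + t *\<^sub>R j)) has_vector_derivative - ((j / z)\<^sup>2)) (at 0)"
    using field_vector_diff_chain_at[OF l, of "\<lambda>w. j / w" "- j / z\<^sup>2"] by (simp add: o_def power2_eq_square)
  note Re = bounded_linear.has_vector_derivative[OF bounded_linear_Re]
  note Im = bounded_linear.has_vector_derivative[OF bounded_linear_Im]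
  show "((\<lambda>t. Re (Ln (z + t *\<^sub>R j))) has_real_derivative Re (j / z)) (at 0)"
    "((\<lambda>t. Im (Ln (z + t *\<^sub>R j))) has_real_derivative Im (j / z)) (at 0)"
    "((\<lambda>t. Re (j / (z + t *\<^sub>R j))) has_real_derivative - Re ((j / z)\<^sup>2)) (at 0)"
    "((\<lambda>t. Im (j / (z + t *\<^sub>R j))) has_real_derivative - Im ((j / z)\<^sup>2)) (at 0)"
    using Re[OF L] Im[OF L] Re[OF I] Im[OF I] by (simp_all add: has_real_derivative_iff_has_vector_derivative)
qed

text \<open>The homogeneous function \<open>r\<^sup>\<gamma> Q(\<theta>)\<close>.\<close>

definition angular :: "real \<Rightarrow> (real \<Rightarrow> real) \<Rightarrow> complex \<Rightarrow> real" where
  "angular \<gamma> Q z = exp (\<gamma> * Re (Ln z)) * Q (Im (Ln z))"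

lemma angular_exp: "0 \<le> Im w \<Longrightarrow> Im w < pi \<Longrightarrow> angular \<gamma> Q (exp w) = exp (\<gamma> * Re w) * Q (Im w)"
  by (simp add: angular_def Ln_exp_strip)

definition angular_pder :: "real \<Rightarrow> (real \<Rightarrow> real) \<Rightarrow> (real \<Rightarrow> real) \<Rightarrow> complex \<Rightarrow> complex \<Rightarrow> real" where
  "angular_pder \<gamma> Q Q1 j z = exp (\<gamma> * Re (Ln z)) * (\<gamma> * Q (Im (Ln z)) * Re (j / z) + Q1 (Im (Ln z)) * Im (j / z))"

lemma angular_has_pder:
  assumes z: "z \<in> sector b" and b: "b \<le> pi"
    and Q: "(Q has_real_derivative Q1 (Im (Ln z))) (at (Im (Ln z)))"
  shows "has_pder j (angular \<gamma> Q) (angular_pder \<gamma> Q Q1 j z) z"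
proof -
  note L = Ln_line[OF sector_not_nonpos[OF z b], of j]
  have "((\<lambda>t. Q (Im (Ln (z + t *\<^sub>R j)))) has_real_derivative Q1 (Im (Ln z)) * Im (j / z)) (at 0)"
    by (rule DERIV_chain2[OF _ L(2)]) (use Q in simp)
  moreover have "((\<lambda>t. exp (\<gamma> * Re (Ln (z + t *\<^sub>R j)))) has_real_derivative exp (\<gamma> * Re (Ln z)) * (\<gamma> * Re (j / z))) (at 0)"
    by (rule DERIV_chain2[OF _ DERIV_cmult[OF L(1)]]) simp
  ultimately show ?thesis unfolding has_pder_def angular_def angular_pder_def
    using DERIV_mult by (fastforce simp: algebra_simps)
qed

text \<open>The polar form \<open>\<Delta>(r\<^sup>\<gamma> Q) = r\<^sup>\<gamma>\<^sup>-\<^sup>2 (\<gamma>\<^sup>2 Q + Q'')\<close> of the Laplacian. Differentiating through \<open>Ln\<close> keeps every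
derivative a rational expression in \<open>1 / z\<close>.\<close>

lemma weak_lap_angular:
  assumes b: "b \<le> pi"
    and Q: "\<And>\<theta>. 0 < \<theta> \<Longrightarrow> \<theta> < b \<Longrightarrow> (Q has_real_derivative Q1 \<theta>) (at \<theta>)"
    and Q1: "\<And>\<theta>. 0 < \<theta> \<Longrightarrow> \<theta> < b \<Longrightarrow> (Q1 has_real_derivative Q2 \<theta>) (at \<theta>)"
    and Q2: "continuous_on {0<..<b} Q2"
  shows "weak_lap (sector b) (angular \<gamma> Q) (angular (\<gamma> - 2) (\<lambda>\<theta>. \<gamma>\<^sup>2 * Q \<theta> + Q2 \<theta>))"
proof -
  let ?E2 = "\<lambda>j z. \<gamma> * angular_pder \<gamma> Q Q1 j z * Re (j / z) - \<gamma> * angular \<gamma> Q z * Re ((j / z)\<^sup>2)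
        + angular_pder \<gamma> Q1 Q2 j z * Im (j / z) - angular \<gamma> Q1 z * Im ((j / z)\<^sup>2)"
  have cont: "continuous_on (sector b) (\<lambda>z. P (Im (Ln z)))" if "continuous_on {0<..<b} P" for P :: "real \<Rightarrow> real"
    by (rule continuous_on_compose2[OF that])
       (use sector_Ln[OF _ b] sector_not_nonpos[OF _ b] in \<open>auto intro!: continuous_intros\<close>)
  have cQ: "continuous_on {0<..<b} Q" "continuous_on {0<..<b} Q1"
    by (auto intro!: continuous_at_imp_continuous_on DERIV_isCont[OF Q] DERIV_isCont[OF Q1])
  have cd: "continuous_on (sector b) (\<lambda>z. j / z)" for j
    using sector_Ln(3)[OF _ b] by (auto intro!: continuous_intros)
  have cL: "continuous_on (sector b) (\<lambda>z. Re (Ln z))"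
    using sector_not_nonpos[OF _ b] by (auto intro!: continuous_intros)
  have "weak_lap (sector b) (angular \<gamma> Q) (\<lambda>z. \<Sum>j\<in>(Basis::complex set). ?E2 j z)"
  proof (rule weak_lap_C2[OF open_sector[OF b], where ?E1.0 = "angular_pder \<gamma> Q Q1"])
    fix j z :: complex assume z: "z \<in> sector b"
    note \<theta> = sector_Ln(1,2)[OF z b]
    note L = Ln_line[OF sector_not_nonpos[OF z b], of j]
    have A: "has_pder j (angular \<gamma> Q) (angular_pder \<gamma> Q Q1 j z) z" "has_pder j (angular \<gamma> Q1) (angular_pder \<gamma> Q1 Q2 j z) z"
      using Q Q1 \<theta> angular_has_pder[OF z b] by blast+
    show "has_pder j (angular \<gamma> Q) (angular_pder \<gamma> Q Q1 j z) z" by (rule A)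
    have "((\<lambda>t. \<gamma> * angular \<gamma> Q (z + t *\<^sub>R j) * Re (j / (z + t *\<^sub>R j)) + angular \<gamma> Q1 (z + t *\<^sub>R j) * Im (j / (z + t *\<^sub>R j)))
       has_real_derivative ?E2 j z) (at 0)"
      using DERIV_add[OF DERIV_mult[OF DERIV_cmult[OF A(1)[unfolded has_pder_def], of \<gamma>] L(3)] DERIV_mult[OF A(2)[unfolded has_pder_def] L(4)]]
      by (simp add: algebra_simps)
    moreover have "angular_pder \<gamma> Q Q1 j z = \<gamma> * angular \<gamma> Q z * Re (j / z) + angular \<gamma> Q1 z * Im (j / z)" for z
      by (simp add: angular_pder_def angular_def algebra_simps)
    ultimately show "has_pder j (angular_pder \<gamma> Q Q1 j) (?E2 j z) z" unfolding has_pder_def by simp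
  next
    fix j
    show "continuous_on (sector b) (angular \<gamma> Q)" "continuous_on (sector b) (angular_pder \<gamma> Q Q1 j)" "continuous_on (sector b) (?E2 j)"
      unfolding angular_pder_def angular_def
      by (intro continuous_on_mult continuous_on_add continuous_on_diff continuous_on_const continuous_on_exp
          continuous_on_Re continuous_on_Im continuous_on_power cont[OF cQ(1)] cont[OF cQ(2)] cont[OF Q2] cd cL)+
  qed
  then show ?thesis
  proof (rule weak_lap_cong[OF _ refl])
    fix z assume z: "z \<in> sector b"
    define u where "u = 1 / z"
    have j: "j / z = j * u" for j by (simp add: u_def)
    have "norm z = exp (Re (Ln z))" using sector_Ln(4)[OF z b] norm_exp_eq_Re[of "Ln z"] by simp
    then have "(norm u)\<^sup>2 = exp (- (2 * Re (Ln z)))"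
      by (simp add: u_def norm_divide power_divide exp_minus inverse_eq_divide flip: exp_double)
    then have u2: "(Re u)\<^sup>2 + (Im u)\<^sup>2 = exp (- (2 * Re (Ln z)))" by (simp add: cmod_power2)
    have "(\<Sum>j\<in>(Basis::complex set). ?E2 j z) = exp (\<gamma> * Re (Ln z)) * ((Re u)\<^sup>2 + (Im u)\<^sup>2) * (\<gamma>\<^sup>2 * Q (Im (Ln z)) + Q2 (Im (Ln z)))"
      unfolding Basis_complex_def j angular_pder_def angular_def
      by (simp add: power2_eq_square algebra_simps)
    also have "\<dots> = angular (\<gamma> - 2) (\<lambda>\<theta>. \<gamma>\<^sup>2 * Q \<theta> + Q2 \<theta>) z"
      unfolding u2 by (simp add: angular_def left_diff_distrib exp_diff exp_minus field_simps)
    finally show "(\<Sum>j\<in>(Basis::complex set). ?E2 j z) = angular (\<gamma> - 2) (\<lambda>\<theta>. \<gamma>\<^sup>2 * Q \<theta> + Q2 \<theta>) z" .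
  qed
qed

text \<open>This is where the opening angle enters: \<open>5 b / 4 \<le> 5 \<pi> / 12 < \<pi> / 2\<close>.\<close>

lemma cos_barrier_ge:
  assumes "0 < b" "b \<le> pi / 3" "0 \<le> \<theta>" "\<theta> \<le> b"
  shows "cos (5 * pi / 12) \<le> cos (5 / 2 * (\<theta> - b / 2))"
proof -
  have "\<bar>5 / 2 * (\<theta> - b / 2)\<bar> \<le> 5 * pi / 12"
    by (rule abs_leI) (use assms in \<open>simp_all add: field_simps\<close>)
  then have "cos (5 * pi / 12) \<le> cos \<bar>5 / 2 * (\<theta> - b / 2)\<bar>"
    using pi_gt_zero by (intro cos_monotone_0_pi_le) auto
  then show ?thesis by (simp only: cos_abs_real)
qed

text \<open>Comparison principle of Phragmen-Lindelof type for functions of growth \<open>r\<^sup>2\<close> at both ends of an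
unbounded sector. With \<open>P(\<theta>) = cos (5/2 (\<theta> - b/2)) > 0\<close> the function \<open>r\<^sup>\<gamma> P\<close> is strictly superharmonic for
\<open>0 \<le> \<gamma> < 5/2\<close>. Adding \<open>\<epsilon> (r\<^sup>1\<^sup>1\<^sup>/\<^sup>5 + r\<^sup>9\<^sup>/\<^sup>5) P\<close> to the supersolution makes the inequality for the Laplacians strict
and beats \<open>C r\<^sup>2\<close> near infinity (first power) and near the origin (second power). A positive value of
the difference would then be attained as an interior maximum.\<close>

lemma sector_comparison:
  fixes f F :: "complex \<Rightarrow> real" and Q Q1 Q2 :: "real \<Rightarrow> real"
  assumes b: "0 < b" "b \<le> pi / 3"
    and cont: "continuous_on (exp ` {w. 0 \<le> Im w \<and> Im w \<le> b}) f"
    and bdry: "\<And>w. Im w = 0 \<or> Im w = b \<Longrightarrow> f (exp w) \<le> 0"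
    and growth: "\<And>w. 0 \<le> Im w \<Longrightarrow> Im w \<le> b \<Longrightarrow> f (exp w) \<le> C * exp (2 * Re w)"
    and wk: "weak_lap (sector b) f F"
    and Q: "continuous_on {0..b} Q" "\<And>\<theta>. 0 \<le> \<theta> \<Longrightarrow> \<theta> \<le> b \<Longrightarrow> 0 \<le> Q \<theta>"
    and Q1: "\<And>\<theta>. 0 < \<theta> \<Longrightarrow> \<theta> < b \<Longrightarrow> (Q has_real_derivative Q1 \<theta>) (at \<theta>)"
    and Q2: "\<And>\<theta>. 0 < \<theta> \<Longrightarrow> \<theta> < b \<Longrightarrow> (Q1 has_real_derivative Q2 \<theta>) (at \<theta>)" "continuous_on {0<..<b} Q2"
    and super: "\<And>w. 0 < Im w \<Longrightarrow> Im w < b \<Longrightarrow>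
        exp (\<kappa> * Re w) * ((2 + \<kappa>)\<^sup>2 * Q (Im w) + Q2 (Im w)) \<le> F (exp w)"
    and w: "0 \<le> Im w" "Im w \<le> b"
  shows "f (exp w) \<le> exp ((2 + \<kappa>) * Re w) * Q (Im w)"
proof -
  have bpi: "b \<le> pi" "b < pi" using b pi_gt_zero by linarith+
  define P where "P \<theta> = cos (5 / 2 * (\<theta> - b / 2))" for \<theta> :: real
  define q0 where "q0 = cos (5 * pi / 12)"
  have q0: "q0 > 0" unfolding q0_def by (rule cos_gt_zero_pi) (use pi_gt_zero in auto)
  have P: "P \<theta> \<ge> q0" if "0 \<le> \<theta>" "\<theta> \<le> b" for \<theta>
    using cos_barrier_ge[OF b that] by (simp add: P_def q0_def)
  have wP: "weak_lap (sector b) (angular \<gamma> P) (angular (\<gamma> - 2) (\<lambda>\<theta>. \<gamma>\<^sup>2 * P \<theta> + (- 25 / 4) * P \<theta>))" for \<gamma>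
    by (rule weak_lap_angular[OF bpi(1), where ?Q1.0 = "\<lambda>\<theta>. - (5 / 2) * sin (5 / 2 * (\<theta> - b / 2))"])
       (auto simp: P_def[abs_def] intro!: derivative_eq_intros continuous_intros)
  have key: "f (exp w) \<le> exp ((2 + \<kappa>) * Re w) * Q (Im w) + \<epsilon> * (exp (11 / 5 * Re w) * P (Im w) + exp (9 / 5 * Re w) * P (Im w))"
    if \<epsilon>: "\<epsilon> > 0" for \<epsilon>
  proof (rule ccontr)
    define E where "E z = angular (2 + \<kappa>) Q z + \<epsilon> * (angular (11 / 5) P z + 1 * angular (9 / 5) P z)" for z
    define L where "L z = angular (2 + \<kappa> - 2) (\<lambda>\<theta>. (2 + \<kappa>)\<^sup>2 * Q \<theta> + Q2 \<theta>) z + \<epsilon> * (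
       angular (11 / 5 - 2) (\<lambda>\<theta>. (11 / 5)\<^sup>2 * P \<theta> + (- 25 / 4) * P \<theta>) z + 1 *
       angular (9 / 5 - 2) (\<lambda>\<theta>. (9 / 5)\<^sup>2 * P \<theta> + (- 25 / 4) * P \<theta>) z)" for z
    have wE: "weak_lap (sector b) E L" unfolding E_def L_def
      by (intro weak_lap_lincomb wP weak_lap_angular[OF bpi(1) Q1 Q2])
    have wfE: "weak_lap (sector b) (\<lambda>z. f z - E z) (\<lambda>z. F z - L z)" by (rule weak_lap_diff[OF wk wE])
    have Eexp: "E (exp w) = exp ((2 + \<kappa>) * Re w) * Q (Im w) + \<epsilon> * (exp (11 / 5 * Re w) * P (Im w) + exp (9 / 5 * Re w) * P (Im w))"
      if "0 \<le> Im w" "Im w \<le> b" for w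
      using that bpi by (simp add: E_def angular_exp)
    \<comment> \<open>Both \<open>(11/5)\<^sup>2\<close> and \<open>(9/5)\<^sup>2\<close> are below \<open>(5/2)\<^sup>2 = 25/4\<close>.\<close>
    have pos: "F z - L z > 0" if z: "z \<in> sector b" for z
    proof -
      obtain w where w: "z = exp w" "0 < Im w" "Im w < b" using z by (auto simp: sector_def)
      have "P (Im w) > 0" using P[of "Im w"] w q0 by linarith
      moreover have "L z = exp (\<kappa> * Re w) * ((2 + \<kappa>)\<^sup>2 * Q (Im w) + Q2 (Im w)) +
          \<epsilon> * P (Im w) * (exp (Re w / 5) * ((11 / 5)\<^sup>2 - 25 / 4) + exp (- Re w / 5) * ((9 / 5)\<^sup>2 - 25 / 4))"
        using w bpi by (simp add: L_def angular_exp algebra_simps)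
      moreover have "exp (Re w / 5) * ((11 / 5)\<^sup>2 - 25 / 4) + exp (- Re w / 5) * ((9 / 5)\<^sup>2 - 25 / 4) < (0::real)"
        by (intro add_neg_neg mult_pos_neg) (auto simp: power2_eq_square)
      ultimately have "L z < exp (\<kappa> * Re w) * ((2 + \<kappa>)\<^sup>2 * Q (Im w) + Q2 (Im w))"
        using \<epsilon> by (simp add: mult_pos_neg)
      then show ?thesis using super[OF w(2,3)] w(1) by simp
    qed
    assume "\<not> ?thesis"
    then have big: "f (exp w) - E (exp w) > 0" using Eexp w by simp
    \<comment> \<open>Outside \<open>|Re w| < R\<close> the \<open>\<epsilon>\<close>-terms exceed \<open>C r\<^sup>2\<close>, so a positive maximum is attained on a compact rectangle.\<close>
    define R where "R = 5 * \<bar>C\<bar> / (\<epsilon> * q0) + 1"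
    have far: "f (exp v) - E (exp v) \<le> 0" if v: "0 \<le> Im v" "Im v \<le> b" "\<bar>Re v\<bar> \<ge> R" for v
    proof -
      have "\<bar>Re v\<bar> / 5 \<le> exp (\<bar>Re v\<bar> / 5)" using exp_ge_add_one_self[of "\<bar>Re v\<bar> / 5"] by linarith
      also have "\<dots> \<le> exp (Re v / 5) + exp (- Re v / 5)" by (cases "Re v \<ge> 0") auto
      finally have "\<epsilon> * q0 * (R / 5) \<le> \<epsilon> * q0 * (exp (Re v / 5) + exp (- Re v / 5))"
        using v(3) \<epsilon> q0 by (intro mult_left_mono) auto
      moreover have "\<epsilon> * q0 * (R / 5) = \<bar>C\<bar> + \<epsilon> * q0 / 5" using \<epsilon> q0 by (simp add: R_def field_simps)
      moreover have "\<epsilon> * q0 > 0" using \<epsilon> q0 by simp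
      ultimately have "C \<le> \<epsilon> * q0 * (exp (Re v / 5) + exp (- Re v / 5))" by linarith
      also have "\<dots> \<le> \<epsilon> * P (Im v) * (exp (Re v / 5) + exp (- Re v / 5))"
        using P[OF v(1,2)] \<epsilon> by (intro mult_right_mono mult_left_mono) (auto intro: add_nonneg_nonneg)
      finally have "C * exp (2 * Re v) \<le> \<epsilon> * P (Im v) * (exp (Re v / 5) + exp (- Re v / 5)) * exp (2 * Re v)"
        by (intro mult_right_mono) auto
      also have "\<dots> = \<epsilon> * (exp (11 / 5 * Re v) * P (Im v) + exp (9 / 5 * Re v) * P (Im v))"
        by (simp add: algebra_simps flip: exp_add)
      also have "\<dots> \<le> E (exp v)" using Q(2)[OF v(1,2)] Eexp[OF v(1,2)] by simp
      finally show ?thesis using growth[OF v(1,2)] by linarith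
    qed
    define K where "K = cbox (Complex (- R) 0) (Complex R b)"
    have K: "v \<in> K \<longleftrightarrow> \<bar>Re v\<bar> \<le> R \<and> 0 \<le> Im v \<and> Im v \<le> b" for v
      by (auto simp: K_def in_cbox_complex_iff)
    have "continuous_on K (\<lambda>v. f (exp v) - (exp ((2 + \<kappa>) * Re v) * Q (Im v) + \<epsilon> * (exp (11 / 5 * Re v) * P (Im v) + exp (9 / 5 * Re v) * P (Im v))))"
      unfolding P_def
      by (intro continuous_intros continuous_on_compose2[OF cont] continuous_on_compose2[OF Q(1)]) (auto simp: K)
    moreover have "w \<in> K" using far[of w] big w unfolding K by force
    moreover have "compact K" by (simp add: K_def)
    ultimately obtain v where v: "v \<in> K" and vmax: "\<And>y. y \<in> K \<Longrightarrow> f (exp y) - E (exp y) \<le> f (exp v) - E (exp v)"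
      using continuous_attains_sup[of K "\<lambda>v. f (exp v) - (exp ((2 + \<kappa>) * Re v) * Q (Im v) + \<epsilon> * (exp (11 / 5 * Re v) * P (Im v) + exp (9 / 5 * Re v) * P (Im v)))"] Eexp
      by (metis (no_types, lifting) K empty_iff)
    have vbig: "f (exp v) - E (exp v) > 0" using vmax[OF \<open>w \<in> K\<close>] big by linarith
    have nE: "0 \<le> E (exp y)" if "0 \<le> Im y" "Im y \<le> b" for y
      unfolding Eexp[OF that] using Q(2)[OF that] P[OF that] q0 \<epsilon> by (intro add_nonneg_nonneg mult_nonneg_nonneg) auto
    have "Im v \<noteq> 0" "Im v \<noteq> b" using bdry[of v] nE[of v] vbig v K[of v] by auto
    then have vS: "exp v \<in> sector b" using v K[of v] by (auto simp: sector_def)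
    show False
    proof (rule weak_lap_no_max[OF wfE open_sector[OF bpi(1)] vS pos[OF vS]])
      fix z assume "z \<in> sector b"
      then obtain y where y: "z = exp y" "0 < Im y" "Im y < b" by (auto simp: sector_def)
      show "f z - E z \<le> f (exp v) - E (exp v)"
      proof (cases "y \<in> K")
        case False
        then show ?thesis using far[of y] y vbig K[of y] by force
      qed (use vmax y in auto)
    qed
  qed
  define c where "c = exp (11 / 5 * Re w) * P (Im w) + exp (9 / 5 * Re w) * P (Im w)"
  have "((\<lambda>\<epsilon>. exp ((2 + \<kappa>) * Re w) * Q (Im w) + \<epsilon> * c) \<longlongrightarrow> exp ((2 + \<kappa>) * Re w) * Q (Im w) + 0 * c) (at_right 0)"
    by (intro tendsto_intros)
  moreover have "\<forall>\<^sub>F \<epsilon> in at_right 0. f (exp w) \<le> exp ((2 + \<kappa>) * Re w) * Q (Im w) + \<epsilon> * c"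
    using key unfolding c_def eventually_at_right_field by (intro exI[of _ 1]) auto
  ultimately show ?thesis using tendsto_lowerbound by fastforce
qed

text \<open>A supersolution for right-hand sides that may blow up like \<open>\<theta>\<^sup>-\<^sup>\<beta>\<close> at one ray: \<open>-\<theta>\<^sup>2\<^sup>-\<^sup>\<beta>\<close>, suitably normalised,
has second derivative \<open>-\<theta>\<^sup>-\<^sup>\<beta>\<close>, and a multiple of the cosine restores positivity. The constant \<open>A\<close>
depends on neither the growth constant \<open>C\<close> nor the function.\<close>

lemma sector_bound:
  assumes b: "0 < b" "b \<le> pi / 3" and \<beta>: "0 < \<beta>" "\<beta> < 1" and \<kappa>: "0 \<le> \<kappa>" "\<kappa> \<le> 1 / 2"
  obtains A where "A > 0" "\<And>f F N C w.
     continuous_on (exp ` {w. 0 \<le> Im w \<and> Im w \<le> b}) f \<Longrightarrow>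
     (\<And>w. Im w = 0 \<or> Im w = b \<Longrightarrow> f (exp w) = 0) \<Longrightarrow>
     (\<And>w. 0 \<le> Im w \<Longrightarrow> Im w \<le> b \<Longrightarrow> \<bar>f (exp w)\<bar> \<le> C * exp (2 * Re w)) \<Longrightarrow>
     weak_lap (sector b) f F \<Longrightarrow> 0 \<le> N \<Longrightarrow>
     (\<And>w. 0 < Im w \<Longrightarrow> Im w < b \<Longrightarrow> \<bar>F (exp w)\<bar> \<le> N * (exp (\<kappa> * Re w) * Im w powr - \<beta>)) \<Longrightarrow>
     0 \<le> Im w \<Longrightarrow> Im w \<le> b \<Longrightarrow> \<bar>f (exp w)\<bar> \<le> N * A * exp ((2 + \<kappa>) * Re w)"
proof -
  define P where "P \<theta> = cos (5 / 2 * (\<theta> - b / 2))" for \<theta> :: real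
  define q0 where "q0 = cos (5 * pi / 12)"
  have q0: "q0 > 0" unfolding q0_def by (rule cos_gt_zero_pi) (use pi_gt_zero in auto)
  have P: "P \<theta> \<ge> q0" if "0 \<le> \<theta>" "\<theta> \<le> b" for \<theta>
    using cos_barrier_ge[OF b that] by (simp add: P_def q0_def)
  define c where "c = (2 - \<beta>) * (1 - \<beta>)"
  have c: "c > 0" using \<beta> by (simp add: c_def)
  define A where "A = b powr (2 - \<beta>) / c / q0"
  have A: "A > 0" using b c q0 by (simp add: A_def)
  define Q where "Q \<theta> = A * P \<theta> - \<theta> powr (2 - \<beta>) / c" for \<theta>
  define Q1 where "Q1 \<theta> = - (5 / 2) * A * sin (5 / 2 * (\<theta> - b / 2)) - \<theta> powr (1 - \<beta>) / (1 - \<beta>)" for \<theta>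
  define Q2 where "Q2 \<theta> = - (25 / 4) * A * P \<theta> - \<theta> powr - \<beta>" for \<theta>
  have Qc: "continuous_on {0..b} Q" unfolding Q_def P_def
    using \<beta> c by (intro continuous_intros continuous_on_powr') auto
  have Q0: "0 \<le> Q \<theta>" "Q \<theta> \<le> A" if "0 \<le> \<theta>" "\<theta> \<le> b" for \<theta>
  proof -
    have "\<theta> powr (2 - \<beta>) / c \<le> b powr (2 - \<beta>) / c"
      using that \<beta> c by (intro divide_right_mono powr_mono2) auto
    also have "\<dots> = A * q0" using q0 by (simp add: A_def)
    also have "\<dots> \<le> A * P \<theta>" using P[OF that] A by simp
    finally show "0 \<le> Q \<theta>" by (simp add: Q_def)
    have "A * P \<theta> \<le> A * 1" using A by (intro mult_left_mono) (auto simp: P_def)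
    moreover have "0 \<le> \<theta> powr (2 - \<beta>) / c" using c by simp
    ultimately show "Q \<theta> \<le> A" by (simp add: Q_def)
  qed
  have dQ: "(Q has_real_derivative Q1 \<theta>) (at \<theta>)" if "0 < \<theta>" for \<theta>
  proof -
    have "((\<lambda>\<theta>. A * P \<theta> - \<theta> powr (2 - \<beta>) / c) has_real_derivative
        A * (- sin (5 / 2 * (\<theta> - b / 2)) * (5 / 2)) - ((2 - \<beta>) * \<theta> powr (2 - \<beta> - 1)) / c) (at \<theta>)"
      unfolding P_def using that c by (auto intro!: derivative_eq_intros)
    moreover have "((2 - \<beta>) * \<theta> powr (2 - \<beta> - 1)) / c = \<theta> powr (1 - \<beta>) / (1 - \<beta>)"
      using \<beta> by (simp add: c_def)
    ultimately show ?thesis by (simp add: Q_def[abs_def] Q1_def algebra_simps)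
  qed
  have dQ1: "(Q1 has_real_derivative Q2 \<theta>) (at \<theta>)" if "0 < \<theta>" for \<theta>
  proof -
    have "((\<lambda>\<theta>. - (5 / 2) * A * sin (5 / 2 * (\<theta> - b / 2)) - \<theta> powr (1 - \<beta>) / (1 - \<beta>)) has_real_derivative
        - (5 / 2) * A * (cos (5 / 2 * (\<theta> - b / 2)) * (5 / 2)) - ((1 - \<beta>) * \<theta> powr (1 - \<beta> - 1)) / (1 - \<beta>)) (at \<theta>)"
      using that by (auto intro!: derivative_eq_intros)
    moreover have "((1 - \<beta>) * \<theta> powr (1 - \<beta> - 1)) / (1 - \<beta>) = \<theta> powr - \<beta>" using \<beta> by simp
    ultimately show ?thesis unfolding Q1_def[abs_def] Q2_def P_def by (simp only: mult_ac) simp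
  qed
  have cQ2: "continuous_on {0<..<b} Q2" unfolding Q2_def P_def
    by (intro continuous_intros) auto
  have super: "(2 + \<kappa>)\<^sup>2 * Q \<theta> + Q2 \<theta> \<le> - (\<theta> powr - \<beta>)" if "0 \<le> \<theta>" "\<theta> \<le> b" for \<theta>
  proof -
    have "(2 + \<kappa>)\<^sup>2 \<le> (5 / 2)\<^sup>2" using \<kappa> by (intro power_mono) auto
    then have k: "(2 + \<kappa>)\<^sup>2 \<le> 25 / 4" by (simp add: power2_eq_square)
    have "(2 + \<kappa>)\<^sup>2 * Q \<theta> \<le> (2 + \<kappa>)\<^sup>2 * (A * P \<theta>)" using c by (intro mult_left_mono) (auto simp: Q_def)
    also have "\<dots> \<le> 25 / 4 * (A * P \<theta>)" using k A P[OF that] q0 by (intro mult_right_mono) auto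
    finally show ?thesis by (simp add: Q2_def)
  qed
  show thesis
  proof (rule that[OF A])
    fix f F :: "complex \<Rightarrow> real" and N C :: real and w :: complex
    assume cont: "continuous_on (exp ` {w. 0 \<le> Im w \<and> Im w \<le> b}) f" and bdry: "\<And>w. Im w = 0 \<or> Im w = b \<Longrightarrow> f (exp w) = 0"
      and growth: "\<And>w. 0 \<le> Im w \<Longrightarrow> Im w \<le> b \<Longrightarrow> \<bar>f (exp w)\<bar> \<le> C * exp (2 * Re w)"
      and wk: "weak_lap (sector b) f F" and N: "0 \<le> N"
      and F: "\<And>w. 0 < Im w \<Longrightarrow> Im w < b \<Longrightarrow> \<bar>F (exp w)\<bar> \<le> N * (exp (\<kappa> * Re w) * Im w powr - \<beta>)"
      and w: "0 \<le> Im w" "Im w \<le> b"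
    have one: "f (exp w) \<le> exp ((2 + \<kappa>) * Re w) * (N * Q (Im w))"
      if cont: "continuous_on (exp ` {w. 0 \<le> Im w \<and> Im w \<le> b}) f" and bdry: "\<And>w. Im w = 0 \<or> Im w = b \<Longrightarrow> f (exp w) \<le> 0"
      and growth: "\<And>w. 0 \<le> Im w \<Longrightarrow> Im w \<le> b \<Longrightarrow> f (exp w) \<le> C * exp (2 * Re w)"
      and wk: "weak_lap (sector b) f F"
      and F: "\<And>w. 0 < Im w \<Longrightarrow> Im w < b \<Longrightarrow> \<bar>F (exp w)\<bar> \<le> N * (exp (\<kappa> * Re w) * Im w powr - \<beta>)" for f F
    proof (rule sector_comparison[OF b cont bdry growth wk, where ?Q1.0 = "\<lambda>\<theta>. N * Q1 \<theta>" and ?Q2.0 = "\<lambda>\<theta>. N * Q2 \<theta>"])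
      fix v :: complex assume v: "0 < Im v" "Im v < b"
      have "exp (\<kappa> * Re v) * ((2 + \<kappa>)\<^sup>2 * (N * Q (Im v)) + N * Q2 (Im v)) = N * (exp (\<kappa> * Re v) * ((2 + \<kappa>)\<^sup>2 * Q (Im v) + Q2 (Im v)))"
        by (simp add: algebra_simps)
      also have "\<dots> \<le> N * (exp (\<kappa> * Re v) * - (Im v powr - \<beta>))"
        using super[of "Im v"] v N by (intro mult_left_mono) auto
      also have "\<dots> \<le> F (exp v)" using F[OF v] by simp
      finally show "exp (\<kappa> * Re v) * ((2 + \<kappa>)\<^sup>2 * (N * Q (Im v)) + N * Q2 (Im v)) \<le> F (exp v)" .
    qed (use N Q0 Qc cQ2 dQ dQ1 w in \<open>auto intro!: continuous_intros DERIV_cmult\<close>)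
    have "f (exp w) \<le> exp ((2 + \<kappa>) * Re w) * (N * Q (Im w))"
      by (rule one[OF cont _ _ wk F]) (use bdry growth in \<open>force simp: abs_le_iff\<close>)+
    moreover have "- f (exp w) \<le> exp ((2 + \<kappa>) * Re w) * (N * Q (Im w))"
      by (rule one[OF continuous_on_minus[OF cont] _ _ weak_lap_minus[OF wk]]) (use bdry growth F in \<open>force simp: abs_le_iff\<close>)+
    ultimately have "\<bar>f (exp w)\<bar> \<le> exp ((2 + \<kappa>) * Re w) * (N * Q (Im w))" by linarith
    also have "\<dots> \<le> exp ((2 + \<kappa>) * Re w) * (N * A)" using Q0(2)[OF w] N by (intro mult_left_mono) auto
    finally show "\<bar>f (exp w)\<bar> \<le> N * A * exp ((2 + \<kappa>) * Re w)" by (simp add: mult_ac)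
  qed
qed

section \<open>The equation \<open>4 G + G'' = g\<close> on the circle\<close>

text \<open>On the closed interval the weight is read with the convention \<open>0 powr x = 0\<close>, so \<open>g\<close> vanishes at \<open>0\<close>; this
is the case for the odd functions of interest.\<close>

definition admissible :: "real \<Rightarrow> real \<Rightarrow> real \<Rightarrow> (real \<Rightarrow> real) \<Rightarrow> bool" where
  "admissible b \<alpha> N g \<longleftrightarrow> continuous_on {0<..<b} g \<and> (\<forall>\<theta>\<in>{0..b}. \<bar>g \<theta>\<bar> \<le> N * \<theta> powr - \<alpha>)"

lemma admissible_weighted_integral:
  assumes g: "admissible b \<alpha> N g" and \<alpha>: "\<alpha> < 1" and b: "0 < b"
    and c: "continuous_on {0..b} c" "\<And>\<theta>. \<bar>c \<theta>\<bar> \<le> 1"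
  shows "(\<lambda>\<phi>. c \<phi> * g \<phi>) integrable_on {0..b}"
    and "0 \<le> \<theta> \<Longrightarrow> \<theta> \<le> b \<Longrightarrow> \<bar>integral {0..\<theta>} (\<lambda>\<phi>. c \<phi> * g \<phi>)\<bar> \<le> N * (b powr (1 - \<alpha>) / (1 - \<alpha>))"
proof -
  have pw: "((\<lambda>\<theta>. N * \<theta> powr - \<alpha>) has_integral N * (x powr (- \<alpha> + 1) / (- \<alpha> + 1))) {0..x}" if "0 \<le> x" for x
    by (rule has_integral_mult_right[OF has_integral_powr_from_0]) (use \<alpha> that in auto)
  have le: "norm (c \<theta> * g \<theta>) \<le> N * \<theta> powr - \<alpha>" if "\<theta> \<in> {0..b}" for \<theta>
  proof -
    have "\<bar>c \<theta>\<bar> * \<bar>g \<theta>\<bar> \<le> 1 * \<bar>g \<theta>\<bar>" using c(2) by (intro mult_right_mono) auto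
    also have "\<dots> \<le> N * \<theta> powr - \<alpha>" using g that by (auto simp: admissible_def)
    finally show ?thesis by (simp add: abs_mult)
  qed
  have "(\<lambda>\<phi>. c \<phi> * g \<phi>) absolutely_integrable_on {0<..<b}"
  proof (rule measurable_bounded_by_integrable_imp_absolutely_integrable)
    have "continuous_on {0<..<b} (\<lambda>\<phi>. c \<phi> * g \<phi>)"
      using g by (intro continuous_intros continuous_on_subset[OF c(1)]) (auto simp: admissible_def)
    then show "(\<lambda>\<phi>. c \<phi> * g \<phi>) \<in> borel_measurable (lebesgue_on {0<..<b})"
      by (intro continuous_imp_measurable_on_sets_lebesgue) auto
    show "(\<lambda>\<theta>. N * \<theta> powr - \<alpha>) integrable_on {0<..<b}"
      using has_integral_integrable[OF pw[of b]] b by (simp add: integrable_on_Icc_iff_Ioo)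
  qed (use le in auto)
  then show int: "(\<lambda>\<phi>. c \<phi> * g \<phi>) integrable_on {0..b}"
    using set_lebesgue_integral_eq_integral(1)[of "{0<..<b}" "\<lambda>\<phi>. c \<phi> * g \<phi>"] by (simp add: integrable_on_Icc_iff_Ioo)
  show "\<bar>integral {0..\<theta>} (\<lambda>\<phi>. c \<phi> * g \<phi>)\<bar> \<le> N * (b powr (1 - \<alpha>) / (1 - \<alpha>))" if \<theta>: "0 \<le> \<theta>" "\<theta> \<le> b"
  proof -
    have "norm (integral {0..\<theta>} (\<lambda>\<phi>. c \<phi> * g \<phi>)) \<le> integral {0..\<theta>} (\<lambda>\<theta>. N * \<theta> powr - \<alpha>)"
      using pw[of \<theta>] \<theta> le by (intro integral_norm_bound_integral integrable_on_subinterval[OF int]) (auto simp: integrable_on_def)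
    also have "\<dots> = N * (\<theta> powr (1 - \<alpha>) / (1 - \<alpha>))" using integral_unique[OF pw[of \<theta>]] \<theta> by simp
    also have "\<dots> \<le> N * (b powr (1 - \<alpha>) / (1 - \<alpha>))"
    proof (intro mult_left_mono divide_right_mono powr_mono2)
      have "\<bar>g b\<bar> \<le> N * b powr - \<alpha>" using g b by (auto simp: admissible_def)
      then have "0 \<le> N * b powr - \<alpha>" by linarith
      then show "0 \<le> N" using b by (simp add: zero_le_mult_iff)
    qed (use \<alpha> \<theta> in auto)
    finally show ?thesis by simp
  qed
qed

definition cos_moment :: "(real \<Rightarrow> real) \<Rightarrow> real \<Rightarrow> real" where
  "cos_moment g \<theta> = integral {0..\<theta>} (\<lambda>\<phi>. cos (2 * \<phi>) * g \<phi>)"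

definition sin_moment :: "(real \<Rightarrow> real) \<Rightarrow> real \<Rightarrow> real" where
  "sin_moment g \<theta> = integral {0..\<theta>} (\<lambda>\<phi>. sin (2 * \<phi>) * g \<phi>)"

text \<open>The coefficient of the homogeneous solution \<open>sin (2 \<theta>)\<close> that makes the solution vanish at \<open>b\<close>.
It exists because \<open>sin (2 b) \<noteq> 0\<close>, that is, \<open>4\<close> is not a Dirichlet eigenvalue of \<open>[0, b]\<close>.\<close>

definition dirichlet_const :: "real \<Rightarrow> (real \<Rightarrow> real) \<Rightarrow> real" where
  "dirichlet_const b g = cos (2 * b) / sin (2 * b) * sin_moment g b - cos_moment g b"

text \<open>Variation of constants for \<open>4 G + G'' = g\<close>, \<open>G(0) = G(b) = 0\<close>.\<close>

definition dirichlet :: "real \<Rightarrow> (real \<Rightarrow> real) \<Rightarrow> real \<Rightarrow> real" where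
  "dirichlet b g \<theta> = 1 / 2 * (sin (2 * \<theta>) * (cos_moment g \<theta> + dirichlet_const b g) - cos (2 * \<theta>) * sin_moment g \<theta>)"

definition dirichlet' :: "real \<Rightarrow> (real \<Rightarrow> real) \<Rightarrow> real \<Rightarrow> real" where
  "dirichlet' b g \<theta> = cos (2 * \<theta>) * (cos_moment g \<theta> + dirichlet_const b g) + sin (2 * \<theta>) * sin_moment g \<theta>"

context
  fixes b \<alpha> :: real
  assumes b: "0 < b" "b \<le> pi / 3" and \<alpha>: "\<alpha> < 1"
begin

lemma sin_2b_pos: "sin (2 * b) > 0"
  using b pi_gt_zero by (intro sin_gt_zero) linarith+

lemmas cos_weighted = admissible_weighted_integral[OF _ \<alpha> b(1), of _ _ "\<lambda>\<phi>. cos (2 * \<phi>)"]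
lemmas sin_weighted = admissible_weighted_integral[OF _ \<alpha> b(1), of _ _ "\<lambda>\<phi>. sin (2 * \<phi>)"]

lemma cos_moment_props:
  assumes g: "admissible b \<alpha> N g"
  shows "continuous_on {0..b} (cos_moment g)" "continuous_on {0..b} (sin_moment g)"
    "0 < \<theta> \<Longrightarrow> \<theta> < b \<Longrightarrow> (cos_moment g has_real_derivative cos (2 * \<theta>) * g \<theta>) (at \<theta>)"
    "0 < \<theta> \<Longrightarrow> \<theta> < b \<Longrightarrow> (sin_moment g has_real_derivative sin (2 * \<theta>) * g \<theta>) (at \<theta>)"
proof -
  have ci: "(\<lambda>\<phi>. cos (2 * \<phi>) * g \<phi>) integrable_on {0..b}" and si: "(\<lambda>\<phi>. sin (2 * \<phi>) * g \<phi>) integrable_on {0..b}"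
    by (rule cos_weighted(1)[OF g] sin_weighted(1)[OF g]; auto intro!: continuous_intros)+
  show "continuous_on {0..b} (cos_moment g)" "continuous_on {0..b} (sin_moment g)"
    unfolding cos_moment_def[abs_def] sin_moment_def[abs_def] by (intro indefinite_integral_continuous_1 ci si)+
  have D: "((\<lambda>\<theta>. integral {0..\<theta>} (\<lambda>\<phi>. c \<phi> * g \<phi>)) has_real_derivative c \<theta> * g \<theta>) (at \<theta>)"
    if ci: "(\<lambda>\<phi>. c \<phi> * g \<phi>) integrable_on {0..b}" and c: "isCont c \<theta>" and \<theta>: "0 < \<theta>" "\<theta> < b" for c \<theta>
  proof -
    have "isCont g \<theta>" using g \<theta> by (auto simp: admissible_def continuous_on_eq_continuous_at)
    then have "continuous (at \<theta> within {0..b} - {}) (\<lambda>\<phi>. c \<phi> * g \<phi>)"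
      by (rule continuous_at_imp_continuous_within[OF continuous_mult[OF c]])
    then have "((\<lambda>\<theta>. integral {0..\<theta>} (\<lambda>\<phi>. c \<phi> * g \<phi>)) has_vector_derivative c \<theta> * g \<theta>) (at \<theta> within {0..b} - {})"
      using \<theta> by (intro integral_has_vector_derivative_continuous_at ci) auto
    then have "((\<lambda>\<theta>. integral {0..\<theta>} (\<lambda>\<phi>. c \<phi> * g \<phi>)) has_vector_derivative c \<theta> * g \<theta>) (at \<theta>)"
      using at_within_interior[of \<theta> "{0..b}"] \<theta> by simp
    then show ?thesis by (simp add: has_real_derivative_iff_has_vector_derivative)
  qed
  show "(cos_moment g has_real_derivative cos (2 * \<theta>) * g \<theta>) (at \<theta>)" "(sin_moment g has_real_derivative sin (2 * \<theta>) * g \<theta>) (at \<theta>)"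
    if "0 < \<theta>" "\<theta> < b"
    unfolding cos_moment_def[abs_def] sin_moment_def[abs_def] using that by (auto intro!: D ci si continuous_intros)
qed

lemma dirichlet_boundary: "dirichlet b g 0 = 0" "dirichlet b g b = 0"
  using sin_2b_pos by (simp_all add: dirichlet_def dirichlet_const_def cos_moment_def sin_moment_def)

lemma dirichlet_deriv:
  assumes g: "admissible b \<alpha> N g"
  shows "continuous_on {0..b} (dirichlet b g)" "continuous_on {0..b} (dirichlet' b g)"
    "0 < \<theta> \<Longrightarrow> \<theta> < b \<Longrightarrow> (dirichlet b g has_real_derivative dirichlet' b g \<theta>) (at \<theta>)"
    "0 < \<theta> \<Longrightarrow> \<theta> < b \<Longrightarrow> (dirichlet' b g has_real_derivative g \<theta> - 4 * dirichlet b g \<theta>) (at \<theta>)"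
proof -
  note I = cos_moment_props[OF g]
  show "continuous_on {0..b} (dirichlet b g)" "continuous_on {0..b} (dirichlet' b g)"
    unfolding dirichlet_def[abs_def] dirichlet'_def[abs_def] by (intro continuous_intros I)+
  assume \<theta>: "0 < \<theta>" "\<theta> < b"
  note [derivative_intros] = I(3,4)[OF \<theta>]
  have "(cos (2 * \<theta>))\<^sup>2 * g \<theta> + (sin (2 * \<theta>))\<^sup>2 * g \<theta> = g \<theta>"
    by (simp only: distrib_right[symmetric] sin_cos_squared_add2 mult_1_left)
  then have sq: "cos (2 * \<theta>) * (cos (2 * \<theta>) * g \<theta>) + sin (2 * \<theta>) * (sin (2 * \<theta>) * g \<theta>) = g \<theta>"
    by (simp only: power2_eq_square mult.assoc)
  have D: "((\<lambda>\<theta>. sin (2 * \<theta>) * (cos_moment g \<theta> + dirichlet_const b g) - cos (2 * \<theta>) * sin_moment g \<theta>) has_real_derivative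
      (cos (2 * \<theta>) * 2 * (cos_moment g \<theta> + dirichlet_const b g) + sin (2 * \<theta>) * (cos (2 * \<theta>) * g \<theta>)
      - (- (sin (2 * \<theta>) * 2) * sin_moment g \<theta> + cos (2 * \<theta>) * (sin (2 * \<theta>) * g \<theta>)))) (at \<theta>)"
    by (auto intro!: derivative_eq_intros)
  from DERIV_cmult[OF this, of "1 / 2"] show "(dirichlet b g has_real_derivative dirichlet' b g \<theta>) (at \<theta>)"
    unfolding dirichlet_def[abs_def] dirichlet'_def by (simp add: algebra_simps)
  have D': "(dirichlet' b g has_real_derivative
      - (sin (2 * \<theta>) * 2) * (cos_moment g \<theta> + dirichlet_const b g) + cos (2 * \<theta>) * (cos (2 * \<theta>) * g \<theta>)
      + (cos (2 * \<theta>) * 2 * sin_moment g \<theta> + sin (2 * \<theta>) * (sin (2 * \<theta>) * g \<theta>))) (at \<theta>)" (is "(_ has_real_derivative ?D') _")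
    unfolding dirichlet'_def[abs_def] by (auto intro!: derivative_eq_intros)
  have "?D' = (cos (2 * \<theta>) * (cos (2 * \<theta>) * g \<theta>) + sin (2 * \<theta>) * (sin (2 * \<theta>) * g \<theta>)) - 4 * dirichlet b g \<theta>"
    by (simp add: dirichlet_def algebra_simps)
  then have "?D' = g \<theta> - 4 * dirichlet b g \<theta>" unfolding sq .
  with D' show "(dirichlet' b g has_real_derivative g \<theta> - 4 * dirichlet b g \<theta>) (at \<theta>)" by simp
qed

text \<open>A bound for the solution operator from the weighted sup norm to \<open>C\<^sup>1\<close>.\<close>

definition dirichlet_norm :: real where
  "dirichlet_norm = (3 + 1 / sin (2 * b)) * (b powr (1 - \<alpha>) / (1 - \<alpha>))"

lemma dirichlet_norm_pos: "dirichlet_norm > 0"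
  unfolding dirichlet_norm_def using sin_2b_pos b \<alpha> by (intro mult_pos_pos divide_pos_pos add_pos_pos) auto

lemma dirichlet_bound:
  assumes g: "admissible b \<alpha> N g" and \<theta>: "0 \<le> \<theta>" "\<theta> \<le> b"
  shows "\<bar>dirichlet b g \<theta>\<bar> \<le> N * dirichlet_norm" "\<bar>dirichlet' b g \<theta>\<bar> \<le> N * dirichlet_norm"
proof -
  define I where "I = N * (b powr (1 - \<alpha>) / (1 - \<alpha>))"
  have C: "\<bar>cos_moment g \<theta>\<bar> \<le> I" if "0 \<le> \<theta>" "\<theta> \<le> b" for \<theta>
    unfolding cos_moment_def I_def by (rule cos_weighted(2)[OF g]) (use that in \<open>auto intro!: continuous_intros\<close>)
  have S: "\<bar>sin_moment g \<theta>\<bar> \<le> I" if "0 \<le> \<theta>" "\<theta> \<le> b" for \<theta>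
    unfolding sin_moment_def I_def by (rule sin_weighted(2)[OF g]) (use that in \<open>auto intro!: continuous_intros\<close>)
  have I0: "0 \<le> I" using C[OF \<theta>] by linarith
  have "\<bar>cos (2 * b) / sin (2 * b) * sin_moment g b\<bar> \<le> 1 / sin (2 * b) * I"
    unfolding abs_mult abs_divide using S[of b] b sin_2b_pos I0
    by (intro mult_mono divide_right_mono frac_le) auto
  then have k: "\<bar>dirichlet_const b g\<bar> \<le> 1 / sin (2 * b) * I + I"
    unfolding dirichlet_const_def using C[of b] b by linarith
  have nn: "N * dirichlet_norm = (3 + 1 / sin (2 * b)) * I" by (simp add: dirichlet_norm_def I_def)
  have p: "\<bar>x * y\<bar> \<le> Y" if "\<bar>x\<bar> \<le> 1" "\<bar>y\<bar> \<le> Y" for x y Y :: real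
    using mult_mono[OF that] that by (simp add: abs_mult)
  have "\<bar>sin (2 * \<theta>) * (cos_moment g \<theta> + dirichlet_const b g)\<bar> \<le> 1 / sin (2 * b) * I + 2 * I"
     "\<bar>cos (2 * \<theta>) * (cos_moment g \<theta> + dirichlet_const b g)\<bar> \<le> 1 / sin (2 * b) * I + 2 * I"
    using C[OF \<theta>] k by (intro p; simp; linarith)+
  moreover have "\<bar>sin (2 * \<theta>) * sin_moment g \<theta>\<bar> \<le> I" "\<bar>cos (2 * \<theta>) * sin_moment g \<theta>\<bar> \<le> I"
    using S[OF \<theta>] by (intro p; simp)+
  moreover have "(3 + 1 / sin (2 * b)) * I = 1 / sin (2 * b) * I + 2 * I + I" by (simp add: algebra_simps)
  moreover have "1 / sin (2 * b) * I \<ge> 0" using I0 sin_2b_pos by simp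
  ultimately have "\<bar>sin (2 * \<theta>) * (cos_moment g \<theta> + dirichlet_const b g) - cos (2 * \<theta>) * sin_moment g \<theta>\<bar> \<le> N * dirichlet_norm"
    and d': "\<bar>cos (2 * \<theta>) * (cos_moment g \<theta> + dirichlet_const b g) + sin (2 * \<theta>) * sin_moment g \<theta>\<bar> \<le> N * dirichlet_norm"
    unfolding nn by linarith+
  moreover have "\<bar>1 / 2 * x\<bar> \<le> y" if "\<bar>x\<bar> \<le> y" for x y :: real using that by (simp add: abs_mult)
  ultimately show "\<bar>dirichlet b g \<theta>\<bar> \<le> N * dirichlet_norm" unfolding dirichlet_def by blast
  show "\<bar>dirichlet' b g \<theta>\<bar> \<le> N * dirichlet_norm" using d' by (simp only: dirichlet'_def)
qed

lemma dirichlet_diff: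
  assumes g: "admissible b \<alpha> N g" and h: "admissible b \<alpha> M h" and \<theta>: "0 \<le> \<theta>" "\<theta> \<le> b"
  shows "dirichlet b (\<lambda>\<phi>. g \<phi> - h \<phi>) \<theta> = dirichlet b g \<theta> - dirichlet b h \<theta>"
proof -
  have i: "(\<lambda>\<phi>. cos (2 * \<phi>) * g \<phi>) integrable_on {0..b}" "(\<lambda>\<phi>. sin (2 * \<phi>) * g \<phi>) integrable_on {0..b}"
    "(\<lambda>\<phi>. cos (2 * \<phi>) * h \<phi>) integrable_on {0..b}" "(\<lambda>\<phi>. sin (2 * \<phi>) * h \<phi>) integrable_on {0..b}"
    by (rule cos_weighted(1)[OF g] sin_weighted(1)[OF g] cos_weighted(1)[OF h] sin_weighted(1)[OF h]; auto intro!: continuous_intros)+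
  have "cos_moment (\<lambda>\<phi>. g \<phi> - h \<phi>) x = cos_moment g x - cos_moment h x" "sin_moment (\<lambda>\<phi>. g \<phi> - h \<phi>) x = sin_moment g x - sin_moment h x"
    if "0 \<le> x" "x \<le> b" for x
    using that i unfolding cos_moment_def sin_moment_def right_diff_distrib
    by (auto intro!: Henstock_Kurzweil_Integration.integral_diff intro: integrable_on_subinterval)
  note e = this[OF \<theta>] this[OF less_imp_le[OF b(1)] order_refl]
  show ?thesis unfolding dirichlet_def dirichlet_const_def e
    by (simp add: algebra_simps diff_divide_distrib)
qed

text \<open>The triangle wave of period \<open>2 b\<close>; it reflects every angle into \<open>[0, b]\<close>.\<close>

definition fold_angle :: "real \<Rightarrow> real" where
  "fold_angle \<theta> = b / pi * arccos (cos (pi * \<theta> / b))"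

lemma fold_angle_id: "0 \<le> \<theta> \<Longrightarrow> \<theta> \<le> b \<Longrightarrow> fold_angle \<theta> = \<theta>"
  using b by (simp add: fold_angle_def arccos_cos field_simps)

lemma fold_angle_range: "0 \<le> fold_angle \<theta>" "fold_angle \<theta> \<le> b"
proof -
  have a: "0 \<le> arccos (cos (pi * \<theta> / b))" "arccos (cos (pi * \<theta> / b)) \<le> pi"
    by (simp_all add: arccos_lbound arccos_ubound)
  show "0 \<le> fold_angle \<theta>" using a b by (simp add: fold_angle_def)
  have "b / pi * arccos (cos (pi * \<theta> / b)) \<le> b / pi * pi"
    using a b pi_gt_zero by (intro mult_left_mono divide_nonneg_nonneg) linarith+
  then show "fold_angle \<theta> \<le> b" by (simp add: fold_angle_def)
qed

lemma fold_angle_cont: "continuous_on UNIV fold_angle"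
  unfolding fold_angle_def[abs_def] by (intro continuous_intros) (use b in auto)

lemma fold_angle_symm: "fold_angle (- \<theta>) = fold_angle \<theta>" "fold_angle (\<theta> + 2 * b) = fold_angle \<theta>"
proof -
  have "pi * (\<theta> + 2 * b) / b = pi * \<theta> / b + 2 * pi" using b by (simp add: field_simps)
  then show "fold_angle (\<theta> + 2 * b) = fold_angle \<theta>" by (simp add: fold_angle_def)
qed (simp add: fold_angle_def)

text \<open>If \<open>G\<close> is odd and \<open>2 b\<close>-periodic, then \<open>G'\<close> is even and \<open>2 b\<close>-periodic, hence determined on \<open>[0, b]\<close> by
folding. Extending \<open>G'\<close> and integrating gives a \<open>C\<^sup>1\<close> extension of \<open>G\<close> at once, with no matching of
one-sided derivatives at the multiples of \<open>b\<close>.\<close>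

definition ang_slope :: "(real \<Rightarrow> real) \<Rightarrow> real \<Rightarrow> real" where
  "ang_slope g \<theta> = dirichlet' b g (fold_angle \<theta>)"

definition ang_stream :: "(real \<Rightarrow> real) \<Rightarrow> real \<Rightarrow> real" where
  "ang_stream g \<theta> = (LBINT y=0..\<theta>. ang_slope g y)"

lemma ang_slope_cont:
  assumes g: "admissible b \<alpha> N g"
  shows "continuous_on S (ang_slope g)"
proof (rule continuous_on_subset)
  show "continuous_on UNIV (ang_slope g)" unfolding ang_slope_def[abs_def]
    by (rule continuous_on_compose2[OF dirichlet_deriv(2)[OF g] fold_angle_cont]) (use fold_angle_range in auto)
qed auto

lemma ang_slope_bound:
  assumes g: "admissible b \<alpha> N g"
  shows "\<bar>ang_slope g \<theta>\<bar> \<le> N * dirichlet_norm"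
  unfolding ang_slope_def by (rule dirichlet_bound(2)[OF g fold_angle_range])

lemma ang_stream_deriv:
  assumes g: "admissible b \<alpha> N g"
  shows "(ang_stream g has_real_derivative ang_slope g \<theta>) (at \<theta>)"
proof -
  let ?a = "- \<bar>\<theta>\<bar> - 1" and ?c = "\<bar>\<theta>\<bar> + 1"
  have "((\<lambda>u. LBINT y=0..u. ang_slope g y) has_vector_derivative ang_slope g \<theta>) (at \<theta> within {?a..?c})"
    using interval_integral_FTC2[of ?a 0 ?c "ang_slope g" \<theta>] ang_slope_cont[OF g] by (auto simp: zero_ereal_def)
  then have "((\<lambda>u. LBINT y=0..u. ang_slope g y) has_vector_derivative ang_slope g \<theta>) (at \<theta>)"
    using at_within_Icc_at[of ?a \<theta> ?c] by simp
  then show ?thesis unfolding ang_stream_def[abs_def] by (simp add: has_real_derivative_iff_has_vector_derivative)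
qed

lemma ang_stream_0: "ang_stream g 0 = 0"
  by (simp add: ang_stream_def zero_ereal_def)

lemma ang_stream_eq_dirichlet:
  assumes g: "admissible b \<alpha> N g" and \<theta>: "0 \<le> \<theta>" "\<theta> \<le> b"
  shows "ang_stream g \<theta> = dirichlet b g \<theta>"
proof (cases "\<theta> = 0")
  case False
  let ?d = "\<lambda>x. ang_stream g x - dirichlet b g x"
  have "?d \<theta> = ?d 0"
  proof (rule DERIV_isconst_end[of 0 \<theta> ?d])
    show "continuous_on {0..\<theta>} ?d"
      by (intro continuous_intros continuous_on_subset[OF dirichlet_deriv(1)[OF g]] DERIV_continuous_on[OF has_field_derivative_at_within[OF ang_stream_deriv[OF g]]]) (use \<theta> in auto)
    show "(?d has_real_derivative 0) (at x)" if "0 < x" "x < \<theta>" for x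
      using DERIV_diff[OF ang_stream_deriv[OF g] dirichlet_deriv(3)[OF g, of x]] that \<theta>
      by (simp add: ang_slope_def fold_angle_id)
  qed (use False \<theta> in auto)
  then show ?thesis by (simp add: ang_stream_0 dirichlet_boundary)
qed (simp add: ang_stream_0 dirichlet_boundary)

text \<open>Oddness is evenness of the derivative. Periodicity needs in addition \<open>G(b) = 0 = G(-b)\<close>, that is, the
boundary condition of the Dirichlet solution.\<close>

lemma ang_stream_symm:
  assumes g: "admissible b \<alpha> N g"
  shows "ang_stream g (- \<theta>) = - ang_stream g \<theta>" "ang_stream g (\<theta> + 2 * b) = ang_stream g \<theta>"
proof -
  note D = ang_stream_deriv[OF g]
  have "((\<lambda>x. ang_stream g (- x) + ang_stream g x) has_real_derivative ang_slope g (- x) * (- 1) + ang_slope g x) (at x)" for x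
    by (intro DERIV_add D DERIV_chain2[OF D]) (auto intro!: derivative_eq_intros)
  then have d: "((\<lambda>x. ang_stream g (- x) + ang_stream g x) has_real_derivative 0) (at x)" for x
    by (simp add: ang_slope_def fold_angle_symm)
  have odd: "ang_stream g (- x) = - ang_stream g x" for x
    using DERIV_isconst_all[OF allI[OF d], of x 0] by (simp add: ang_stream_0 eq_neg_iff_add_eq_0)
  then show "ang_stream g (- \<theta>) = - ang_stream g \<theta>" .
  have "((\<lambda>x. ang_stream g (x + 2 * b) - ang_stream g x) has_real_derivative ang_slope g (x + 2 * b) * 1 - ang_slope g x) (at x)" for x
    by (intro DERIV_diff D DERIV_chain2[OF D]) (auto intro!: derivative_eq_intros)
  then have "((\<lambda>x. ang_stream g (x + 2 * b) - ang_stream g x) has_real_derivative 0) (at x)" for x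
    by (simp add: ang_slope_def fold_angle_symm)
  from DERIV_isconst_all[OF allI[OF this], of \<theta> "- b"] show "ang_stream g (\<theta> + 2 * b) = ang_stream g \<theta>"
    using odd[of b] ang_stream_eq_dirichlet[OF g, of b] b by (simp add: dirichlet_boundary)
qed

lemma ang_slope_symm: "ang_slope g (- \<theta>) = ang_slope g \<theta>" "ang_slope g (\<theta> + 2 * b) = ang_slope g \<theta>"
  by (simp_all add: ang_slope_def fold_angle_symm)

lemma periodic_int_multiple:
  fixes h :: "real \<Rightarrow> real" and p :: real
  assumes "\<And>x. h (x + p) = h x"
  shows "h (x + of_int n * p) = h x"
proof (induction n arbitrary: x rule: int_induct[where k = 0])
  case (step1 i)
  have "h (x + of_int (i + 1) * p) = h (x + of_int i * p + p)" by (simp add: algebra_simps)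
  then show ?case using assms step1 by simp
next
  case (step2 i)
  have "h (x + of_int (i - 1) * p) = h (x + of_int (i - 1) * p + p)" using assms by simp
  also have "x + of_int (i - 1) * p + p = x + of_int i * p" by (simp add: algebra_simps)
  finally show ?case using step2 by simp
qed simp

text \<open>On \<open>(0, b)\<close> this is the equation for the Dirichlet solution; oddness carries it to \<open>(-b, 0)\<close> and
periodicity to every other interval between multiples of \<open>b\<close>.\<close>

lemma ang_slope_deriv:
  assumes g: "admissible b \<alpha> N g" and odd: "\<And>\<theta>. g (- \<theta>) = - g \<theta>" and per: "\<And>\<theta>. g (\<theta> + 2 * b) = g \<theta>"
    and \<theta>: "\<And>j::int. \<theta> \<noteq> j * b"
  shows "(ang_slope g has_real_derivative g \<theta> - 4 * ang_stream g \<theta>) (at \<theta>)"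
proof -
  have A: "(ang_slope g has_real_derivative g \<theta> - 4 * ang_stream g \<theta>) (at \<theta>)" if \<theta>: "0 < \<theta>" "\<theta> < b" for \<theta>
  proof -
    have "(dirichlet' b g has_real_derivative g \<theta> - 4 * ang_stream g \<theta>) (at \<theta>)"
      using dirichlet_deriv(4)[OF g \<theta>] ang_stream_eq_dirichlet[OF g] \<theta> by simp
    moreover have "\<forall>\<^sub>F x in nhds \<theta>. dirichlet' b g x = ang_slope g x"
      using eventually_nhds_in_open[of "{0<..<b}" \<theta>] \<theta> by (auto elim!: eventually_mono simp: ang_slope_def fold_angle_id)
    ultimately show ?thesis using DERIV_cong_ev by blast
  qed
  have B: "(ang_slope g has_real_derivative g \<theta> - 4 * ang_stream g \<theta>) (at \<theta>)" if \<theta>: "- b < \<theta>" "\<theta> < 0" for \<theta>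
  proof -
    have "((\<lambda>x. ang_slope g (- x)) has_real_derivative (g (- \<theta>) - 4 * ang_stream g (- \<theta>)) * (- 1)) (at \<theta>)"
      by (rule DERIV_chain2[OF A]) (use \<theta> in \<open>auto intro!: derivative_eq_intros\<close>)
    then show ?thesis by (simp add: ang_slope_symm odd ang_stream_symm[OF g])
  qed
  \<comment> \<open>Shift \<open>\<theta>\<close> by a multiple of the period into \<open>[-b, b)\<close>.\<close>
  define n where "n = \<lfloor>\<theta> / (2 * b) + 1 / 2\<rfloor>"
  define y where "y = \<theta> + of_int (- n) * (2 * b)"
  have "of_int n \<le> \<theta> / (2 * b) + 1 / 2" "\<theta> / (2 * b) + 1 / 2 < of_int n + 1" unfolding n_def by linarith+
  then have y: "- b \<le> y" "y < b" using b by (simp_all add: y_def field_simps)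
  have "y \<noteq> 0" using \<theta>[of "2 * n"] by (auto simp: y_def)
  moreover have "y \<noteq> - b" using \<theta>[of "2 * n - 1"] by (auto simp: y_def algebra_simps)
  ultimately have "(ang_slope g has_real_derivative g y - 4 * ang_stream g y) (at y)"
    using y A[of y] B[of y] by linarith
  then have "((\<lambda>x. ang_slope g (x + of_int (- n) * (2 * b))) has_real_derivative (g y - 4 * ang_stream g y) * 1) (at \<theta>)"
    by (intro DERIV_chain2[where g = "\<lambda>x. x + of_int (- n) * (2 * b)"]) (auto simp: y_def intro!: derivative_eq_intros)
  moreover have "g y = g \<theta>" "ang_stream g y = ang_stream g \<theta>" "ang_slope g (x + of_int (- n) * (2 * b)) = ang_slope g x" for x
    unfolding y_def by (rule periodic_int_multiple, rule per ang_stream_symm(2)[OF g] ang_slope_symm(2))+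
  ultimately show ?thesis by simp
qed

end

section \<open>Characteristics\<close>

text \<open>The square \<open>Y\<^sup>2\<close> decays at most exponentially, so \<open>Y\<close> has no zero; being positive at the start it stays
positive. Applied to the distances of a trajectory to two rest points.\<close>

lemma gronwall_positive:
  fixes Y D :: "real \<Rightarrow> real"
  assumes c: "continuous_on {0..t} Y" and d: "\<And>s. 0 < s \<Longrightarrow> s < t \<Longrightarrow> (Y has_real_derivative D s) (at s)"
    and D: "\<And>s. 0 < s \<Longrightarrow> s < t \<Longrightarrow> \<bar>D s\<bar> \<le> L * \<bar>Y s\<bar>" and pos: "Y 0 > 0" and t: "0 \<le> t"
  shows "Y t > 0"
proof -
  have nz: "Y s \<noteq> 0" if s: "0 \<le> s" "s \<le> t" for s
  proof -
    have "(Y 0)\<^sup>2 * exp (2 * L * 0) \<le> (Y s)\<^sup>2 * exp (2 * L * s)"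
    proof (rule DERIV_nonneg_imp_increasing_open[OF s(1)])
      fix x assume x: "0 < x" "x < s"
      have "((\<lambda>x. (Y x)\<^sup>2 * exp (2 * L * x)) has_real_derivative
          2 * Y x * D x * exp (2 * L * x) + (Y x)\<^sup>2 * (exp (2 * L * x) * (2 * L))) (at x)"
        using d[of x] x s by (auto intro!: derivative_eq_intros simp: power2_eq_square)
      moreover have "2 * Y x * D x * exp (2 * L * x) + (Y x)\<^sup>2 * (exp (2 * L * x) * (2 * L))
          = 2 * exp (2 * L * x) * (Y x * D x + L * (Y x)\<^sup>2)" by (simp add: algebra_simps)
      moreover have "0 \<le> Y x * D x + L * (Y x)\<^sup>2"
      proof -
        have "\<bar>Y x * D x\<bar> \<le> \<bar>Y x\<bar> * (L * \<bar>Y x\<bar>)" unfolding abs_mult using D[of x] x s by (intro mult_left_mono) auto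
        also have "\<dots> = L * (Y x)\<^sup>2" by (simp add: power2_eq_square)
        finally show ?thesis by linarith
      qed
      ultimately show "\<exists>y. ((\<lambda>x. (Y x)\<^sup>2 * exp (2 * L * x)) has_real_derivative y) (at x) \<and> 0 \<le> y" by auto
    qed (use s in \<open>auto intro!: continuous_intros continuous_on_subset[OF c]\<close>)
    then show ?thesis using pos by (auto simp: power2_eq_square mult_le_0_iff)
  qed
  show ?thesis
  proof (rule ccontr)
    assume "\<not> Y t > 0"
    then obtain s where "0 \<le> s" "s \<le> t" "Y s = 0"
      using IVT2'[of Y t 0 0] pos t c by force
    then show False using nz by blast
  qed
qed

lemma time_interval_Icc:
  assumes "T' \<in> time_interval T"
  shows "{0..T'} \<subseteq> time_interval T"
proof
  fix t assume "t \<in> {0..T'}"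
  then have "0 \<le> t" "ereal t \<le> ereal T'" by auto
  moreover have "ereal T' < T" using assms by (simp add: time_interval_def)
  ultimately show "t \<in> time_interval T" using le_less_trans[of "ereal t" "ereal T'" T] by (simp add: time_interval_def)
qed

lemma time_interval_extend:
  assumes "t \<in> time_interval T"
  shows "\<exists>T'\<in>time_interval T. t < T'"
proof -
  have "ereal t < T" "0 \<le> t" using assms by (auto simp: time_interval_def)
  then obtain z where "t < z" "ereal z < T" using ereal_dense2[of "ereal t" T] by auto
  then show ?thesis using \<open>0 \<le> t\<close> by (intro bexI[of _ z]) (auto simp: time_interval_def)
qed

text \<open>Transfers limits at \<open>t\<close> between the half-open time interval and compact ones. Every \<open>t\<close> admits a larger
\<open>T'\<close>, because a nonempty \<open>time_interval T\<close> has no largest element.\<close>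

lemma time_interval_at_within:
  assumes "T' \<in> time_interval T" "t < T'"
  shows "at t within time_interval T = at t within {0..T'}"
proof (rule at_within_nhd)
  show "t \<in> {..<T'}" "open {..<T'}" using assms(2) by auto
  have "time_interval T \<inter> {..<T'} = {0..T'} \<inter> {..<T'}"
    using time_interval_Icc[OF assms(1)] by (auto simp: time_interval_def)
  then show "time_interval T \<inter> {..<T'} - {t} = {0..T'} \<inter> {..<T'} - {t}" by simp
qed

text \<open>Picard iteration for the field truncated outside \<open>[0, b]\<close>, which is globally Lipschitz on each compact
time interval. One sequence of iterates serves all compact intervals; the weight \<open>exp (2 L t)\<close> gives
the contraction factor \<open>1/2\<close> on intervals of any length. The rest points \<open>0\<close> and \<open>b\<close> confine the
trajectory, so the truncation is never active.\<close>

lemma characteristic_exists: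
  fixes T :: ereal and V :: "real \<Rightarrow> real \<Rightarrow> real" and b \<theta> :: real
  defines "J \<equiv> time_interval T"
  assumes \<theta>: "0 < \<theta>" "\<theta> < b"
    and V0: "\<And>t. t \<in> J \<Longrightarrow> V t 0 = 0" "\<And>t. t \<in> J \<Longrightarrow> V t b = 0"
    and lip: "\<And>T'. T' \<in> J \<Longrightarrow> \<exists>L. \<forall>t\<in>{0..T'}. \<forall>x\<in>{0..b}. \<forall>y\<in>{0..b}. \<bar>V t x - V t y\<bar> \<le> L * \<bar>x - y\<bar>"
    and cont: "\<And>x. x \<in> {0..b} \<Longrightarrow> continuous_on J (\<lambda>t. V t x)"
  obtains X where "X 0 = \<theta>" "\<And>t. t \<in> J \<Longrightarrow> X t \<in> {0<..<b}"
    "\<And>t. t \<in> J \<Longrightarrow> (X has_real_derivative V t (X t)) (at t within J)"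
proof -
  have b: "0 < b" using \<theta> by linarith
  define clip where "clip x = max 0 (min b x)" for x
  have clip: "clip x \<in> {0..b}" "\<bar>clip x - clip y\<bar> \<le> \<bar>x - y\<bar>" for x y
    using b by (auto simp: clip_def)
  define W where "W t x = V t (clip x)" for t x
  define P where "P = rec_nat (\<lambda>t. \<theta>) (\<lambda>n Y t. \<theta> + integral {0..t} (\<lambda>s. W s (Y s)))"
  have P0: "P 0 = (\<lambda>t. \<theta>)" and PS: "P (Suc n) = (\<lambda>t. \<theta> + integral {0..t} (\<lambda>s. W s (P n s)))" for n
    by (simp_all add: P_def)
  \<comment> \<open>The telescoping series of the iterates, summed pointwise, so that \<open>X\<close> is defined before any
compact interval is chosen.\<close>
  define X where "X t = \<theta> + (\<Sum>i. P (Suc i) t - P i t)" for t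
  have J0: "{0..T'} \<subseteq> J" if "T' \<in> J" for T'
    using time_interval_Icc that by (simp add: J_def)
  have main: "continuous_on {0..T'} X \<and> (\<forall>t\<in>{0..T'}. (X has_real_derivative W t (X t)) (at t within {0..T'})) \<and>
      (\<exists>L. \<forall>t\<in>{0..T'}. \<forall>x. \<bar>W t x\<bar> \<le> L * \<bar>x\<bar> \<and> \<bar>W t x\<bar> \<le> L * \<bar>b - x\<bar>)"
    if T': "T' \<in> J" for T'
  proof -
    obtain L0 where L0: "\<And>t x y. t \<in> {0..T'} \<Longrightarrow> x \<in> {0..b} \<Longrightarrow> y \<in> {0..b} \<Longrightarrow> \<bar>V t x - V t y\<bar> \<le> L0 * \<bar>x - y\<bar>"
      using lip[OF T'] by blast
    define L where "L = max 1 L0"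
    have L: "1 \<le> L" "L0 \<le> L" by (auto simp: L_def)
    have LV: "\<bar>V t x - V t y\<bar> \<le> L * \<bar>x - y\<bar>" if "t \<in> {0..T'}" "x \<in> {0..b}" "y \<in> {0..b}" for t x y
      using L0[OF that] mult_right_mono[OF L(2), of "\<bar>x - y\<bar>"] by linarith
    have LW: "\<bar>W t x - W t y\<bar> \<le> L * \<bar>x - y\<bar>" if "t \<in> {0..T'}" for t x y
      using LV[OF that clip(1)[of x] clip(1)[of y]] mult_left_mono[OF clip(2)[of x y], of L] L unfolding W_def by linarith
    have W0: "\<bar>W t x\<bar> \<le> L * \<bar>x\<bar>" "\<bar>W t x\<bar> \<le> L * \<bar>b - x\<bar>" if "t \<in> {0..T'}" for t x
    proof -
      have tJ: "t \<in> J" using that J0[OF T'] by blast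
      show "\<bar>W t x\<bar> \<le> L * \<bar>x\<bar>" using LW[OF that, of x 0] V0[OF tJ] b by (simp add: W_def clip_def)
      have "W t b = 0" using V0[OF tJ] b by (simp add: W_def clip_def)
      then show "\<bar>W t x\<bar> \<le> L * \<bar>b - x\<bar>" using LW[OF that, of x b] by (simp add: abs_minus_commute)
    qed
    have cW: "continuous_on {0..T'} (\<lambda>s. W s (Y s))" if Y: "continuous_on {0..T'} Y" for Y
      unfolding continuous_on_def
    proof
      fix t assume t: "t \<in> {0..T'}"
      have "continuous_on {0..T'} (\<lambda>s. V s (clip (Y t)))"
        using cont[OF clip(1)] J0[OF T'] by (rule continuous_on_subset)
      then have "((\<lambda>s. V s (clip (Y t))) \<longlongrightarrow> V t (clip (Y t))) (at t within {0..T'})"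
        using t by (simp add: continuous_on_def)
      then have 1: "((\<lambda>s. W s (Y t) - W t (Y t)) \<longlongrightarrow> 0) (at t within {0..T'})"
        unfolding W_def by (rule LIM_zero)
      have "((\<lambda>s. L * \<bar>Y s - Y t\<bar>) \<longlongrightarrow> L * \<bar>Y t - Y t\<bar>) (at t within {0..T'})"
        using Y t by (intro tendsto_intros) (simp add: continuous_on_def)
      then have "((\<lambda>s. L * \<bar>Y s - Y t\<bar>) \<longlongrightarrow> 0) (at t within {0..T'})" by simp
      moreover have "\<forall>\<^sub>F s in at t within {0..T'}. norm (W s (Y s) - W s (Y t)) \<le> L * \<bar>Y s - Y t\<bar>"
        using LW by (auto simp: eventually_at_filter)
      ultimately have 2: "((\<lambda>s. W s (Y s) - W s (Y t)) \<longlongrightarrow> 0) (at t within {0..T'})"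
        by (rule Lim_null_comparison[rotated])
      have "((\<lambda>s. W s (Y s) - W t (Y t)) \<longlongrightarrow> 0) (at t within {0..T'})"
        using tendsto_add[OF 1 2] by simp
      then show "((\<lambda>s. W s (Y s)) \<longlongrightarrow> W t (Y t)) (at t within {0..T'})" by (rule LIM_zero_cancel)
    qed
    have cP: "continuous_on {0..T'} (P n)" for n
    proof (induction n)
      case (Suc n)
      show ?case unfolding PS
        by (intro continuous_intros indefinite_integral_continuous_1 integrable_continuous_real cW Suc)
    qed (simp add: P0)
    have iP: "(\<lambda>s. W s (P n s)) integrable_on {0..t}" if "t \<le> T'" for n t
      using that by (intro integrable_continuous_real continuous_on_subset[OF cW[OF cP]]) auto
    have step: "\<bar>P (Suc n) t - P n t\<bar> \<le> b / 2 ^ n * exp (2 * L * t)" if t: "0 \<le> t" "t \<le> T'" for n t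
      using t
    proof (induction n arbitrary: t)
      case 0
      have "norm (integral {0..t} (\<lambda>s. W s \<theta>)) \<le> L * b * (t - 0)"
      proof (rule integral_bound)
        show "continuous_on {0..t} (\<lambda>s. W s \<theta>)"
          using cW[OF continuous_on_const] by (rule continuous_on_subset) (use 0 in auto)
        show "norm (W s \<theta>) \<le> L * b" if "s \<in> {0..t}" for s
        proof -
          have "L * \<bar>\<theta>\<bar> \<le> L * b" using \<theta> L by (intro mult_left_mono) auto
          then show ?thesis using W0(1)[of s \<theta>] that 0 by auto
        qed
      qed (use 0 in auto)
      moreover have "b * (L * t) \<le> b * exp (2 * L * t)"
      proof (intro mult_left_mono)
        have "0 \<le> L * t" using L 0 by simp
        then show "L * t \<le> exp (2 * L * t)" using exp_ge_add_one_self[of "2 * L * t"] by linarith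
      qed (use b in simp)
      ultimately show ?case by (simp add: P0 PS mult_ac)
    next
      case (Suc n)
      have "P (Suc (Suc n)) t - P (Suc n) t = integral {0..t} (\<lambda>s. W s (P (Suc n) s)) - integral {0..t} (\<lambda>s. W s (P n s))"
        by (simp add: PS)
      also have "\<dots> = integral {0..t} (\<lambda>s. W s (P (Suc n) s) - W s (P n s))"
        using iP Suc.prems by (intro Henstock_Kurzweil_Integration.integral_diff[symmetric]) auto
      finally have eq: "P (Suc (Suc n)) t - P (Suc n) t = integral {0..t} (\<lambda>s. W s (P (Suc n) s) - W s (P n s))" .
      have hi: "((\<lambda>s. b / 2 ^ Suc n * (exp (2 * L * s) * (2 * L))) has_integral
          b / 2 ^ Suc n * exp (2 * L * t) - b / 2 ^ Suc n * exp (2 * L * 0)) {0..t}"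
        using Suc.prems by (intro fundamental_theorem_of_calculus)
           (auto intro!: derivative_eq_intros simp flip: has_real_derivative_iff_has_vector_derivative)
      have "norm (integral {0..t} (\<lambda>s. W s (P (Suc n) s) - W s (P n s))) \<le> integral {0..t} (\<lambda>s. b / 2 ^ Suc n * (exp (2 * L * s) * (2 * L)))"
      proof (rule integral_norm_bound_integral)
        show "(\<lambda>s. W s (P (Suc n) s) - W s (P n s)) integrable_on {0..t}"
          using iP Suc.prems by (intro Henstock_Kurzweil_Integration.integrable_diff) auto
        show "(\<lambda>s. b / 2 ^ Suc n * (exp (2 * L * s) * (2 * L))) integrable_on {0..t}" using hi by blast
        fix s assume s: "s \<in> {0..t}"
        have "\<bar>W s (P (Suc n) s) - W s (P n s)\<bar> \<le> L * \<bar>P (Suc n) s - P n s\<bar>" using LW s Suc.prems by auto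
        also have "\<dots> \<le> L * (b / 2 ^ n * exp (2 * L * s))" using Suc.IH[of s] s Suc.prems L by (intro mult_left_mono) auto
        finally show "norm (W s (P (Suc n) s) - W s (P n s)) \<le> b / 2 ^ Suc n * (exp (2 * L * s) * (2 * L))"
          by (simp add: field_simps)
      qed
      also have "\<dots> \<le> b / 2 ^ Suc n * exp (2 * L * t)" using b unfolding integral_unique[OF hi] by simp
      finally show ?case unfolding eq by simp
    qed
    have ul: "uniform_limit {0..T'} P X sequentially"
    proof -
      have "uniform_limit {0..T'} (\<lambda>n t. \<Sum>i<n. P (Suc i) t - P i t) (\<lambda>t. \<Sum>i. P (Suc i) t - P i t) sequentially"
      proof (rule Weierstrass_m_test)
        fix n t assume t: "t \<in> {0..T'}"
        have "\<bar>P (Suc n) t - P n t\<bar> \<le> b / 2 ^ n * exp (2 * L * t)" using step t by auto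
        also have "\<dots> \<le> b / 2 ^ n * exp (2 * L * T')" using t L b by (intro mult_left_mono) auto
        finally show "norm (P (Suc n) t - P n t) \<le> b * exp (2 * L * T') * (1 / 2) ^ n" by (simp add: power_divide mult_ac)
      qed (intro summable_mult summable_geometric, simp)
      moreover have "(\<Sum>i<n. P (Suc i) t - P i t) = P n t - \<theta>" for n t
        using sum_lessThan_telescope[of "\<lambda>i. P i t" n] by (simp add: P0)
      ultimately have "uniform_limit {0..T'} (\<lambda>n t. P n t - \<theta>) (\<lambda>t. X t - \<theta>) sequentially"
        by (simp add: X_def)
      then show ?thesis by (simp add: uniform_limit_iff dist_norm)
    qed
    have cX: "continuous_on {0..T'} X"
      by (rule uniform_limit_theorem[OF _ ul]) (auto simp: cP)
    have ulW: "uniform_limit {0..T'} (\<lambda>n s. W s (P n s)) (\<lambda>s. W s (X s)) sequentially"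
      unfolding uniform_limit_iff
    proof (intro allI impI)
      fix e :: real assume "e > 0"
      then have "\<forall>\<^sub>F n in sequentially. \<forall>s\<in>{0..T'}. dist (P n s) (X s) < e / L"
        using ul L unfolding uniform_limit_iff by simp
      then show "\<forall>\<^sub>F n in sequentially. \<forall>s\<in>{0..T'}. dist (W s (P n s)) (W s (X s)) < e"
      proof (rule eventually_mono, intro ballI)
        fix n s assume "\<forall>s\<in>{0..T'}. dist (P n s) (X s) < e / L" and s: "s \<in> {0..T'}"
        then have "L * \<bar>P n s - X s\<bar> < e" using L by (simp add: dist_real_def field_simps)
        then show "dist (W s (P n s)) (W s (X s)) < e" using LW[OF s, of "P n s" "X s"] by (simp add: dist_real_def)
      qed
    qed
    have fix_pt: "X t = \<theta> + integral {0..t} (\<lambda>s. W s (X s))" if t: "t \<in> {0..T'}" for t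
    proof -
      have "uniform_limit {0..t} (\<lambda>n s. W s (P n s)) (\<lambda>s. W s (X s)) sequentially"
        using ulW by (rule uniform_limit_on_subset) (use t in auto)
      then obtain I K where IK: "\<And>n. ((\<lambda>s. W s (P n s)) has_integral I n) {0..t}"
         "((\<lambda>s. W s (X s)) has_integral K) {0..t}" "I \<longlonglongrightarrow> K"
        by (rule uniform_limit_integral) (use t in \<open>auto intro: continuous_on_subset[OF cW[OF cP]]\<close>)
      have "(\<lambda>n. \<theta> + I n) \<longlonglongrightarrow> \<theta> + K" by (intro tendsto_intros IK)
      then have "(\<lambda>n. P (Suc n) t) \<longlonglongrightarrow> \<theta> + K" unfolding PS using IK(1)[THEN integral_unique] by simp
      moreover have "(\<lambda>n. P (Suc n) t) \<longlonglongrightarrow> X t"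
        using tendsto_uniform_limitI[OF ul t] by (rule LIMSEQ_Suc)
      ultimately show ?thesis using LIMSEQ_unique IK(2)[THEN integral_unique] by blast
    qed
    have "(X has_real_derivative W t (X t)) (at t within {0..T'})" if t: "t \<in> {0..T'}" for t
    proof -
      have "((\<lambda>t. \<theta> + integral {0..t} (\<lambda>s. W s (X s))) has_real_derivative 0 + W t (X t)) (at t within {0..T'})"
        by (intro DERIV_add DERIV_const integral_has_real_derivative cW cX t)
      then show ?thesis
        using has_field_derivative_transform_within[OF _ zero_less_one t, of _ "W t (X t)" X] fix_pt by simp
    qed
    then show ?thesis using cX W0 by blast
  qed
  have "P n 0 = \<theta>" for n by (cases n) (simp_all add: P0 PS)
  then have X0: "X 0 = \<theta>" by (simp add: X_def)
  have der: "(X has_real_derivative W t (X t)) (at t within J)" if t: "t \<in> J" for t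
  proof -
    obtain T' where T': "t < T'" "T' \<in> J" using time_interval_extend t unfolding J_def by blast
    have t0: "0 \<le> t" using t by (simp add: J_def time_interval_def)
    have "at t within J = at t within {0..T'}" unfolding J_def
      by (rule time_interval_at_within) (use T' in \<open>auto simp: J_def\<close>)
    then show ?thesis using main[OF T'(2)] t0 T'(1) by auto
  qed
  have rng: "X t \<in> {0<..<b}" if t: "t \<in> J" for t
  proof -
    have t0: "0 \<le> t" using t by (simp add: J_def time_interval_def)
    obtain L where L: "\<And>s x. s \<in> {0..t} \<Longrightarrow> \<bar>W s x\<bar> \<le> L * \<bar>x\<bar> \<and> \<bar>W s x\<bar> \<le> L * \<bar>b - x\<bar>"
      using main[OF t] by blast
    have cX: "continuous_on {0..t} X" using main[OF t] by blast
    have d: "(X has_real_derivative W s (X s)) (at s)" if s: "0 < s" "s < t" for s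
    proof -
      have "(X has_real_derivative W s (X s)) (at s within {0..t})" using main[OF t] s by simp
      then show ?thesis using at_within_Icc_at[OF s] by simp
    qed
    have "X t > 0"
      by (rule gronwall_positive[OF cX d _ _ t0, where L = L]) (use L X0 \<theta> in auto)
    moreover have "b - X t > 0"
    proof (rule gronwall_positive[where Y = "\<lambda>s. b - X s" and D = "\<lambda>s. - W s (X s)" and L = L])
      show "((\<lambda>s. b - X s) has_real_derivative - W s (X s)) (at s)" if "0 < s" "s < t" for s
        using DERIV_diff[OF DERIV_const d[OF that], of b] by simp
    qed (use L X0 \<theta> t0 in \<open>auto intro!: continuous_intros cX\<close>)
    ultimately show ?thesis by simp
  qed
  show thesis
  proof (rule that[of X, OF X0 rng])
    fix t assume t: "t \<in> J"
    have "clip (X t) = X t" using rng[OF t] by (simp add: clip_def)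
    then show "(X has_real_derivative V t (X t)) (at t within J)" using der[OF t] by (simp add: W_def)
  qed
qed

section \<open>Scale-invariant bounds and radial limits\<close>

lemma dderiv_diff:
  assumes "f differentiable (at x)" "g differentiable (at x)"
  shows "dderiv v (\<lambda>y. f y - g y) x = dderiv v f x - dderiv v g x"
proof -
  have "((\<lambda>y. f y - g y) has_derivative (\<lambda>h. frechet_derivative f (at x) h - frechet_derivative g (at x) h)) (at x)"
    using assms by (intro has_derivative_diff) (simp_all add: frechet_derivative_works[symmetric])
  from frechet_derivative_at[OF this, symmetric] show ?thesis by (simp only: dderiv_def)
qed

definition polar_diff :: "nat \<Rightarrow> (complex \<Rightarrow> real) \<Rightarrow> bool" where
  "polar_diff m f \<longleftrightarrow> (\<forall>x\<in>polar_sector m. polar f differentiable (at x))"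

lemma smooth_on_differentiable: "smooth_on S f \<Longrightarrow> x \<in> S \<Longrightarrow> f differentiable (at x)"
  unfolding smooth_on_def by (elim allE[of _ "[]"]) simp

lemma Comega_lam_polar_diff: "f \<in> Comega_lam m \<alpha> lam \<Longrightarrow> polar_diff m f"
  unfolding polar_diff_def Comega_lam_def using smooth_on_differentiable by blast

text \<open>The terms \<open>k = 0\<close> and \<open>k = 1\<close> of the norm.\<close>

definition C1_bound :: "nat \<Rightarrow> real \<Rightarrow> real \<Rightarrow> (complex \<Rightarrow> real) \<Rightarrow> bool" where
  "C1_bound m \<alpha> N f \<longleftrightarrow> (\<forall>r \<theta>. (r, \<theta>) \<in> polar_sector m \<longrightarrow>
     \<bar>(r + \<theta>) powr \<alpha> * polar f (r, \<theta>)\<bar> \<le> N \<and>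
     \<bar>(r + \<theta>) powr (1 + \<alpha>) * dderiv (1, 0) (polar f) (r, \<theta>)\<bar> \<le> N \<and>
     \<bar>(r + \<theta>) powr (1 + \<alpha>) * dderiv (0, 1) (polar f) (r, \<theta>)\<bar> \<le> N)"

lemma C1_bound_mono: "C1_bound m \<alpha> N f \<Longrightarrow> N \<le> M \<Longrightarrow> C1_bound m \<alpha> M f"
  unfolding C1_bound_def by (meson order_trans)

lemma C1_bound_of_norm:
  assumes lam: "lam > 0" and e: "0 \<le> e" and le: "Comega_norm m \<alpha> lam f \<le> ennreal e"
  shows "C1_bound m \<alpha> (e * (1 + 1 / lam)) f"
proof -
  have *: "lam ^ k / fact k * \<bar>(r + \<theta>) powr (real k + \<alpha>) * F (r, \<theta>)\<bar> \<le> e"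
    if s: "(r, \<theta>) \<in> polar_sector m" and F: "F = (dderiv (1, 0) ^^ k) (polar f) \<or> F = (dderiv (0, 1) ^^ k) (polar f)" for k r \<theta> F
  proof -
    let ?A = "weighted_sup m (real k + \<alpha>) ((dderiv (1, 0) ^^ k) (polar f))"
    let ?B = "weighted_sup m (real k + \<alpha>) ((dderiv (0, 1) ^^ k) (polar f))"
    let ?x = "\<bar>(r + \<theta>) powr (real k + \<alpha>) * F (r, \<theta>)\<bar>"
    define S where "S k = ennreal (lam ^ k / fact k) *
        (weighted_sup m (real k + \<alpha>) ((dderiv (1, 0) ^^ k) (polar f)) +
         weighted_sup m (real k + \<alpha>) ((dderiv (0, 1) ^^ k) (polar f)))" for k
    have "ennreal ?x \<le> weighted_sup m (real k + \<alpha>) F"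
      unfolding weighted_sup_def using SUP_upper[OF s, of "\<lambda>(r, \<theta>). ennreal \<bar>(r + \<theta>) powr (real k + \<alpha>) * F (r, \<theta>)\<bar>"] by simp
    also have "\<dots> \<le> ?A + ?B" using F by (elim disjE) (simp_all add: add_increasing add_increasing2)
    finally have "ennreal (lam ^ k / fact k) * ennreal ?x \<le> S k"
      unfolding S_def by (rule mult_left_mono) simp
    also have "S k = (\<Sum>j\<in>{k}. S j)" by simp
    also have "\<dots> \<le> (\<Sum>j. S j)" by (rule sum_le_suminf) auto
    also have "\<dots> = Comega_norm m \<alpha> lam f" by (simp add: Comega_norm_def S_def)
    also note le
    finally have "ennreal (lam ^ k / fact k * ?x) \<le> ennreal e"
      by (simp only: ennreal_mult''[OF abs_ge_zero])
    then show ?thesis using e by (simp only: ennreal_le_iff)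
  qed
  have e1: "e \<le> e * (1 + 1 / lam)" using e lam by (simp add: field_simps)
  have e2: "x \<le> e * (1 + 1 / lam)" if "lam * x \<le> e" for x
  proof -
    have "x \<le> e / lam" using that lam by (simp add: field_simps)
    also have "\<dots> \<le> e * (1 + 1 / lam)" using e lam by (simp add: field_simps)
    finally show ?thesis .
  qed
  show ?thesis unfolding C1_bound_def
  proof (intro allI impI conjI)
    fix r \<theta> assume s: "(r, \<theta>) \<in> polar_sector m"
    show "\<bar>(r + \<theta>) powr \<alpha> * polar f (r, \<theta>)\<bar> \<le> e * (1 + 1 / lam)"
      using *[OF s, of "polar f" 0] e1 by simp
    show "\<bar>(r + \<theta>) powr (1 + \<alpha>) * dderiv (1, 0) (polar f) (r, \<theta>)\<bar> \<le> e * (1 + 1 / lam)"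
      by (rule e2) (use *[OF s, of "dderiv (1, 0) (polar f)" 1] in simp)
    show "\<bar>(r + \<theta>) powr (1 + \<alpha>) * dderiv (0, 1) (polar f) (r, \<theta>)\<bar> \<le> e * (1 + 1 / lam)"
      by (rule e2) (use *[OF s, of "dderiv (0, 1) (polar f)" 1] in simp)
  qed
qed

lemma polar_minus: "polar (\<lambda>z. f z - h z) = (\<lambda>x. polar f x - polar h x)"
  by (auto simp: polar_def)

lemma C1_bound_triangle:
  assumes "C1_bound m \<alpha> N f" "C1_bound m \<alpha> M (\<lambda>z. h z - f z)" "polar_diff m f" "polar_diff m h"
  shows "C1_bound m \<alpha> (N + M) h"
  unfolding C1_bound_def
proof (intro allI impI)
  fix r \<theta> assume s: "(r, \<theta>) \<in> polar_sector m"
  have t: "\<bar>w * x\<bar> \<le> N + M" if "\<bar>w * y\<bar> \<le> N" "\<bar>w * (x - y)\<bar> \<le> M" for w x y :: real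
    using that abs_triangle_ineq[of "w * y" "w * (x - y)"] by (simp add: algebra_simps)
  have d: "dderiv v (polar (\<lambda>z. h z - f z)) (r, \<theta>) = dderiv v (polar h) (r, \<theta>) - dderiv v (polar f) (r, \<theta>)" for v
    unfolding polar_minus by (rule dderiv_diff) (use assms(3,4) s in \<open>auto simp: polar_diff_def\<close>)
  have p: "polar (\<lambda>z. h z - f z) (r, \<theta>) = polar h (r, \<theta>) - polar f (r, \<theta>)" by (simp add: polar_minus)
  note f = assms(1)[unfolded C1_bound_def, rule_format, OF s]
  note hf = assms(2)[unfolded C1_bound_def, rule_format, OF s, unfolded d p]
  show "\<bar>(r + \<theta>) powr \<alpha> * polar h (r, \<theta>)\<bar> \<le> N + M \<and>
     \<bar>(r + \<theta>) powr (1 + \<alpha>) * dderiv (1, 0) (polar h) (r, \<theta>)\<bar> \<le> N + M \<and>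
     \<bar>(r + \<theta>) powr (1 + \<alpha>) * dderiv (0, 1) (polar h) (r, \<theta>)\<bar> \<le> N + M"
    using f hf by (intro conjI t) (elim conjE, assumption)+
qed

text \<open>Heine-Borel for bounds that are only given as admissible constants.\<close>

lemma locally_bounded_on_interval:
  fixes P :: "real \<Rightarrow> real \<Rightarrow> bool"
  assumes mono: "\<And>t N M. P t N \<Longrightarrow> N \<le> M \<Longrightarrow> P t M"
    and loc: "\<And>t. t \<in> {a..b} \<Longrightarrow> \<exists>N. P t N \<and> (\<forall>\<^sub>F s in at t within {a..b}. P s N)"
  shows "\<exists>N. \<forall>t\<in>{a..b}. P t N"
proof -
  have "\<exists>N d. d > 0 \<and> (\<forall>s\<in>{a..b}. dist s t < d \<longrightarrow> P s N)" if "t \<in> {a..b}" for t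
    using loc[OF that] unfolding eventually_at by (metis dist_self dist_nz)
  then obtain N d where d: "\<And>t. t \<in> {a..b} \<Longrightarrow> d t > 0" "\<And>t s. t \<in> {a..b} \<Longrightarrow> s \<in> {a..b} \<Longrightarrow> dist s t < d t \<Longrightarrow> P s (N t)"
    by metis
  have "{a..b} \<subseteq> (\<Union>t\<in>{a..b}. ball t (d t))" using d(1) by fastforce
  then obtain D where D: "D \<subseteq> {a..b}" "finite D" "{a..b} \<subseteq> (\<Union>t\<in>D. ball t (d t))"
    using compactE_image[OF compact_Icc, of "{a..b}" "\<lambda>t. ball t (d t)"] by (metis open_ball)
  have "P s (\<Sum>t\<in>D. \<bar>N t\<bar>)" if s: "s \<in> {a..b}" for s
  proof -
    obtain t where t: "t \<in> D" "dist s t < d t" using D(3) s by (auto simp: dist_commute)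
    then have "P s (N t)" using d(2) D(1) s by blast
    moreover have "N t \<le> (\<Sum>t\<in>D. \<bar>N t\<bar>)"
      using member_le_sum[OF t(1), of "\<lambda>t. \<bar>N t\<bar>"] D(2) by simp
    ultimately show ?thesis by (rule mono)
  qed
  then show ?thesis by blast
qed

lemma continuous_Comega_C1:
  assumes c: "continuous_Comega m \<alpha> T \<omega>" and T': "T' \<in> time_interval T"
  shows "\<exists>N. \<forall>t\<in>{0..T'}. C1_bound m \<alpha> N (\<omega> t)"
    and "t \<in> {0..T'} \<Longrightarrow> \<epsilon> > 0 \<Longrightarrow> \<forall>\<^sub>F s in at t within {0..T'}. C1_bound m \<alpha> \<epsilon> (\<lambda>z. \<omega> s z - \<omega> t z)"
    and "t \<in> {0..T'} \<Longrightarrow> polar_diff m (\<omega> t) \<and> odd_mfold m (\<omega> t)"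
proof -
  obtain lam where lam: "lam > 0" and mem: "\<And>t. t \<in> {0..T'} \<Longrightarrow> \<omega> t \<in> Comega_lam m \<alpha> lam"
    and lim: "\<And>t. t \<in> {0..T'} \<Longrightarrow> ((\<lambda>s. Comega_norm m \<alpha> lam (\<lambda>z. \<omega> s z - \<omega> t z)) \<longlongrightarrow> 0) (at t within {0..T'})"
    using c T' unfolding continuous_Comega_def by blast
  show diff: "polar_diff m (\<omega> t) \<and> odd_mfold m (\<omega> t)" if "t \<in> {0..T'}" for t
    using Comega_lam_polar_diff[OF mem[OF that]] mem[OF that] by (auto simp: Comega_lam_def)
  show close: "\<forall>\<^sub>F s in at t within {0..T'}. C1_bound m \<alpha> \<epsilon> (\<lambda>z. \<omega> s z - \<omega> t z)"
    if t: "t \<in> {0..T'}" and \<epsilon>: "\<epsilon> > 0" for t \<epsilon>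
  proof -
    define e where "e = \<epsilon> / (1 + 1 / lam)"
    have q: "1 + 1 / lam > 0" using lam by (simp add: add_pos_pos)
    have e: "e > 0" "e * (1 + 1 / lam) = \<epsilon>" using \<epsilon> q by (auto simp: e_def)
    have "\<forall>\<^sub>F s in at t within {0..T'}. Comega_norm m \<alpha> lam (\<lambda>z. \<omega> s z - \<omega> t z) < ennreal e"
      using lim[OF t] e by (intro order_tendstoD(2)) auto
    then show ?thesis
    proof (rule eventually_mono)
      fix s assume lt: "Comega_norm m \<alpha> lam (\<lambda>z. \<omega> s z - \<omega> t z) < ennreal e"
      from C1_bound_of_norm[OF lam less_imp_le[OF e(1)] less_imp_le[OF lt]]
      show "C1_bound m \<alpha> \<epsilon> (\<lambda>z. \<omega> s z - \<omega> t z)" unfolding e(2) .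
    qed
  qed
  show "\<exists>N. \<forall>t\<in>{0..T'}. C1_bound m \<alpha> N (\<omega> t)"
  proof (rule locally_bounded_on_interval[OF C1_bound_mono])
    fix t assume t: "t \<in> {0..T'}"
    have "Comega_norm m \<alpha> lam (\<omega> t) < \<infinity>" using mem[OF t] by (simp add: Comega_lam_def)
    then obtain e where "0 \<le> e" "Comega_norm m \<alpha> lam (\<omega> t) = ennreal e"
      by (cases "Comega_norm m \<alpha> lam (\<omega> t)") auto
    then have 0: "C1_bound m \<alpha> (e * (1 + 1 / lam)) (\<omega> t)" using C1_bound_of_norm[OF lam] by simp
    have "\<forall>\<^sub>F s in at t within {0..T'}. s \<in> {0..T'}" by (simp add: eventually_at_filter)
    with close[OF t zero_less_one] have "\<forall>\<^sub>F s in at t within {0..T'}. C1_bound m \<alpha> (e * (1 + 1 / lam) + 1) (\<omega> s)"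
      by eventually_elim (use 0 diff t in \<open>blast intro: C1_bound_triangle\<close>)
    moreover have "C1_bound m \<alpha> (e * (1 + 1 / lam) + 1) (\<omega> t)" using C1_bound_mono[OF 0] by simp
    ultimately show "\<exists>N. C1_bound m \<alpha> N (\<omega> t) \<and> (\<forall>\<^sub>F s in at t within {0..T'}. C1_bound m \<alpha> N (\<omega> s))" by blast
  qed
qed

lemma C1_bound_D:
  assumes N: "C1_bound m \<alpha> N f" and \<alpha>: "0 \<le> \<alpha>" and r: "0 < r" and \<theta>: "0 < \<theta>" "\<theta> < pi / m"
  shows "\<bar>f (rcis r \<theta>)\<bar> \<le> N * \<theta> powr - \<alpha>"
    and "\<bar>dderiv (1, 0) (polar f) (r, \<theta>)\<bar> \<le> N * \<theta> powr - (1 + \<alpha>)"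
    and "\<bar>dderiv (0, 1) (polar f) (r, \<theta>)\<bar> \<le> N * \<theta> powr - (1 + \<alpha>)"
proof -
  have s: "(r, \<theta>) \<in> polar_sector m" using r \<theta> by (simp add: polar_sector_def)
  have *: "\<bar>x\<bar> \<le> N * \<theta> powr - a" if "\<bar>(r + \<theta>) powr a * x\<bar> \<le> N" "0 \<le> a" for x a
  proof -
    have "\<theta> powr a * \<bar>x\<bar> \<le> (r + \<theta>) powr a * \<bar>x\<bar>"
      using r \<theta> that(2) by (intro mult_right_mono powr_mono2) auto
    also have "\<dots> \<le> N" using that(1) by (simp add: abs_mult)
    finally show ?thesis using \<theta> by (simp add: powr_minus field_simps)
  qed
  note F = N[unfolded C1_bound_def, rule_format, OF s]
  have "\<bar>polar f (r, \<theta>)\<bar> \<le> N * \<theta> powr - \<alpha>" by (rule *[OF conjunct1[OF F] \<alpha>])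
  then show "\<bar>f (rcis r \<theta>)\<bar> \<le> N * \<theta> powr - \<alpha>" by (simp only: polar_def prod.case)
  show "\<bar>dderiv (1, 0) (polar f) (r, \<theta>)\<bar> \<le> N * \<theta> powr - (1 + \<alpha>)"
    by (rule *[OF conjunct1[OF conjunct2[OF F]]]) (use \<alpha> in simp)
  show "\<bar>dderiv (0, 1) (polar f) (r, \<theta>)\<bar> \<le> N * \<theta> powr - (1 + \<alpha>)"
    by (rule *[OF conjunct2[OF conjunct2[OF F]]]) (use \<alpha> in simp)
qed

text \<open>Restriction of the total derivative of \<open>polar f\<close> to the coordinate lines.\<close>

lemma polar_line_derivs:
  assumes "polar_diff m f" "0 < r" "0 < \<theta>" "\<theta> < pi / m"
  shows "((\<lambda>r. f (rcis r \<theta>)) has_real_derivative dderiv (1, 0) (polar f) (r, \<theta>)) (at r)"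
    and "((\<lambda>\<theta>. f (rcis r \<theta>)) has_real_derivative dderiv (0, 1) (polar f) (r, \<theta>)) (at \<theta>)"
proof -
  have D: "(polar f has_derivative frechet_derivative (polar f) (at (r, \<theta>))) (at (r, \<theta>))"
    using assms by (simp add: polar_diff_def polar_sector_def frechet_derivative_works[symmetric])
  have lin: "frechet_derivative (polar f) (at (r, \<theta>)) (c *\<^sub>R v) = c * frechet_derivative (polar f) (at (r, \<theta>)) v" for c v
    using linear_scale[OF has_derivative_linear[OF D]] by simp
  have r: "((\<lambda>r. (r, \<theta>)) has_derivative (\<lambda>h. (h, 0))) (at r)" by (auto intro!: derivative_eq_intros)
  have \<theta>: "((\<lambda>\<theta>. (r, \<theta>)) has_derivative (\<lambda>h. (0, h))) (at \<theta>)" by (auto intro!: derivative_eq_intros)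
  have eq: "(\<lambda>h. frechet_derivative (polar f) (at (r, \<theta>)) (h, 0)) = (*) (dderiv (1, 0) (polar f) (r, \<theta>))"
    "(\<lambda>h. frechet_derivative (polar f) (at (r, \<theta>)) (0, h)) = (*) (dderiv (0, 1) (polar f) (r, \<theta>))"
  proof (intro ext)
    fix h
    show "frechet_derivative (polar f) (at (r, \<theta>)) (h, 0) = dderiv (1, 0) (polar f) (r, \<theta>) * h"
      using lin[of h "(1, 0)"] by (simp add: dderiv_def)
  next
    show "(\<lambda>h. frechet_derivative (polar f) (at (r, \<theta>)) (0, h)) = (*) (dderiv (0, 1) (polar f) (r, \<theta>))"
    proof
      fix h
      show "frechet_derivative (polar f) (at (r, \<theta>)) (0, h) = dderiv (0, 1) (polar f) (r, \<theta>) * h"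
        using lin[of h "(0, 1)"] by (simp add: dderiv_def)
    qed
  qed
  have pf: "(\<lambda>r. polar f (r, \<theta>)) = (\<lambda>r. f (rcis r \<theta>))" "(\<lambda>\<theta>. polar f (r, \<theta>)) = (\<lambda>\<theta>. f (rcis r \<theta>))"
    by (simp_all add: polar_def)
  show "((\<lambda>r. f (rcis r \<theta>)) has_real_derivative dderiv (1, 0) (polar f) (r, \<theta>)) (at r)"
    using has_derivative_compose[OF r D] unfolding has_field_derivative_def eq pf .
  show "((\<lambda>\<theta>. f (rcis r \<theta>)) has_real_derivative dderiv (0, 1) (polar f) (r, \<theta>)) (at \<theta>)"
    using has_derivative_compose[OF \<theta> D] unfolding has_field_derivative_def eq pf .
qed

text \<open>The value \<open>0\<close> where no limit exists respects the symmetries, so the radial limit of an odd, \<open>m\<close>-fold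
symmetric function has these symmetries at every angle, including those on the rays.\<close>

definition radial_limit :: "(complex \<Rightarrow> real) \<Rightarrow> real \<Rightarrow> real" where
  "radial_limit f \<theta> = (if \<exists>l. ((\<lambda>r. f (rcis r \<theta>)) \<longlongrightarrow> l) (at_right 0)
     then Lim (at_right 0) (\<lambda>r. f (rcis r \<theta>)) else 0)"

lemma radial_limit_eq: "((\<lambda>r. f (rcis r \<theta>)) \<longlongrightarrow> l) (at_right 0) \<Longrightarrow> radial_limit f \<theta> = l"
  unfolding radial_limit_def using tendsto_Lim[OF trivial_limit_at_right_real] by auto

lemma radial_limit_cong_scale:
  assumes "\<And>r. 0 < r \<Longrightarrow> f (rcis r \<theta>') = c * f (rcis r \<theta>)" "c \<noteq> 0"
  shows "radial_limit f \<theta>' = c * radial_limit f \<theta>"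
proof -
  have e: "\<forall>\<^sub>F r in at_right 0. f (rcis r \<theta>') = c * f (rcis r \<theta>)"
    using assms(1) by (auto simp: eventually_at_right_field intro: exI[of _ 1])
  have 1: "((\<lambda>r. f (rcis r \<theta>')) \<longlongrightarrow> c * l) (at_right 0)" if "((\<lambda>r. f (rcis r \<theta>)) \<longlongrightarrow> l) (at_right 0)" for l
    using tendsto_mult_left[OF that, of c] by (simp only: tendsto_cong[OF e])
  have 2: "((\<lambda>r. f (rcis r \<theta>)) \<longlongrightarrow> l / c) (at_right 0)" if "((\<lambda>r. f (rcis r \<theta>')) \<longlongrightarrow> l) (at_right 0)" for l
  proof -
    have "((\<lambda>r. c * f (rcis r \<theta>)) \<longlongrightarrow> l) (at_right 0)" using that by (simp only: tendsto_cong[OF e])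
    from tendsto_mult_left[OF this, of "1 / c"] show ?thesis using assms(2) by simp
  qed
  show ?thesis
  proof (cases "\<exists>l. ((\<lambda>r. f (rcis r \<theta>)) \<longlongrightarrow> l) (at_right 0)")
    case True
    then show ?thesis using 1 radial_limit_eq by metis
  next
    case False
    then have "\<nexists>l. ((\<lambda>r. f (rcis r \<theta>')) \<longlongrightarrow> l) (at_right 0)" using 2 by blast
    with False show ?thesis unfolding radial_limit_def by simp
  qed
qed

lemma radial_limit_symm:
  assumes "odd_mfold m f"
  shows "radial_limit f (- \<theta>) = - radial_limit f \<theta>" "radial_limit f (\<theta> + 2 * pi / m) = radial_limit f \<theta>"
proof -
  have "f (rcis r (- \<theta>)) = - f (rcis r \<theta>)" "f (rcis r (\<theta> + 2 * pi / m)) = f (rcis r \<theta>)" if "0 < r" for r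
    using assms that by (auto simp: odd_mfold_def odd_fun_def periodic_with_def polar_def less_imp_le)
  then show "radial_limit f (- \<theta>) = - radial_limit f \<theta>" "radial_limit f (\<theta> + 2 * pi / m) = radial_limit f \<theta>"
    using radial_limit_cong_scale[of f "- \<theta>" "-1" \<theta>] radial_limit_cong_scale[of f "\<theta> + 2 * pi / m" 1 \<theta>] by auto
qed

text \<open>The radial derivative is bounded by \<open>N \<theta>\<^sup>-\<^sup>1\<^sup>-\<^sup>\<alpha>\<close> uniformly in \<open>r\<close>, so along each ray inside the sector \<open>f\<close> is
Lipschitz and extends continuously to the origin.\<close>

lemma radial_limit_exists:
  assumes N: "C1_bound m \<alpha> N f" and d: "polar_diff m f" and \<alpha>: "0 \<le> \<alpha>" and \<theta>: "0 < \<theta>" "\<theta> < pi / m"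
  shows "((\<lambda>r. f (rcis r \<theta>)) \<longlongrightarrow> radial_limit f \<theta>) (at_right 0)"
    and "0 < r \<Longrightarrow> \<bar>f (rcis r \<theta>) - radial_limit f \<theta>\<bar> \<le> N * \<theta> powr - (1 + \<alpha>) * r"
    and "\<bar>radial_limit f \<theta>\<bar> \<le> N * \<theta> powr - \<alpha>"
proof -
  define B where "B = N * \<theta> powr - (1 + \<alpha>)"
  have B0: "0 \<le> B" using C1_bound_D(2)[OF N \<alpha> zero_less_one \<theta>] unfolding B_def by linarith
  have lip: "\<bar>f (rcis x \<theta>) - f (rcis y \<theta>)\<bar> \<le> B * \<bar>x - y\<bar>" if "0 < x" "0 < y" for x y
  proof -
    have "norm (f (rcis x \<theta>) - f (rcis y \<theta>)) \<le> B * norm (x - y)"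
    proof (rule field_differentiable_bound[where f = "\<lambda>r. f (rcis r \<theta>)" and x = x and y = y and B = B and S = "{0<..}" and f' = "\<lambda>r. dderiv (1, 0) (polar f) (r, \<theta>)"])
      show "((\<lambda>r. f (rcis r \<theta>)) has_field_derivative dderiv (1, 0) (polar f) (z, \<theta>)) (at z within {0<..})" if "z \<in> {0<..}" for z
        by (rule has_field_derivative_at_within[OF polar_line_derivs(1)[OF d _ \<theta>]]) (use that in auto)
    qed (use that C1_bound_D(2)[OF N \<alpha> _ \<theta>] in \<open>auto simp: B_def\<close>)
    then show ?thesis by simp
  qed
  then have L: "B-lipschitz_on {0<..} (\<lambda>r. f (rcis r \<theta>))" using B0 by (auto simp: lipschitz_on_def dist_real_def)
  obtain h where h: "B-lipschitz_on (closure {0<..}) h" and "\<forall>r\<in>{0<..}. h r = f (rcis r \<theta>)"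
    using lipschitz_extend_closure[OF L] by blast
  then have h2: "h r = f (rcis r \<theta>)" if "0 < r" for r using that by simp
  have "continuous_on {0..} h" using lipschitz_on_continuous_on[OF h] by simp
  then have "(h \<longlongrightarrow> h 0) (at 0 within {0..})" by (simp add: continuous_on_def)
  then have "(h \<longlongrightarrow> h 0) (at_right 0)" by (rule tendsto_within_subset) auto
  moreover have e: "\<forall>\<^sub>F r in at_right 0. h r = f (rcis r \<theta>)"
    using h2 by (auto simp: eventually_at_right_field intro: exI[of _ 1])
  ultimately have "((\<lambda>r. f (rcis r \<theta>)) \<longlongrightarrow> h 0) (at_right 0)" by (simp only: tendsto_cong[OF e])
  then show lim: "((\<lambda>r. f (rcis r \<theta>)) \<longlongrightarrow> radial_limit f \<theta>) (at_right 0)" using radial_limit_eq by metis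
  have pos: "\<forall>\<^sub>F r in at_right 0. 0 < (r::real)" by (simp add: eventually_at_filter)
  show "\<bar>f (rcis r \<theta>) - radial_limit f \<theta>\<bar> \<le> N * \<theta> powr - (1 + \<alpha>) * r" if r: "0 < r"
  proof (rule tendsto_le[OF trivial_limit_at_right_real])
    show "((\<lambda>y. \<bar>f (rcis r \<theta>) - f (rcis y \<theta>)\<bar>) \<longlongrightarrow> \<bar>f (rcis r \<theta>) - radial_limit f \<theta>\<bar>) (at_right 0)"
      by (intro tendsto_intros lim)
    have "((\<lambda>y. B * \<bar>r - y\<bar>) \<longlongrightarrow> B * \<bar>r - 0\<bar>) (at_right 0)" by (intro tendsto_intros)
    then show "((\<lambda>y. B * \<bar>r - y\<bar>) \<longlongrightarrow> N * \<theta> powr - (1 + \<alpha>) * r) (at_right 0)" using r by (simp add: B_def)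
    show "\<forall>\<^sub>F y in at_right 0. \<bar>f (rcis r \<theta>) - f (rcis y \<theta>)\<bar> \<le> B * \<bar>r - y\<bar>"
      using pos by eventually_elim (use lip r in auto)
  qed
  show "\<bar>radial_limit f \<theta>\<bar> \<le> N * \<theta> powr - \<alpha>"
  proof (rule tendsto_upperbound)
    show "((\<lambda>r. \<bar>f (rcis r \<theta>)\<bar>) \<longlongrightarrow> \<bar>radial_limit f \<theta>\<bar>) (at_right 0)" by (intro tendsto_intros lim)
    show "\<forall>\<^sub>F r in at_right 0. \<bar>f (rcis r \<theta>)\<bar> \<le> N * \<theta> powr - \<alpha>"
      using pos by eventually_elim (use C1_bound_D(1)[OF N \<alpha> _ \<theta>] in auto)
  qed simp
qed

text \<open>Local Lipschitz continuity, inherited from the bound on the angular derivative.\<close>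

lemma radial_limit_continuous:
  assumes N: "C1_bound m \<alpha> N f" and d: "polar_diff m f" and \<alpha>: "0 \<le> \<alpha>"
  shows "continuous_on {0<..<pi / m} (radial_limit f)"
proof -
  have lip: "\<bar>radial_limit f x - radial_limit f y\<bar> \<le> N * a powr - (1 + \<alpha>) * \<bar>x - y\<bar>"
    if a: "0 < a" and x: "x \<in> {a<..<pi / m}" and y: "y \<in> {a<..<pi / m}" for a x y
  proof (rule tendsto_upperbound)
    show "((\<lambda>r. \<bar>f (rcis r x) - f (rcis r y)\<bar>) \<longlongrightarrow> \<bar>radial_limit f x - radial_limit f y\<bar>) (at_right 0)"
      using radial_limit_exists(1)[OF N d \<alpha>] a x y by (intro tendsto_intros) auto
    have "\<forall>\<^sub>F r in at_right 0. 0 < (r::real)" by (simp add: eventually_at_filter)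
    then show "\<forall>\<^sub>F r in at_right 0. \<bar>f (rcis r x) - f (rcis r y)\<bar> \<le> N * a powr - (1 + \<alpha>) * \<bar>x - y\<bar>"
    proof eventually_elim
      fix r :: real assume r: "0 < r"
      have "norm (f (rcis r x) - f (rcis r y)) \<le> N * a powr - (1 + \<alpha>) * norm (x - y)"
      proof (rule field_differentiable_bound[where f = "\<lambda>\<theta>. f (rcis r \<theta>)" and x = x and y = y and B = "N * a powr - (1 + \<alpha>)" and S = "{a<..<pi / m}" and f' = "\<lambda>\<theta>. dderiv (0, 1) (polar f) (r, \<theta>)"])
        fix z assume z: "z \<in> {a<..<pi / m}"
        then have z': "0 < z" "z < pi / m" using a by auto
        show "((\<lambda>\<theta>. f (rcis r \<theta>)) has_field_derivative dderiv (0, 1) (polar f) (r, z)) (at z within {a<..<pi / m})"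
          by (rule has_field_derivative_at_within[OF polar_line_derivs(2)[OF d r z']])
        have "0 \<le> N * z powr - (1 + \<alpha>)" using C1_bound_D(3)[OF N \<alpha> r z'] by linarith
        then have "0 \<le> N" using z' by (simp add: zero_le_mult_iff)
        then have "N * z powr - (1 + \<alpha>) \<le> N * a powr - (1 + \<alpha>)"
          using z a \<alpha> by (intro mult_left_mono powr_mono2') auto
        then show "norm (dderiv (0, 1) (polar f) (r, z)) \<le> N * a powr - (1 + \<alpha>)"
          using C1_bound_D(3)[OF N \<alpha> r z'] by simp
      qed (use x y in auto)
      then show "\<bar>f (rcis r x) - f (rcis r y)\<bar> \<le> N * a powr - (1 + \<alpha>) * \<bar>x - y\<bar>" by simp
    qed
  qed simp
  have "isCont (radial_limit f) x" if x: "x \<in> {0<..<pi / m}" for x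
  proof -
    let ?S = "{x / 2<..<pi / m}"
    have xS: "x \<in> ?S" using x by auto
    have "((\<lambda>y. N * (x / 2) powr - (1 + \<alpha>) * \<bar>y - x\<bar>) \<longlongrightarrow> N * (x / 2) powr - (1 + \<alpha>) * \<bar>x - x\<bar>) (at x)"
      by (intro tendsto_intros)
    then have "((\<lambda>y. N * (x / 2) powr - (1 + \<alpha>) * \<bar>y - x\<bar>) \<longlongrightarrow> 0) (at x)" by simp
    moreover have "\<forall>\<^sub>F y in at x. norm (radial_limit f y - radial_limit f x) \<le> N * (x / 2) powr - (1 + \<alpha>) * \<bar>y - x\<bar>"
    proof (rule eventually_mono)
      show "\<forall>\<^sub>F y in at x. y \<in> ?S" using eventually_at_in_open'[of ?S x] xS by simp
      show "norm (radial_limit f y - radial_limit f x) \<le> N * (x / 2) powr - (1 + \<alpha>) * \<bar>y - x\<bar>" if "y \<in> ?S" for y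
        unfolding real_norm_def by (rule lip[OF _ that xS]) (use x in simp)
    qed
    ultimately have "((\<lambda>y. radial_limit f y - radial_limit f x) \<longlongrightarrow> 0) (at x)"
      by (rule Lim_null_comparison[rotated])
    then show ?thesis unfolding isCont_def by (rule LIM_zero_cancel)
  qed
  then show ?thesis by (simp add: continuous_at_imp_continuous_on)
qed

lemma radial_limit_on_rays:
  assumes "odd_mfold m f" "\<theta> = 0 \<or> \<theta> = pi / m" "m > 0"
  shows "radial_limit f \<theta> = 0"
proof -
  note symm = radial_limit_symm[OF assms(1)]
  have "- (pi / m) + 2 * pi / m = pi / m" by simp
  then have "radial_limit f (pi / m) = - radial_limit f (pi / m)"
    using symm(2)[of "- (pi / m)"] symm(1)[of "pi / m"] by simp
  then show ?thesis using symm(1)[of 0] assms(2) by auto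
qed

lemma radial_limit_admissible:
  assumes N: "C1_bound m \<alpha> N f" and d: "polar_diff m f" and odd: "odd_mfold m f" and \<alpha>: "0 \<le> \<alpha>" and m: "m > 0"
  shows "admissible (pi / m) \<alpha> N (radial_limit f)"
  unfolding admissible_def
proof (intro conjI ballI radial_limit_continuous[OF N d \<alpha>])
  have b: "0 < pi / m" using m by simp
  have "\<bar>radial_limit f (pi / m / 2)\<bar> \<le> N * (pi / m / 2) powr - \<alpha>"
    by (rule radial_limit_exists(3)[OF N d \<alpha>]) (use b in auto)
  then have "0 \<le> N * (pi / m / 2) powr - \<alpha>" by linarith
  then have N0: "0 \<le> N" using b m by (simp add: zero_le_mult_iff)
  fix \<theta> assume "\<theta> \<in> {0..pi / m}"
  then consider "\<theta> = 0 \<or> \<theta> = pi / m" | "0 < \<theta>" "\<theta> < pi / m" by force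
  then show "\<bar>radial_limit f \<theta>\<bar> \<le> N * \<theta> powr - \<alpha>"
    by cases (use N0 radial_limit_on_rays[OF odd _ m] radial_limit_exists(3)[OF N d \<alpha>] in auto)
qed

text \<open>Interpolation between the Lipschitz bound \<open>r \<theta>\<^sup>-\<^sup>1\<^sup>-\<^sup>\<alpha>\<close> and the trivial bound \<open>2 N \<theta>\<^sup>-\<^sup>\<alpha>\<close>. A small power
\<open>\<kappa>\<close> of \<open>r\<close> is gained while the singularity \<open>\<theta>\<^sup>-\<^sup>\<alpha>\<^sup>-\<^sup>\<kappa>\<close> at the ray stays weaker than \<open>\<theta>\<^sup>-\<^sup>1\<close>.\<close>

lemma radial_limit_rate:
  assumes N: "C1_bound m \<alpha> N f" and d: "polar_diff m f" and \<alpha>: "0 \<le> \<alpha>" and \<theta>: "0 < \<theta>" "\<theta> < pi / m"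
    and r: "0 < r" and \<kappa>: "0 \<le> \<kappa>" "\<kappa> \<le> 1"
  shows "\<bar>f (rcis r \<theta>) - radial_limit f \<theta>\<bar> \<le> 2 * N * (r powr \<kappa> * \<theta> powr - (\<alpha> + \<kappa>))"
proof -
  have "0 \<le> N * \<theta> powr - \<alpha>" using C1_bound_D(1)[OF N \<alpha> r \<theta>] by linarith
  then have N0: "0 \<le> N" using \<theta> by (simp add: zero_le_mult_iff)
  have eq: "r powr \<kappa> * \<theta> powr - (\<alpha> + \<kappa>) = (r / \<theta>) powr \<kappa> * \<theta> powr - \<alpha>"
  proof -
    have "\<theta> powr - (\<alpha> + \<kappa>) = \<theta> powr - \<alpha> * \<theta> powr - \<kappa>" by (simp flip: powr_add)
    then show ?thesis using r \<theta> by (simp add: powr_divide powr_minus_divide)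
  qed
  have sgl: "\<theta> powr - (1 + \<alpha>) * r = r / \<theta> * \<theta> powr - \<alpha>"
  proof -
    have "\<theta> powr - (1 + \<alpha>) = \<theta> powr (- 1 + - \<alpha>)" by simp
    also have "\<dots> = \<theta> powr - \<alpha> / \<theta>" unfolding powr_add using \<theta> by (simp add: powr_minus_divide)
    finally show ?thesis by simp
  qed
  show ?thesis
  proof (cases "r \<le> \<theta>")
    case True
    have "\<bar>f (rcis r \<theta>) - radial_limit f \<theta>\<bar> \<le> N * (r / \<theta> * \<theta> powr - \<alpha>)"
      using radial_limit_exists(2)[OF N d \<alpha> \<theta> r] sgl by (simp only: mult.assoc)
    also have "\<dots> \<le> N * ((r / \<theta>) powr \<kappa> * \<theta> powr - \<alpha>)"
    proof (intro mult_left_mono mult_right_mono N0)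
      have "(r / \<theta>) powr 1 \<le> (r / \<theta>) powr \<kappa>" using True r \<theta> \<kappa> by (intro powr_mono') auto
      then show "r / \<theta> \<le> (r / \<theta>) powr \<kappa>" using r \<theta> by simp
    qed auto
    also have "\<dots> \<le> 2 * N * ((r / \<theta>) powr \<kappa> * \<theta> powr - \<alpha>)" using N0 by (intro mult_right_mono) auto
    finally show ?thesis unfolding eq .
  next
    case False
    have "\<bar>f (rcis r \<theta>) - radial_limit f \<theta>\<bar> \<le> 2 * N * (1 * \<theta> powr - \<alpha>)"
      using C1_bound_D(1)[OF N \<alpha> r \<theta>] radial_limit_exists(3)[OF N d \<alpha> \<theta>] by linarith
    also have "\<dots> \<le> 2 * N * ((r / \<theta>) powr \<kappa> * \<theta> powr - \<alpha>)"
      using False N0 \<theta> \<kappa> by (intro mult_left_mono mult_right_mono ge_one_powr_ge_zero) auto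
    finally show ?thesis unfolding eq .
  qed
qed

lemma radial_limit_diff:
  assumes N: "C1_bound m \<alpha> N f" and d: "polar_diff m f" and M: "C1_bound m \<alpha> M h" and d': "polar_diff m h"
    and \<alpha>: "0 \<le> \<alpha>" and E: "C1_bound m \<alpha> \<epsilon> (\<lambda>z. f z - h z)" and \<theta>: "0 < \<theta>" "\<theta> < pi / m"
  shows "\<bar>radial_limit f \<theta> - radial_limit h \<theta>\<bar> \<le> \<epsilon> * \<theta> powr - \<alpha>"
proof (rule tendsto_upperbound)
  show "((\<lambda>r. \<bar>f (rcis r \<theta>) - h (rcis r \<theta>)\<bar>) \<longlongrightarrow> \<bar>radial_limit f \<theta> - radial_limit h \<theta>\<bar>) (at_right 0)"
    by (intro tendsto_intros radial_limit_exists(1)[OF N d \<alpha> \<theta>] radial_limit_exists(1)[OF M d' \<alpha> \<theta>])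
  have "\<forall>\<^sub>F r in at_right 0. 0 < (r::real)" by (simp add: eventually_at_filter)
  then show "\<forall>\<^sub>F r in at_right 0. \<bar>f (rcis r \<theta>) - h (rcis r \<theta>)\<bar> \<le> \<epsilon> * \<theta> powr - \<alpha>"
    by eventually_elim (use C1_bound_D(1)[OF E \<alpha> _ \<theta>] in auto)
qed simp

section \<open>The stream function near the origin\<close>

lemma exp_eq_rcis: "exp w = rcis (exp (Re w)) (Im w)"
  by (simp add: rcis_def exp_eq_polar)

lemma rcis_eq_exp: "0 < r \<Longrightarrow> rcis r \<theta> = exp (Complex (ln r) \<theta>)"
  by (simp add: exp_eq_rcis)

text \<open>Inside the sector \<open>f\<close> is \<open>polar f\<close> composed with the smooth chart \<open>z \<mapsto> (|z|, arg z)\<close>, so differentiability in polar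
coordinates gives differentiability in Cartesian ones.\<close>

lemma cartesian_from_polar:
  assumes d: "polar_diff m f" and z: "0 < r" "0 < \<theta>" "\<theta> < pi / m" and m: "m > 0"
  shows "f differentiable (at (rcis r \<theta>))"
    and "dderiv (0, 1) (polar f) (r, \<theta>) = r * (cos \<theta> * dderiv \<i> f (rcis r \<theta>) - sin \<theta> * dderiv 1 f (rcis r \<theta>))"
    and "dderiv (1, 0) (polar f) (r, \<theta>) = cos \<theta> * dderiv 1 f (rcis r \<theta>) + sin \<theta> * dderiv \<i> f (rcis r \<theta>)"
proof -
  have bpi: "pi / m \<le> pi" using m by (simp add: field_simps)
  let ?z = "rcis r \<theta>" and ?h = "\<lambda>z. (exp (Re (Ln z)), Im (Ln z))"
  have zS: "?z \<in> sector (pi / m)" unfolding rcis_eq_exp[OF z(1)] sector_def by (rule imageI) (use z in simp)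
  have zn: "?z \<notin> \<real>\<^sub>\<le>\<^sub>0" by (rule sector_not_nonpos[OF zS bpi])
  have hz: "?h ?z = (r, \<theta>)"
  proof -
    have "Ln ?z = Complex (ln r) \<theta>" unfolding rcis_eq_exp[OF z(1)] by (rule Ln_exp_strip) (use z bpi in auto)
    then show ?thesis using z by simp
  qed
  have "Ln differentiable (at ?z)"
    using has_field_derivative_Ln[OF zn] unfolding has_field_derivative_def differentiable_def by blast
  then obtain L where L: "(Ln has_derivative L) (at ?z)" by (auto simp: differentiable_def)
  have R: "((\<lambda>z. Re (Ln z)) has_derivative (\<lambda>v. Re (L v))) (at ?z)"
    by (rule bounded_linear.has_derivative[OF bounded_linear_Re L])
  have I: "((\<lambda>z. Im (Ln z)) has_derivative (\<lambda>v. Im (L v))) (at ?z)"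
    by (rule bounded_linear.has_derivative[OF bounded_linear_Im L])
  have "(?h has_derivative (\<lambda>v. (Re (L v) * exp (Re (Ln ?z)), Im (L v)))) (at ?z)"
    by (rule has_derivative_Pair[OF DERIV_compose_FDERIV[OF DERIV_exp R] I])
  then have hd: "?h differentiable (at ?z)" unfolding differentiable_def by blast
  have "polar f differentiable (at (?h ?z))" using d z unfolding hz polar_diff_def polar_sector_def by auto
  then have "(polar f \<circ> ?h) differentiable (at ?z)" by (rule differentiable_chain_at[OF hd])
  then obtain D where D: "((polar f \<circ> ?h) has_derivative D) (at ?z)" by (auto simp: differentiable_def)
  have fD: "(f has_derivative D) (at ?z)"
  proof (rule has_derivative_transform_within_open[OF D open_sector[OF bpi] zS])
    fix x assume "x \<in> sector (pi / m)"
    then have "exp (Ln x) = x" using sector_Ln(4)[OF _ bpi] by blast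
    then show "(polar f \<circ> ?h) x = f x" by (simp add: polar_def flip: exp_eq_rcis)
  qed
  then show fd: "f differentiable (at ?z)" unfolding differentiable_def by blast
  have Dl: "D v = Re v * dderiv 1 f ?z + Im v * dderiv \<i> f ?z" for v
  proof -
    have "v = Re v *\<^sub>R 1 + Im v *\<^sub>R \<i>" by (simp add: complex_eq_iff)
    then have "D v = D (Re v *\<^sub>R 1 + Im v *\<^sub>R \<i>)" by simp
    also have "\<dots> = Re v * D 1 + Im v * D \<i>"
      using has_derivative_linear[OF fD] by (simp add: linear_add linear_scale)
    finally show ?thesis using dderiv_eqI[OF fD] by simp
  qed
  have "((\<lambda>\<theta>. rcis r \<theta>) has_vector_derivative (of_real r * (\<i> * cis \<theta>))) (at \<theta>)"
    unfolding rcis_def by (auto intro!: derivative_eq_intros simp: has_vector_derivative_def scaleR_conv_of_real mult_ac)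
  then have vd: "((\<lambda>\<theta>. rcis r \<theta>) has_derivative (\<lambda>t. t *\<^sub>R (of_real r * (\<i> * cis \<theta>)))) (at \<theta>)"
    by (simp only: has_vector_derivative_def)
  have "((\<lambda>\<theta>. f (rcis r \<theta>)) has_derivative (\<lambda>t. D (t *\<^sub>R (of_real r * (\<i> * cis \<theta>))))) (at \<theta>)"
    by (rule has_derivative_compose[where f = "\<lambda>\<theta>. rcis r \<theta>" and g = f, OF vd fD])
  moreover have "(\<lambda>t. D (t *\<^sub>R (of_real r * (\<i> * cis \<theta>)))) = (\<lambda>t. r * (cos \<theta> * dderiv \<i> f ?z - sin \<theta> * dderiv 1 f ?z) * t)"
    unfolding Dl by (auto simp: algebra_simps)
  ultimately have "((\<lambda>\<theta>. f (rcis r \<theta>)) has_real_derivative r * (cos \<theta> * dderiv \<i> f ?z - sin \<theta> * dderiv 1 f ?z)) (at \<theta>)"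
    unfolding has_field_derivative_def by simp
  then show "dderiv (0, 1) (polar f) (r, \<theta>) = r * (cos \<theta> * dderiv \<i> f ?z - sin \<theta> * dderiv 1 f ?z)"
    using polar_line_derivs(2)[OF d z] DERIV_unique by blast
  have "((\<lambda>r. rcis r \<theta>) has_vector_derivative cis \<theta>) (at r)"
    unfolding rcis_def by (auto intro!: derivative_eq_intros simp: has_vector_derivative_def scaleR_conv_of_real)
  then have vd: "((\<lambda>r. rcis r \<theta>) has_derivative (\<lambda>t. t *\<^sub>R cis \<theta>)) (at r)"
    by (simp only: has_vector_derivative_def)
  have "((\<lambda>r. f (rcis r \<theta>)) has_derivative (\<lambda>t. D (t *\<^sub>R cis \<theta>))) (at r)"
    by (rule has_derivative_compose[where f = "\<lambda>r. rcis r \<theta>" and g = f, OF vd fD])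
  moreover have "(\<lambda>t. D (t *\<^sub>R cis \<theta>)) = (\<lambda>t. (cos \<theta> * dderiv 1 f ?z + sin \<theta> * dderiv \<i> f ?z) * t)"
    unfolding Dl by (auto simp: algebra_simps)
  ultimately have "((\<lambda>r. f (rcis r \<theta>)) has_real_derivative cos \<theta> * dderiv 1 f ?z + sin \<theta> * dderiv \<i> f ?z) (at r)"
    unfolding has_field_derivative_def by simp
  then show "dderiv (1, 0) (polar f) (r, \<theta>) = cos \<theta> * dderiv 1 f ?z + sin \<theta> * dderiv \<i> f ?z"
    using polar_line_derivs(1)[OF d z] DERIV_unique by blast
qed

text \<open>A square around \<open>exp w0\<close> whose side is a small multiple of the modulus has logarithms near \<open>w0\<close>.
This makes the interior gradient estimate scale invariant.\<close>

lemma near_exp: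
  assumes \<delta>: "0 < \<delta>" "\<delta> \<le> 1 / 8" and z: "z \<in> cbox (exp w0 - (\<delta> * exp (Re w0)) *\<^sub>R One) (exp w0 + (\<delta> * exp (Re w0)) *\<^sub>R One)"
  shows "\<exists>w. z = exp w \<and> norm (w - w0) \<le> 4 * \<delta>"
proof -
  let ?z0 = "exp w0" and ?\<rho> = "\<delta> * exp (Re w0)"
  have "\<bar>Re (z - ?z0)\<bar> \<le> ?\<rho>" "\<bar>Im (z - ?z0)\<bar> \<le> ?\<rho>"
    using z by (auto simp: in_cbox_complex_iff Basis_complex_def abs_le_iff)
  then have "norm (z - ?z0) \<le> 2 * ?\<rho>" using cmod_le[of "z - ?z0"] by linarith
  define \<zeta> where "\<zeta> = (z - ?z0) / ?z0"
  have "norm \<zeta> \<le> 2 * \<delta>"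
    using \<open>norm (z - ?z0) \<le> 2 * ?\<rho>\<close> by (simp add: \<zeta>_def norm_divide norm_exp_eq_Re field_simps)
  then have "norm (Ln (1 + \<zeta>)) \<le> 2 * norm \<zeta>" using \<delta> by (intro norm_Ln_le) linarith
  moreover have "1 + \<zeta> \<noteq> 0"
  proof
    assume "1 + \<zeta> = 0"
    then have "\<zeta> = -1" by (simp add: add_eq_0_iff)
    then show False using \<open>norm \<zeta> \<le> 2 * \<delta>\<close> \<delta> by simp
  qed
  then have "exp (w0 + Ln (1 + \<zeta>)) = z" by (simp add: exp_add \<zeta>_def field_simps)
  ultimately show ?thesis using \<open>norm \<zeta> \<le> 2 * \<delta>\<close> by (intro exI[of _ "w0 + Ln (1 + \<zeta>)"]) auto
qed

lemma odd_mfold_vanishes_on_rays: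
  assumes "odd_mfold m f" "0 \<le> r" "\<theta> = 0 \<or> \<theta> = pi / m" "m > 0"
  shows "f (rcis r \<theta>) = 0"
proof -
  have odd: "f (rcis r (- \<theta>)) = - f (rcis r \<theta>)" and per: "f (rcis r (\<theta> + 2 * pi / m)) = f (rcis r \<theta>)" for \<theta>
    using assms(1,2) by (auto simp: odd_mfold_def odd_fun_def periodic_with_def polar_def)
  have "- (pi / m) + 2 * pi / m = pi / m" by (simp add: field_simps)
  then have "f (rcis r (pi / m)) = - f (rcis r (pi / m))" using per[of "- (pi / m)"] odd[of "pi / m"] by simp
  moreover have "f (rcis r 0) = - f (rcis r 0)" using odd[of 0] by simp
  ultimately show ?thesis using assms(3) by auto
qed

text \<open>The difference \<open>D = \<psi> - r\<^sup>2 G\<close> satisfies the hypotheses of the sector bound: it vanishes on the rays by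
symmetry, is \<open>O(r\<^sup>2)\<close> by the growth condition on \<open>\<psi>\<close>, and its Laplacian \<open>f - g\<close> is controlled by the rate of
convergence to the radial limit. The growth constant of \<open>\<psi>\<close> does not enter \<open>K\<close>, so the estimate is
uniform in time although nothing is assumed about how \<open>\<psi>\<close> depends on time. The gradient estimate is
applied on a square of side proportional to \<open>r\<close>.\<close>

lemma stream_asymptotics:
  fixes m :: nat and \<alpha> a :: real
  defines "b \<equiv> pi / m" and "\<kappa> \<equiv> (1 - \<alpha>) / 4"
  assumes m: "m \<ge> 3" and \<alpha>: "0 \<le> \<alpha>" "\<alpha> < 1" and a: "0 < a"
  obtains K where "K > 0" "\<And>N f \<psi> r \<theta> j. N > 0 \<Longrightarrow> C1_bound m \<alpha> N f \<Longrightarrow> polar_diff m f \<Longrightarrow> odd_mfold m f \<Longrightarrow>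
      stream_function m f \<psi> \<Longrightarrow> 0 < r \<Longrightarrow> a \<le> \<theta> \<Longrightarrow> \<theta> \<le> b - a \<Longrightarrow> j \<in> Basis \<Longrightarrow>
      \<bar>dderiv j \<psi> (rcis r \<theta>) - angular_pder 2 (ang_stream b (radial_limit f)) (ang_slope b (radial_limit f)) j (rcis r \<theta>)\<bar>
        \<le> K * N * r powr (1 + \<kappa>)"
proof -
  have b: "0 < b" "b \<le> pi / 3" "b \<le> pi" "b < pi"
    using m pi_gt_zero by (auto simp: b_def field_simps intro!: divide_left_mono)
  have m0: "m > 0" using m by simp
  define \<beta> where "\<beta> = \<alpha> + \<kappa>"
  have \<kappa>: "0 < \<kappa>" "\<kappa> \<le> 1 / 2" "\<kappa> \<le> 1" and \<beta>: "0 < \<beta>" "\<beta> < 1" using \<alpha> by (auto simp: \<kappa>_def \<beta>_def field_simps)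
  obtain A where A: "A > 0" and bound: "\<And>f F N C w.
     continuous_on (exp ` {w. 0 \<le> Im w \<and> Im w \<le> b}) f \<Longrightarrow>
     (\<And>w. Im w = 0 \<or> Im w = b \<Longrightarrow> f (exp w) = 0) \<Longrightarrow>
     (\<And>w. 0 \<le> Im w \<Longrightarrow> Im w \<le> b \<Longrightarrow> \<bar>f (exp w)\<bar> \<le> C * exp (2 * Re w)) \<Longrightarrow>
     weak_lap (sector b) f F \<Longrightarrow> 0 \<le> N \<Longrightarrow>
     (\<And>w. 0 < Im w \<Longrightarrow> Im w < b \<Longrightarrow> \<bar>F (exp w)\<bar> \<le> N * (exp (\<kappa> * Re w) * Im w powr - \<beta>)) \<Longrightarrow>
     0 \<le> Im w \<Longrightarrow> Im w \<le> b \<Longrightarrow> \<bar>f (exp w)\<bar> \<le> N * A * exp ((2 + \<kappa>) * Re w)"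
    by (rule sector_bound[OF b(1,2) \<beta> less_imp_le[OF \<kappa>(1)] \<kappa>(2)]) blast
  \<comment> \<open>By \<open>near_exp\<close> a square of relative size \<open>\<delta>\<close> moves the angle by at most \<open>a/2\<close>, hence stays inside the sector.\<close>
  define \<delta> where "\<delta> = min (a / 8) (1 / 8)"
  have \<delta>: "0 < \<delta>" "\<delta> \<le> 1 / 8" "4 * \<delta> \<le> a / 2" using a by (auto simp: \<delta>_def)
  define K where "K = 4 * A * exp (2 + \<kappa>) / \<delta> + 2 * exp \<kappa> * (a / 2) powr - \<beta> * \<delta>"
  have K: "K > 0" unfolding K_def using A \<delta> by (intro add_pos_nonneg) auto
  show thesis
  proof (rule that[OF K])
    fix N r \<theta> :: real and f \<psi> :: "complex \<Rightarrow> real" and j :: complex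
    assume N: "N > 0" and fN: "C1_bound m \<alpha> N f" and fd: "polar_diff m f" and fo: "odd_mfold m f"
      and str: "stream_function m f \<psi>" and r: "0 < r" and \<theta>: "a \<le> \<theta>" "\<theta> \<le> b - a" and j: "j \<in> Basis"
    define g where "g = radial_limit f"
    define G where "G = ang_stream b g"
    define G1 where "G1 = ang_slope b g"
    have adm: "admissible b \<alpha> N g" unfolding g_def b_def by (rule radial_limit_admissible[OF fN fd fo \<alpha>(1) m0])
    have godd: "g (- x) = - g x" and gper: "g (x + 2 * b) = g x" for x
      using radial_limit_symm[OF fo] by (auto simp: g_def b_def)
    note GS = ang_stream_symm[OF b(1,2) \<alpha>(2) adm, folded G_def]
    have GD: "(G has_real_derivative G1 x) (at x)" for x
      unfolding G_def G1_def by (rule ang_stream_deriv[OF b(1,2) \<alpha>(2) adm])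
    have Gc: "continuous_on S G" for S using GD by (meson DERIV_isCont continuous_at_imp_continuous_on)
    have G0: "G 0 = 0" "G b = 0"
      using ang_stream_eq_dirichlet[OF b(1,2) \<alpha>(2) adm, folded G_def] dirichlet_boundary[OF b(1,2) \<alpha>(2)] b by auto
    have G1D: "(G1 has_real_derivative g x - 4 * G x) (at x)" if x: "0 < x" "x < b" for x
      unfolding G_def G1_def
    proof (rule ang_slope_deriv[OF b(1,2) \<alpha>(2) adm godd gper])
      fix i :: int
      show "x \<noteq> i * b"
      proof
        assume "x = i * b"
        then have "0 < real_of_int i" "real_of_int i < 1" using x b by (auto simp: zero_less_mult_iff)
        then show False by simp
      qed
    qed
    have psi: "odd_mfold m \<psi>" "\<And>z. z \<noteq> 0 \<Longrightarrow> \<psi> differentiable (at z)" "distr_laplacian_eq \<psi> f"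
      using str by (auto simp: stream_function_def)
    obtain C where C: "\<And>z. z \<noteq> 0 \<Longrightarrow> \<bar>\<psi> z\<bar> / (cmod z)\<^sup>2 \<le> C"
      using str by (auto simp: stream_function_def)
    have cpsi: "continuous_on S \<psi>" if "0 \<notin> S" for S
      using psi(2) that by (metis continuous_at_imp_continuous_on differentiable_imp_continuous_within)
    define D where "D z = \<psi> z - angular 2 G z" for z
    define F where "F z = f z - g (Im (Ln z))" for z
    have S_rcis: "\<exists>r \<theta>. z = rcis r \<theta> \<and> 0 < r \<and> 0 < \<theta> \<and> \<theta> < b" if "z \<in> sector b" for z
      using that unfolding sector_def exp_eq_rcis by fastforce
    have fdiff: "f differentiable (at z)" if "z \<in> sector b" for z
      using S_rcis[OF that] cartesian_from_polar(1)[OF fd _ _ _ m0] unfolding b_def by blast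
    have cf: "continuous_on (sector b) f"
      using fdiff by (metis continuous_at_imp_continuous_on differentiable_imp_continuous_within)
    have S0: "0 \<notin> sector b" using sector_Ln(3)[OF _ b(3)] by blast
    have wpsi: "weak_lap (sector b) \<psi> f" by (rule weak_lap_of_distr[OF psi(3) cpsi[OF S0] cf])
    have cg: "continuous_on {0<..<b} g" using adm by (simp add: admissible_def)
    have "weak_lap (sector b) (angular 2 G) (angular (2 - 2) (\<lambda>\<theta>. 2\<^sup>2 * G \<theta> + (g \<theta> - 4 * G \<theta>)))"
      by (rule weak_lap_angular[OF b(3) GD G1D]) (auto intro!: continuous_intros cg Gc)
    then have wG: "weak_lap (sector b) (angular 2 G) (\<lambda>z. g (Im (Ln z)))"
      by (rule weak_lap_cong) (auto simp: angular_def)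
    have wD: "weak_lap (sector b) D F" unfolding D_def F_def by (rule weak_lap_diff[OF wpsi wG])
    have Aexp: "angular 2 G (exp w) = exp (2 * Re w) * G (Im w)" if "0 \<le> Im w" "Im w \<le> b" for w
      using that b by (simp add: angular_exp)
    have Fb: "\<bar>F (exp w)\<bar> \<le> 2 * N * (exp (\<kappa> * Re w) * Im w powr - \<beta>)" if w: "0 < Im w" "Im w < b" for w
    proof -
      have "\<bar>f (rcis (exp (Re w)) (Im w)) - radial_limit f (Im w)\<bar> \<le> 2 * N * (exp (Re w) powr \<kappa> * Im w powr - (\<alpha> + \<kappa>))"
        by (rule radial_limit_rate[OF fN fd \<alpha>(1)]) (use w \<kappa> in \<open>auto simp: b_def\<close>)
      moreover have "exp (Re w) powr \<kappa> = exp (\<kappa> * Re w)" by (simp add: powr_def)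
      ultimately show ?thesis using w b by (simp add: F_def Ln_exp_strip \<beta>_def g_def flip: exp_eq_rcis)
    qed
    have Db: "\<bar>D (exp w)\<bar> \<le> 2 * N * A * exp ((2 + \<kappa>) * Re w)" if w: "0 \<le> Im w" "Im w \<le> b" for w
    proof (rule bound[OF _ _ _ wD _ Fb])
      let ?S = "exp ` {w. 0 \<le> Im w \<and> Im w \<le> b}"
      have "z \<notin> \<real>\<^sub>\<le>\<^sub>0" if "z \<in> ?S" for z
      proof
        assume "z \<in> \<real>\<^sub>\<le>\<^sub>0"
        from that obtain w where w: "z = exp w" "0 \<le> Im w" "Im w \<le> b" by auto
        have "sin (Im w) = 0" "cos (Im w) \<le> 0" using \<open>z \<in> \<real>\<^sub>\<le>\<^sub>0\<close> w(1)
          by (auto simp: complex_nonpos_Reals_iff Re_exp Im_exp mult_le_0_iff)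
        then show False using w b sin_gt_zero[of "Im w"] by (cases "Im w = 0") auto
      qed
      then have "continuous_on ?S (angular 2 G)" unfolding angular_def
        by (intro continuous_intros continuous_on_compose2[OF Gc[of UNIV]]) auto
      then show "continuous_on ?S D" unfolding D_def by (intro continuous_intros cpsi) auto
      show "D (exp w) = 0" if "Im w = 0 \<or> Im w = b" for w
      proof -
        have "\<psi> (exp w) = 0" unfolding exp_eq_rcis
          by (rule odd_mfold_vanishes_on_rays[OF psi(1)]) (use that m0 in \<open>auto simp: b_def\<close>)
        then show ?thesis using that G0 b Aexp[of w] by (auto simp: D_def)
      qed
      show "\<bar>D (exp w)\<bar> \<le> (C + N * dirichlet_norm b \<alpha>) * exp (2 * Re w)" if w: "0 \<le> Im w" "Im w \<le> b" for w
      proof -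
        have "(cmod (exp w))\<^sup>2 = exp (2 * Re w)" by (simp add: norm_exp_eq_Re exp_double)
        then have 1: "\<bar>\<psi> (exp w)\<bar> \<le> C * exp (2 * Re w)" using C[of "exp w"] by (simp add: field_simps)
        have "\<bar>G (Im w)\<bar> \<le> N * dirichlet_norm b \<alpha>"
          using dirichlet_bound(1)[OF b(1,2) \<alpha>(2) adm w] ang_stream_eq_dirichlet[OF b(1,2) \<alpha>(2) adm w] by (simp add: G_def)
        then have "exp (2 * Re w) * \<bar>G (Im w)\<bar> \<le> exp (2 * Re w) * (N * dirichlet_norm b \<alpha>)" by (intro mult_left_mono) auto
        then have 2: "\<bar>angular 2 G (exp w)\<bar> \<le> N * dirichlet_norm b \<alpha> * exp (2 * Re w)"
          using Aexp[OF w] by (simp add: abs_mult mult_ac)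
        show ?thesis unfolding D_def distrib_right using 1 2 by linarith
      qed
    qed (use N w in auto)
    define w0 where "w0 = Complex (ln r) \<theta>"
    have z0: "rcis r \<theta> = exp w0" using r by (simp add: w0_def rcis_eq_exp)
    have er: "exp (Re w0) = r" using r by (simp add: w0_def)
    let ?Q = "cbox (exp w0 - (\<delta> * r) *\<^sub>R One) (exp w0 + (\<delta> * r) *\<^sub>R One)"
    have Q: "\<exists>w. z = exp w \<and> a / 2 \<le> Im w \<and> Im w < b \<and> Re w \<le> Re w0 + 1" if "z \<in> ?Q" for z
    proof -
      obtain w where w: "z = exp w" "norm (w - w0) \<le> 4 * \<delta>" using near_exp[OF \<delta>(1,2), of z w0] \<open>z \<in> ?Q\<close> er by auto
      have "\<bar>Im (w - w0)\<bar> \<le> 4 * \<delta>" "\<bar>Re (w - w0)\<bar> \<le> 4 * \<delta>"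
        using w(2) abs_Im_le_cmod[of "w - w0"] abs_Re_le_cmod[of "w - w0"] by linarith+
      then have "a / 2 \<le> Im w \<and> Im w < b \<and> Re w \<le> Re w0 + 1"
        using \<delta> \<theta> a unfolding w0_def by (simp add: abs_le_iff)
      then show ?thesis using w(1) by blast
    qed
    define M where "M = 2 * N * A * exp ((2 + \<kappa>) * (Re w0 + 1))"
    define NF where "NF = 2 * N * (exp (\<kappa> * (Re w0 + 1)) * (a / 2) powr - \<beta>)"
    have "\<bar>dderiv j \<psi> (exp w0) - angular_pder 2 G G1 j (exp w0)\<bar> \<le> 2 * M / (\<delta> * r) + NF * (\<delta> * r)"
    proof (rule weak_lap_gradient_le[OF wD j])
      show "0 < \<delta> * r" using \<delta> r by simp
      show "NF > 0" unfolding NF_def using N a by simp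
      show "?Q \<subseteq> sector b"
      proof
        fix z assume "z \<in> ?Q"
        from Q[OF this] show "z \<in> sector b" unfolding sector_def using a by fastforce
      qed
      show "\<bar>D z\<bar> \<le> M" if "z \<in> ?Q" for z
      proof -
        obtain w where w: "z = exp w" "a / 2 \<le> Im w" "Im w < b" "Re w \<le> Re w0 + 1" using Q[OF \<open>z \<in> ?Q\<close>] by blast
        have "\<bar>D z\<bar> \<le> 2 * N * A * exp ((2 + \<kappa>) * Re w)" unfolding w(1) by (rule Db) (use w a in auto)
        also have "\<dots> \<le> M" unfolding M_def using N A w \<kappa> by (intro mult_left_mono) auto
        finally show ?thesis .
      qed
      show "\<bar>F z\<bar> \<le> NF" if "z \<in> ?Q" for z
      proof -
        obtain w where w: "z = exp w" "a / 2 \<le> Im w" "Im w < b" "Re w \<le> Re w0 + 1" using Q[OF \<open>z \<in> ?Q\<close>] by blast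
        have "\<bar>F z\<bar> \<le> 2 * N * (exp (\<kappa> * Re w) * Im w powr - \<beta>)" unfolding w(1) by (rule Fb) (use w a in auto)
        also have "\<dots> \<le> NF" unfolding NF_def using N w \<kappa> a \<beta> by (intro mult_left_mono mult_mono powr_mono2') auto
        finally show ?thesis .
      qed
      have zS: "exp w0 \<in> sector b" unfolding sector_def by (rule imageI) (use a \<theta> in \<open>auto simp: w0_def\<close>)
      have "(\<psi> has_derivative frechet_derivative \<psi> (at (exp w0))) (at (exp w0))"
        using psi(2) by (simp add: frechet_derivative_works[symmetric])
      from has_derivative_pder[OF this, of j] have 1: "has_pder j \<psi> (dderiv j \<psi> (exp w0)) (exp w0)" by (simp add: dderiv_def)
      have 2: "has_pder j (angular 2 G) (angular_pder 2 G G1 j (exp w0)) (exp w0)" by (rule angular_has_pder[where ?Q1.0 = G1, OF zS b(3) GD])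
      show "has_pder j D (dderiv j \<psi> (exp w0) - angular_pder 2 G G1 j (exp w0)) (exp w0)"
        using DERIV_diff[OF 1[unfolded has_pder_def] 2[unfolded has_pder_def]] by (simp add: has_pder_def D_def)
    qed
    also have "2 * M / (\<delta> * r) + NF * (\<delta> * r) = K * N * r powr (1 + \<kappa>)"
    proof -
      have M: "exp ((2 + \<kappa>) * (Re w0 + 1)) = exp (2 + \<kappa>) * (r powr (1 + \<kappa>) * r)"
      proof -
        have "(2 + \<kappa>) * (Re w0 + 1) = (2 + \<kappa>) + ((1 + \<kappa>) * ln r + ln r)" by (simp add: w0_def algebra_simps)
        then have "exp ((2 + \<kappa>) * (Re w0 + 1)) = exp (2 + \<kappa>) * (exp ((1 + \<kappa>) * ln r) * exp (ln r))"
          by (simp only: exp_add[symmetric])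
        then show ?thesis using r by (simp add: powr_def)
      qed
      have NF: "exp (\<kappa> * (Re w0 + 1)) * r = exp \<kappa> * r powr (1 + \<kappa>)"
      proof -
        have "\<kappa> * (Re w0 + 1) + ln r = \<kappa> + (1 + \<kappa>) * ln r" by (simp add: w0_def algebra_simps)
        then have "exp (\<kappa> * (Re w0 + 1)) * exp (ln r) = exp \<kappa> * exp ((1 + \<kappa>) * ln r)" by (simp only: exp_add[symmetric])
        then show ?thesis using r by (simp add: powr_def)
      qed
      have "NF * (\<delta> * r) = 2 * N * (a / 2) powr - \<beta> * \<delta> * (exp (\<kappa> * (Re w0 + 1)) * r)" by (simp add: NF_def)
      also have "\<dots> = 2 * exp \<kappa> * (a / 2) powr - \<beta> * \<delta> * N * r powr (1 + \<kappa>)" unfolding NF by simp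
      finally have 2: "NF * (\<delta> * r) = 2 * exp \<kappa> * (a / 2) powr - \<beta> * \<delta> * N * r powr (1 + \<kappa>)" .
      have 1: "2 * M / (\<delta> * r) = 4 * A * exp (2 + \<kappa>) / \<delta> * N * r powr (1 + \<kappa>)"
        unfolding M_def M using r \<delta>(1) by simp
      show ?thesis unfolding 1 2 K_def by (simp only: distrib_right)
    qed
    finally show "\<bar>dderiv j \<psi> (rcis r \<theta>) - angular_pder 2 (ang_stream b (radial_limit f)) (ang_slope b (radial_limit f)) j (rcis r \<theta>)\<bar>
        \<le> K * N * r powr (1 + \<kappa>)" unfolding z0 G_def G1_def g_def .
  qed
qed

text \<open>In polar coordinates \<open>\<nabla>\<^sup>\<bottom>\<psi> \<cdot> \<nabla>f = (\<partial>\<^sub>r \<psi> \<partial>\<^sub>\<theta> f - \<partial>\<^sub>\<theta> \<psi> \<partial>\<^sub>r f) / r\<close>. Replacing \<open>\<psi>\<close> by \<open>r\<^sup>2 G\<close> gives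
\<open>2 G \<partial>\<^sub>\<theta> f - r G' \<partial>\<^sub>r f\<close>, whose second term is \<open>O(r)\<close>. The error of the replacement is \<open>O(r\<^sup>1\<^sup>+\<^sup>\<kappa>)\<close> in the velocity,
against a gradient of \<open>f\<close> of size \<open>O(1/r)\<close>.\<close>

lemma transport_rate:
  fixes m :: nat and \<alpha> a :: real
  defines "b \<equiv> pi / m" and "\<kappa> \<equiv> (1 - \<alpha>) / 4"
  assumes m: "m \<ge> 3" and \<alpha>: "0 \<le> \<alpha>" "\<alpha> < 1" and a: "0 < a" and N: "N > 0"
  obtains K where "\<And>f \<psi> r \<theta>. C1_bound m \<alpha> N f \<Longrightarrow> polar_diff m f \<Longrightarrow> odd_mfold m f \<Longrightarrow>
      stream_function m f \<psi> \<Longrightarrow> 0 < r \<Longrightarrow> r \<le> 1 \<Longrightarrow> a \<le> \<theta> \<Longrightarrow> \<theta> \<le> b - a \<Longrightarrow>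
      \<bar>perp_grad \<psi> (rcis r \<theta>) \<bullet> grad f (rcis r \<theta>) - 2 * ang_stream b (radial_limit f) \<theta> * dderiv (0, 1) (polar f) (r, \<theta>)\<bar>
        \<le> K * r powr \<kappa>"
proof -
  have b: "0 < b" "b \<le> pi / 3"
    using m pi_gt_zero by (auto simp: b_def field_simps intro!: divide_left_mono)
  have m0: "m > 0" using m by simp
  have \<kappa>: "0 < \<kappa>" "\<kappa> \<le> 1" using \<alpha> by (auto simp: \<kappa>_def)
  obtain K where K: "K > 0" and asy: "\<And>N f \<psi> r \<theta> j. N > 0 \<Longrightarrow> C1_bound m \<alpha> N f \<Longrightarrow> polar_diff m f \<Longrightarrow> odd_mfold m f \<Longrightarrow>
      stream_function m f \<psi> \<Longrightarrow> 0 < r \<Longrightarrow> a \<le> \<theta> \<Longrightarrow> \<theta> \<le> b - a \<Longrightarrow> j \<in> Basis \<Longrightarrow>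
      \<bar>dderiv j \<psi> (rcis r \<theta>) - angular_pder 2 (ang_stream b (radial_limit f)) (ang_slope b (radial_limit f)) j (rcis r \<theta>)\<bar>
        \<le> K * N * r powr (1 + \<kappa>)"
    using stream_asymptotics[OF m \<alpha> a] unfolding b_def \<kappa>_def by metis
  define B where "B = N * a powr - (1 + \<alpha>)"
  show thesis
  proof (rule that)
    fix f \<psi> :: "complex \<Rightarrow> real" and r \<theta> :: real
    assume fN: "C1_bound m \<alpha> N f" and fd: "polar_diff m f" and fo: "odd_mfold m f"
      and str: "stream_function m f \<psi>" and r: "0 < r" "r \<le> 1" and \<theta>: "a \<le> \<theta>" "\<theta> \<le> b - a"
    let ?z = "rcis r \<theta>" and ?c = "cos \<theta>" and ?s = "sin \<theta>"
    define G where "G = ang_stream b (radial_limit f) \<theta>"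
    define G1 where "G1 = ang_slope b (radial_limit f) \<theta>"
    have \<theta>b: "0 < \<theta>" "\<theta> < pi / m" using a \<theta> by (auto simp: b_def)
    have adm: "admissible b \<alpha> N (radial_limit f)" unfolding b_def by (rule radial_limit_admissible[OF fN fd fo \<alpha>(1) m0])
    define fr where "fr = dderiv (1, 0) (polar f) (r, \<theta>)"
    define ft where "ft = dderiv (0, 1) (polar f) (r, \<theta>)"
    define f1 where "f1 = dderiv 1 f ?z"
    define fi where "fi = dderiv \<i> f ?z"
    have ft: "ft = r * (?c * fi - ?s * f1)" and fr: "fr = ?c * f1 + ?s * fi"
      unfolding ft_def fr_def f1_def fi_def by (rule cartesian_from_polar[OF fd r(1) \<theta>b m0])+
    have B: "\<bar>fr\<bar> \<le> B" "\<bar>ft\<bar> \<le> B"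
    proof -
      have "N * \<theta> powr - (1 + \<alpha>) \<le> B" unfolding B_def using N a \<alpha> \<theta> by (intro mult_left_mono powr_mono2') auto
      then show "\<bar>fr\<bar> \<le> B" "\<bar>ft\<bar> \<le> B"
        using C1_bound_D(2,3)[OF fN \<alpha>(1) r(1) \<theta>b] unfolding fr_def ft_def by linarith+
    qed
    have B0: "0 \<le> B" using B by linarith
    have cs: "?c * ?c + ?s * ?s = 1" using sin_cos_squared_add[of \<theta>] by (simp add: power2_eq_square)
    \<comment> \<open>Inverting the rotation expresses the Cartesian gradient through \<open>\<partial>\<^sub>r f\<close> and \<open>\<partial>\<^sub>\<theta> f\<close>, giving the bound \<open>2 B / r\<close>.\<close>
    have alg: "c * (r * (c * x + s * y)) - s * (r * (c * y - s * x)) = (c * c + s * s) * (r * x)"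
      "s * (r * (c * x + s * y)) + c * (r * (c * y - s * x)) = (c * c + s * s) * (r * y)" for c s x y :: real
      by (simp_all add: algebra_simps)
    have "?c * (r * fr) - ?s * ft = (?c * ?c + ?s * ?s) * (r * f1)" "?s * (r * fr) + ?c * ft = (?c * ?c + ?s * ?s) * (r * fi)"
      unfolding ft fr by (rule alg)+
    then have inv: "r * f1 = ?c * (r * fr) - ?s * ft" "r * fi = ?s * (r * fr) + ?c * ft" unfolding cs by simp_all
    have p: "\<bar>u * x\<bar> \<le> B" if "\<bar>u\<bar> \<le> 1" "\<bar>x\<bar> \<le> B" for u x
      using mult_mono[OF that] by (simp add: abs_mult)
    have rfr: "\<bar>r * fr\<bar> \<le> B" using p[of r fr] r B by simp
    have "\<bar>r * f1\<bar> \<le> 2 * B" "\<bar>r * fi\<bar> \<le> 2 * B"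
      unfolding inv using p[OF _ rfr, of ?c] p[OF _ rfr, of ?s] p[OF _ B(2), of ?c] p[OF _ B(2), of ?s] by (simp; linarith)+
    then have g1: "\<bar>f1\<bar> \<le> 2 * B / r" and gi: "\<bar>fi\<bar> \<le> 2 * B / r" using r by (simp_all add: abs_mult field_simps)
    have "\<theta> < pi" using \<theta>b(2) b(2) pi_gt_zero unfolding b_def by linarith
    have Ln: "Ln ?z = Complex (ln r) \<theta>"
      unfolding rcis_eq_exp[OF r(1)] by (rule Ln_exp_strip) (use \<theta>b \<open>\<theta> < pi\<close> in auto)
    have e2: "exp (2 * ln r) = r * r" using exp_double[of "ln r"] r(1) by (simp add: power2_eq_square)
    have iz: "1 / ?z = rcis (1 / r) (- \<theta>)" by (metis rcis_inverse inverse_eq_divide)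
    have iz': "\<i> / ?z = \<i> * rcis (1 / r) (- \<theta>)" using iz by (metis mult.right_neutral times_divide_eq_right)
    have E: "angular_pder 2 (ang_stream b (radial_limit f)) (ang_slope b (radial_limit f)) 1 ?z = r * (2 * G * ?c - G1 * ?s)"
      "angular_pder 2 (ang_stream b (radial_limit f)) (ang_slope b (radial_limit f)) \<i> ?z = r * (2 * G * ?s + G1 * ?c)"
      unfolding angular_pder_def iz iz' Ln complex.sel e2 G_def G1_def using r(1) by (simp_all add: field_simps)
    define d1 where "d1 = dderiv 1 \<psi> ?z - r * (2 * G * ?c - G1 * ?s)"
    define di where "di = dderiv \<i> \<psi> ?z - r * (2 * G * ?s + G1 * ?c)"
    have basis: "(1::complex) \<in> Basis" "\<i> \<in> Basis" by (simp_all add: Basis_complex_def)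
    have db: "\<bar>d1\<bar> \<le> K * N * r powr (1 + \<kappa>)" "\<bar>di\<bar> \<le> K * N * r powr (1 + \<kappa>)"
      unfolding d1_def di_def E[symmetric] by (rule asy[OF N fN fd fo str r(1) \<theta>], rule basis)+
    have "perp_grad \<psi> ?z \<bullet> grad f ?z = - dderiv \<i> \<psi> ?z * f1 + dderiv 1 \<psi> ?z * fi"
      by (simp add: perp_grad_def grad_def inner_complex_def f1_def fi_def)
    also have "\<dots> = - di * f1 + d1 * fi + 2 * G * ft - G1 * (r * fr)"
      unfolding d1_def di_def ft fr by (simp add: algebra_simps)
    finally have eq: "perp_grad \<psi> ?z \<bullet> grad f ?z - 2 * G * ft = - di * f1 + d1 * fi - G1 * (r * fr)" by simp
    have q: "\<bar>x * y\<bar> \<le> 2 * K * N * B * r powr \<kappa>" if "\<bar>x\<bar> \<le> K * N * r powr (1 + \<kappa>)" "\<bar>y\<bar> \<le> 2 * B / r" for x y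
    proof -
      have "\<bar>x * y\<bar> \<le> K * N * r powr (1 + \<kappa>) * (2 * B / r)" unfolding abs_mult using that K N by (intro mult_mono) auto
      also have "\<dots> = 2 * K * N * B * r powr \<kappa>" using r by (simp add: powr_add)
      finally show ?thesis .
    qed
    have "r powr 1 \<le> r powr \<kappa>" using r \<kappa> by (intro powr_mono') auto
    then have rk: "r \<le> r powr \<kappa>" using r by simp
    have "\<bar>G1\<bar> \<le> N * dirichlet_norm b \<alpha>" unfolding G1_def
      by (rule ang_slope_bound[OF b \<alpha>(2) adm])
    moreover have "\<bar>r * fr\<bar> \<le> r powr \<kappa> * B" using mult_mono[OF rk B(1)] r(1) by (simp add: abs_mult)
    ultimately have "\<bar>G1 * (r * fr)\<bar> \<le> N * dirichlet_norm b \<alpha> * (r powr \<kappa> * B)"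
      unfolding abs_mult[of G1] by (intro mult_mono) auto
    then have "\<bar>perp_grad \<psi> ?z \<bullet> grad f ?z - 2 * G * ft\<bar> \<le> 2 * (2 * K * N * B * r powr \<kappa>) + N * dirichlet_norm b \<alpha> * (r powr \<kappa> * B)"
      unfolding eq using q[OF db(2) g1] q[OF db(1) gi] by linarith
    also have "\<dots> = (4 * K * N * B + N * dirichlet_norm b \<alpha> * B) * r powr \<kappa>" by (simp add: algebra_simps)
    finally show "\<bar>perp_grad \<psi> ?z \<bullet> grad f ?z - 2 * ang_stream b (radial_limit f) \<theta> * dderiv (0, 1) (polar f) (r, \<theta>)\<bar>
      \<le> (4 * K * N * B + N * dirichlet_norm b \<alpha> * B) * r powr \<kappa>" unfolding G_def ft_def .
  qed
qed

section \<open>Transport of the radial limit\<close>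

text \<open>The vorticity is differentiable in time at fixed position and in the angle at fixed time, but nothing is
known about joint differentiability. Continuity of the angular derivative at the single point
\<open>(s0, X s0)\<close> is enough for the chain rule along a trajectory: the mean value theorem in the angle
handles the second increment.\<close>

lemma chain_rule_partial:
  fixes F p :: "real \<Rightarrow> real \<Rightarrow> real" and X :: "real \<Rightarrow> real"
  assumes s0: "s0 \<in> I"
    and dF: "((\<lambda>s. F s (X s0)) has_real_derivative d) (at s0 within I)"
    and dX: "(X has_real_derivative v) (at s0 within I)"
    and U: "X s0 \<in> {lo<..<hi}"
    and dp: "\<And>s x. s \<in> I \<Longrightarrow> x \<in> {lo<..<hi} \<Longrightarrow> (F s has_real_derivative p s x) (at x)"
    and cp: "\<And>\<epsilon>. \<epsilon> > 0 \<Longrightarrow> \<exists>\<delta>>0. \<forall>\<^sub>F s in at s0 within I. \<forall>x. \<bar>x - X s0\<bar> < \<delta> \<longrightarrow> \<bar>p s x - p s0 (X s0)\<bar> < \<epsilon>"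
  shows "((\<lambda>s. F s (X s)) has_real_derivative d + p s0 (X s0) * v) (at s0 within I)"
proof -
  let ?x = "X s0" and ?A = "at s0 within I"
  define q where "q s = (if X s = ?x then p s0 ?x else (F s (X s) - F s ?x) / (X s - ?x))" for s
  have Xlim: "(X \<longlongrightarrow> ?x) ?A"
    using DERIV_continuous[OF dX] by (simp add: continuous_within)
  have I: "\<forall>\<^sub>F s in ?A. s \<in> I" by (simp add: eventually_at_filter)
  have qlim: "(q \<longlongrightarrow> p s0 ?x) ?A"
  proof (rule tendstoI)
    fix \<epsilon> :: real assume \<epsilon>: "\<epsilon> > 0"
    obtain \<delta> where \<delta>: "\<delta> > 0" "\<forall>\<^sub>F s in ?A. \<forall>x. \<bar>x - ?x\<bar> < \<delta> \<longrightarrow> \<bar>p s x - p s0 ?x\<bar> < \<epsilon>"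
      using cp[OF \<epsilon>] by blast
    have "\<forall>\<^sub>F s in ?A. dist (X s) ?x < \<delta>" using Xlim \<delta>(1) by (rule tendstoD)
    moreover have "\<forall>\<^sub>F s in ?A. X s \<in> {lo<..<hi}"
      using topological_tendstoD[OF Xlim _ U] by simp
    ultimately show "\<forall>\<^sub>F s in ?A. dist (q s) (p s0 ?x) < \<epsilon>" using \<delta>(2) I
    proof eventually_elim
      case (elim s)
      show ?case
      proof (cases "X s = ?x")
        case False
        have "\<exists>\<xi>. \<bar>\<xi> - ?x\<bar> \<le> \<bar>X s - ?x\<bar> \<and> F s (X s) - F s ?x = (X s - ?x) * p s \<xi>"
        proof (cases "X s < ?x")
          case True
          obtain \<xi> where "X s < \<xi>" "\<xi> < ?x" "F s ?x - F s (X s) = (?x - X s) * p s \<xi>"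
            using MVT2[OF True, of "F s" "p s"] dp[OF elim(4)] elim(2) U by auto
          then show ?thesis by (intro exI[of _ \<xi>]) (auto simp: algebra_simps)
        next
          case False
          then have lt: "?x < X s" using \<open>X s \<noteq> ?x\<close> by simp
          obtain \<xi> where "?x < \<xi>" "\<xi> < X s" "F s (X s) - F s ?x = (X s - ?x) * p s \<xi>"
            using MVT2[OF lt, of "F s" "p s"] dp[OF elim(4)] elim(2) U by auto
          then show ?thesis by (intro exI[of _ \<xi>]) auto
        qed
        then obtain \<xi> where \<xi>: "\<bar>\<xi> - ?x\<bar> \<le> \<bar>X s - ?x\<bar>" "F s (X s) - F s ?x = (X s - ?x) * p s \<xi>" by blast
        have "q s = p s \<xi>" using \<xi>(2) False by (simp add: q_def)
        moreover have "\<bar>\<xi> - ?x\<bar> < \<delta>" using \<xi>(1) elim(1) by (simp add: dist_real_def)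
        ultimately show ?thesis using elim(3) by (simp add: dist_real_def)
      qed (use \<epsilon> in \<open>simp add: q_def\<close>)
    qed
  qed
  have "((\<lambda>s. (F s ?x - F s0 ?x) / (s - s0) + q s * ((X s - ?x) / (s - s0))) \<longlongrightarrow> d + p s0 ?x * v) ?A"
    using dF dX qlim unfolding has_field_derivative_iff by (intro tendsto_intros)
  moreover have "(F s ?x - F s0 ?x) / (s - s0) + q s * ((X s - ?x) / (s - s0)) = (F s (X s) - F s0 ?x) / (s - s0)" for s
  proof (cases "X s = ?x")
    case False
    then have "q s * ((X s - ?x) / (s - s0)) = (F s (X s) - F s ?x) / (s - s0)" by (simp add: q_def)
    then show ?thesis by (simp add: diff_divide_distrib)
  qed simp
  ultimately show ?thesis unfolding has_field_derivative_iff by simp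
qed

text \<open>Closeness in the norm compares the angular derivatives at two times, locally uniformly in the angle;
smoothness at the fixed time \<open>s0\<close> compares two angles.\<close>

lemma angular_derivative_close:
  assumes cC: "continuous_Comega m \<alpha> T \<omega>" and T': "T' \<in> time_interval T" and \<alpha>: "0 \<le> \<alpha>"
    and s0: "s0 \<in> {0..T'}" and r: "0 < r" and x0: "0 < x0" "x0 < pi / m" and \<epsilon>: "\<epsilon> > 0"
  shows "\<exists>\<delta>>0. \<forall>\<^sub>F s in at s0 within {0..T'}. \<forall>x. \<bar>x - x0\<bar> < \<delta> \<longrightarrow>
    \<bar>dderiv (0, 1) (polar (\<omega> s)) (r, x) - dderiv (0, 1) (polar (\<omega> s0)) (r, x0)\<bar> < \<epsilon>"
proof -
  let ?p = "\<lambda>s x. dderiv (0, 1) (polar (\<omega> s)) (r, x)"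
  note C1 = continuous_Comega_C1[OF cC T']
  obtain lam where lam: "\<forall>t\<in>{0..T'}. \<omega> t \<in> Comega_lam m \<alpha> lam \<and>
        ((\<lambda>s. Comega_norm m \<alpha> lam (\<lambda>z. \<omega> s z - \<omega> t z)) \<longlongrightarrow> 0) (at t within {0..T'})"
    using bspec[OF cC[unfolded continuous_Comega_def] T'] by auto
  have "\<omega> s0 \<in> Comega_lam m \<alpha> lam" by (rule conjunct1[OF bspec[OF lam s0]])
  then have sm: "smooth_on (polar_sector m) (polar (\<omega> s0))" by (simp add: Comega_lam_def)
  have rx: "(r, x0) \<in> polar_sector m" using r x0 by (simp add: polar_sector_def)
  have "set [(0, 1)] \<subseteq> (Basis :: (real \<times> real) set)" by (simp add: Basis_prod_def)
  from sm[unfolded smooth_on_def, rule_format, OF this rx]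
  have "isCont (dderiv (0, 1) (polar (\<omega> s0))) (r, x0)"
    by (simp add: differentiable_imp_continuous_within)
  then have ct: "isCont (dderiv (0, 1) (polar (\<omega> s0))) (Pair r x0)" .
  have "isCont (Pair r) x0" by (intro continuous_Pair continuous_const continuous_ident)
  from isCont_o2[OF this ct] have "isCont (?p s0) x0" .
  then obtain \<delta>0 where "\<delta>0 > 0" "\<forall>x. dist x x0 < \<delta>0 \<longrightarrow> dist (?p s0 x) (?p s0 x0) < \<epsilon> / 2"
    unfolding continuous_at_eps_delta using half_gt_zero[OF \<epsilon>] by meson
  note \<delta>0 = this(1) this(2)[rule_format]
  define \<delta> where "\<delta> = min \<delta>0 (min (x0 / 2) (pi / m - x0))"
  define e where "e = \<epsilon> / 4 * (x0 / 2) powr (1 + \<alpha>)"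
  have e: "e > 0" "e * (x0 / 2) powr - (1 + \<alpha>) = \<epsilon> / 4" using \<epsilon> x0 by (auto simp: e_def simp flip: powr_add)
  have "\<forall>\<^sub>F s in at s0 within {0..T'}. s \<in> {0..T'}" by (simp add: eventually_at_filter)
  with C1(2)[OF s0 e(1)] have "\<forall>\<^sub>F s in at s0 within {0..T'}. \<forall>x. \<bar>x - x0\<bar> < \<delta> \<longrightarrow> \<bar>?p s x - ?p s0 x0\<bar> < \<epsilon>"
  proof eventually_elim
    case (elim s)
    show ?case
    proof (intro allI impI)
      fix x assume x: "\<bar>x - x0\<bar> < \<delta>"
      then have "\<bar>x - x0\<bar> < x0 / 2" "\<bar>x - x0\<bar> < pi / m - x0" unfolding \<delta>_def by linarith+
      then have xr: "x0 / 2 \<le> x" "0 < x" "x < pi / m" using x0 by linarith+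
      have "?p s x - ?p s0 x = dderiv (0, 1) (polar (\<lambda>z. \<omega> s z - \<omega> s0 z)) (r, x)"
        unfolding polar_minus using C1(3)[OF elim(2)] C1(3)[OF s0] xr r
        by (intro dderiv_diff[symmetric]) (auto simp: polar_diff_def polar_sector_def)
      then have "\<bar>?p s x - ?p s0 x\<bar> \<le> e * x powr - (1 + \<alpha>)"
        using C1_bound_D(3)[OF elim(1) \<alpha> r xr(2,3)] by simp
      also have "\<dots> \<le> e * (x0 / 2) powr - (1 + \<alpha>)"
      proof (rule mult_left_mono)
        show "x powr - (1 + \<alpha>) \<le> (x0 / 2) powr - (1 + \<alpha>)" by (rule powr_mono2') (use xr x0 \<alpha> in simp_all)
      qed (use e(1) in simp)
      finally have "\<bar>?p s x - ?p s0 x\<bar> \<le> \<epsilon> / 4" using e(2) by simp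
      moreover have "\<bar>?p s0 x - ?p s0 x0\<bar> < \<epsilon> / 2" using \<delta>0(2)[of x] x by (simp add: \<delta>_def dist_real_def)
      ultimately show "\<bar>?p s x - ?p s0 x0\<bar> < \<epsilon>" using \<epsilon> by linarith
    qed
  qed
  moreover have "\<delta> > 0" using \<delta>0 x0 by (simp add: \<delta>_def)
  ultimately show ?thesis by blast
qed

text \<open>The equation at fixed \<open>r\<close> gives \<open>d/ds \<omega>(s, r, X(s)) = - u \<cdot> \<nabla>\<omega> + 2 G \<partial>\<^sub>\<theta>\<omega> = O(r\<^sup>\<kappa>)\<close>, uniformly on the compact
time interval, since the trajectory stays away from both rays there. Integrating and letting
\<open>r \<rightarrow> 0\<close> shows conservation.\<close>

lemma radial_limit_transported:
  fixes m :: nat and \<alpha> T' :: real and T :: ereal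
  defines "b \<equiv> pi / m"
  assumes m: "m \<ge> 3" and \<alpha>: "0 \<le> \<alpha>" "\<alpha> < 1" and cC: "continuous_Comega m \<alpha> T \<omega>"
    and str: "\<And>t. t \<in> time_interval T \<Longrightarrow> stream_function m (\<omega> t) (\<psi> t)"
    and eul: "\<And>t r \<theta>. t \<in> time_interval T \<Longrightarrow> (r, \<theta>) \<in> polar_sector m \<Longrightarrow>
        ((\<lambda>s. \<omega> s (rcis r \<theta>)) has_real_derivative - (perp_grad (\<psi> t) (rcis r \<theta>) \<bullet> grad (\<omega> t) (rcis r \<theta>))) (at t within time_interval T)"
    and T': "T' \<in> time_interval T"
    and X: "\<And>t. t \<in> time_interval T \<Longrightarrow> X t \<in> {0<..<b}"
      "\<And>t. t \<in> time_interval T \<Longrightarrow> (X has_real_derivative 2 * ang_stream b (radial_limit (\<omega> t)) (X t)) (at t within time_interval T)"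
  shows "radial_limit (\<omega> T') (X T') = radial_limit (\<omega> 0) (X 0)"
proof -
  let ?I = "{0..T'}"
  have T0: "0 \<le> T'" using T' by (simp add: time_interval_def)
  have IJ: "?I \<subseteq> time_interval T" by (rule time_interval_Icc[OF T'])
  note C1 = continuous_Comega_C1[OF cC T']
  obtain N0 where N0: "\<forall>t\<in>?I. C1_bound m \<alpha> N0 (\<omega> t)" using C1(1) by blast
  define N where "N = max 1 N0"
  have fN: "C1_bound m \<alpha> N (\<omega> t)" if "t \<in> ?I" for t
    using N0 that C1_bound_mono[of m \<alpha> N0 "\<omega> t" N] by (auto simp: N_def)
  have N: "N > 0" by (simp add: N_def)
  have dXI: "(X has_real_derivative 2 * ang_stream b (radial_limit (\<omega> t)) (X t)) (at t within ?I)" if "t \<in> ?I" for t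
    using X(2)[of t] IJ that by (blast intro: has_field_derivative_subset)
  then have cX: "continuous_on ?I X" by (rule DERIV_continuous_on)
  have ne: "?I \<noteq> {}" using T0 by auto
  obtain s1 where "s1 \<in> ?I" "\<forall>s\<in>?I. X s1 \<le> X s"
    using continuous_attains_inf[OF compact_Icc ne cX] by blast
  note s1 = this(1) this(2)[rule_format]
  obtain s2 where "s2 \<in> ?I" "\<forall>s\<in>?I. X s \<le> X s2"
    using continuous_attains_sup[OF compact_Icc ne cX] by blast
  note s2 = this(1) this(2)[rule_format]
  define a where "a = min (X s1) (b - X s2)"
  have "X s1 \<in> {0<..<b}" "X s2 \<in> {0<..<b}" using X(1) s1(1) s2(1) IJ by blast+
  then have a: "a > 0" by (simp add: a_def)
  have aX: "a \<le> X s" "X s \<le> b - a" if "s \<in> ?I" for s using s1(2)[OF that] s2(2)[OF that] unfolding a_def by linarith+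
  define \<kappa> where "\<kappa> = (1 - \<alpha>) / 4"
  have \<kappa>: "\<kappa> > 0" using \<alpha> by (simp add: \<kappa>_def)
  obtain K where K: "\<And>f \<psi> r \<theta>. C1_bound m \<alpha> N f \<Longrightarrow> polar_diff m f \<Longrightarrow> odd_mfold m f \<Longrightarrow>
      stream_function m f \<psi> \<Longrightarrow> 0 < r \<Longrightarrow> r \<le> 1 \<Longrightarrow> a \<le> \<theta> \<Longrightarrow> \<theta> \<le> b - a \<Longrightarrow>
      \<bar>perp_grad \<psi> (rcis r \<theta>) \<bullet> grad f (rcis r \<theta>) - 2 * ang_stream b (radial_limit f) \<theta> * dderiv (0, 1) (polar f) (r, \<theta>)\<bar>
        \<le> K * r powr \<kappa>"
    using transport_rate[OF m \<alpha> a N] unfolding b_def \<kappa>_def by metis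
  have main: "\<bar>\<omega> T' (rcis r (X T')) - \<omega> 0 (rcis r (X 0))\<bar> \<le> K * r powr \<kappa> * T'" if r: "0 < r" "r \<le> 1" for r
  proof -
    have "norm (\<omega> T' (rcis r (X T')) - \<omega> 0 (rcis r (X 0))) \<le> K * r powr \<kappa> * norm (T' - 0)"
    proof (rule field_differentiable_bound[where f = "\<lambda>s. \<omega> s (rcis r (X s))" and x = T' and y = 0 and B = "K * r powr \<kappa>" and S = ?I
         and f' = "\<lambda>s. - (perp_grad (\<psi> s) (rcis r (X s)) \<bullet> grad (\<omega> s) (rcis r (X s)))
          + dderiv (0, 1) (polar (\<omega> s)) (r, X s) * (2 * ang_stream b (radial_limit (\<omega> s)) (X s))"])
      fix s assume s: "s \<in> ?I"
      have sJ: "s \<in> time_interval T" using s IJ by blast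
      have Xs: "0 < X s" "X s < pi / m" using X(1)[OF sJ] by (auto simp: b_def)
      have rs: "(r, X s) \<in> polar_sector m" using r Xs by (simp add: polar_sector_def)
      have "((\<lambda>s. \<omega> s (rcis r (X s))) has_real_derivative
          - (perp_grad (\<psi> s) (rcis r (X s)) \<bullet> grad (\<omega> s) (rcis r (X s)))
          + dderiv (0, 1) (polar (\<omega> s)) (r, X s) * (2 * ang_stream b (radial_limit (\<omega> s)) (X s))) (at s within ?I)"
      proof (rule chain_rule_partial[where F = "\<lambda>s x. \<omega> s (rcis r x)" and p = "\<lambda>s x. dderiv (0, 1) (polar (\<omega> s)) (r, x)"
            and X = X and I = ?I and lo = 0 and hi = "pi / m"
            and d = "- (perp_grad (\<psi> s) (rcis r (X s)) \<bullet> grad (\<omega> s) (rcis r (X s)))" and v = "2 * ang_stream b (radial_limit (\<omega> s)) (X s)"])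
        show "s \<in> ?I" by (rule s)
        show "((\<lambda>s'. \<omega> s' (rcis r (X s))) has_real_derivative - (perp_grad (\<psi> s) (rcis r (X s)) \<bullet> grad (\<omega> s) (rcis r (X s)))) (at s within ?I)"
          by (rule has_field_derivative_subset[OF eul[OF sJ rs] IJ])
        show "(X has_real_derivative 2 * ang_stream b (radial_limit (\<omega> s)) (X s)) (at s within ?I)" by (rule dXI[OF s])
        show "X s \<in> {0<..<pi / m}" using Xs by simp
        show "((\<lambda>x. \<omega> s' (rcis r x)) has_real_derivative dderiv (0, 1) (polar (\<omega> s')) (r, x)) (at x)"
          if "s' \<in> ?I" "x \<in> {0<..<pi / m}" for s' x
          using polar_line_derivs(2)[of m "\<omega> s'" r x] C1(3)[OF that(1)] r that(2) by simp
        show "\<exists>\<delta>>0. \<forall>\<^sub>F s' in at s within ?I. \<forall>x. \<bar>x - X s\<bar> < \<delta> \<longrightarrow>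
            \<bar>dderiv (0, 1) (polar (\<omega> s')) (r, x) - dderiv (0, 1) (polar (\<omega> s)) (r, X s)\<bar> < \<epsilon>" if "\<epsilon> > 0" for \<epsilon>
          by (rule angular_derivative_close[OF cC T' \<alpha>(1) s r(1) Xs that])
      qed
      then show "((\<lambda>s. \<omega> s (rcis r (X s))) has_field_derivative
          - (perp_grad (\<psi> s) (rcis r (X s)) \<bullet> grad (\<omega> s) (rcis r (X s)))
          + dderiv (0, 1) (polar (\<omega> s)) (r, X s) * (2 * ang_stream b (radial_limit (\<omega> s)) (X s))) (at s within ?I)" .
      have "\<bar>perp_grad (\<psi> s) (rcis r (X s)) \<bullet> grad (\<omega> s) (rcis r (X s))
          - 2 * ang_stream b (radial_limit (\<omega> s)) (X s) * dderiv (0, 1) (polar (\<omega> s)) (r, X s)\<bar> \<le> K * r powr \<kappa>"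
        using K[OF fN[OF s] _ _ str[OF sJ] r aX[OF s]] C1(3)[OF s] by blast
      then show "norm (- (perp_grad (\<psi> s) (rcis r (X s)) \<bullet> grad (\<omega> s) (rcis r (X s)))
          + dderiv (0, 1) (polar (\<omega> s)) (r, X s) * (2 * ang_stream b (radial_limit (\<omega> s)) (X s))) \<le> K * r powr \<kappa>"
        by (simp add: abs_le_iff algebra_simps)
    qed (use T0 in auto)
    then show ?thesis using T0 by simp
  qed
  have lims: "((\<lambda>r. \<omega> s (rcis r (X s))) \<longlongrightarrow> radial_limit (\<omega> s) (X s)) (at_right 0)" if s: "s \<in> ?I" for s
  proof -
    have "X s \<in> {0<..<b}" using X(1) s IJ by blast
    then show ?thesis using radial_limit_exists(1)[OF fN[OF s] _ \<alpha>(1), of "X s"] C1(3)[OF s] by (auto simp: b_def)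
  qed
  have I0: "0 \<in> ?I" "T' \<in> ?I" using T0 by auto
  have "\<bar>radial_limit (\<omega> T') (X T') - radial_limit (\<omega> 0) (X 0)\<bar> \<le> 0"
  proof (rule tendsto_le[OF trivial_limit_at_right_real])
    show "((\<lambda>r. \<bar>\<omega> T' (rcis r (X T')) - \<omega> 0 (rcis r (X 0))\<bar>) \<longlongrightarrow> \<bar>radial_limit (\<omega> T') (X T') - radial_limit (\<omega> 0) (X 0)\<bar>) (at_right 0)"
      by (intro tendsto_intros lims I0)
    have "((\<lambda>r::real. r powr \<kappa>) \<longlongrightarrow> 0) (at_right 0)"
      by (rule tendsto_zero_powrI[OF tendsto_ident_at tendsto_const _ \<kappa>]) (simp add: eventually_at_filter)
    then have "((\<lambda>r. K * r powr \<kappa> * T') \<longlongrightarrow> K * 0 * T') (at_right 0)" by (intro tendsto_intros)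
    then show "((\<lambda>r. K * r powr \<kappa> * T') \<longlongrightarrow> 0) (at_right 0)" by simp
    show "\<forall>\<^sub>F r in at_right 0. \<bar>\<omega> T' (rcis r (X T')) - \<omega> 0 (rcis r (X 0))\<bar> \<le> K * r powr \<kappa> * T'"
      unfolding eventually_at_right_field by (intro exI[of _ 1]) (use main in auto)
  qed
  then show ?thesis by simp
qed

lemma Comega_C1:
  assumes "f \<in> Comega m \<alpha>"
  shows "polar_diff m f" "\<exists>N. C1_bound m \<alpha> N f"
proof -
  obtain lam where lam: "lam > 0" "f \<in> Comega_lam m \<alpha> lam" using assms by (auto simp: Comega_def)
  show "polar_diff m f" using Comega_lam_polar_diff[OF lam(2)] .
  have "Comega_norm m \<alpha> lam f < \<infinity>" using lam(2) by (simp add: Comega_lam_def)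
  then obtain e where "0 \<le> e" "Comega_norm m \<alpha> lam f = ennreal e"
    by (cases "Comega_norm m \<alpha> lam f") auto
  then show "\<exists>N. C1_bound m \<alpha> N f" using C1_bound_of_norm[OF lam(1)] by (metis order_refl)
qed

text \<open>The map from \<open>\<omega>\<close> to \<open>G\<close> through the radial limit is linear and bounded for the norms involved.\<close>

lemma ang_stream_continuous_in_time:
  fixes m :: nat and \<alpha> x :: real
  defines "b \<equiv> pi / m"
  assumes m: "m \<ge> 3" and \<alpha>: "0 \<le> \<alpha>" "\<alpha> < 1" and cC: "continuous_Comega m \<alpha> T \<omega>" and x: "x \<in> {0..b}"
  shows "continuous_on (time_interval T) (\<lambda>t. ang_stream b (radial_limit (\<omega> t)) x)"
  unfolding continuous_on_def
proof
  have b: "0 < b" "b \<le> pi / 3"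
    using m pi_gt_zero by (auto simp: b_def field_simps intro!: divide_left_mono)
  have m0: "m > 0" using m by simp
  fix t assume t: "t \<in> time_interval T"
  obtain T' where T': "T' \<in> time_interval T" "t < T'" using time_interval_extend[OF t] by blast
  note C1 = continuous_Comega_C1[OF cC T'(1)]
  have tI: "t \<in> {0..T'}" using t T' by (simp add: time_interval_def)
  obtain N where N: "\<forall>t\<in>{0..T'}. C1_bound m \<alpha> N (\<omega> t)" using C1(1) by blast
  have adm: "admissible b \<alpha> N (radial_limit (\<omega> s))" if "s \<in> {0..T'}" for s
    unfolding b_def using N C1(3)[OF that] that by (intro radial_limit_admissible \<alpha> m0) auto
  define n where "n = dirichlet_norm b \<alpha>"
  have n: "n > 0" unfolding n_def by (rule dirichlet_norm_pos[OF b \<alpha>(2)])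
  show "((\<lambda>t. ang_stream b (radial_limit (\<omega> t)) x) \<longlongrightarrow> ang_stream b (radial_limit (\<omega> t)) x) (at t within time_interval T)"
    unfolding time_interval_at_within[OF T']
  proof (rule tendstoI)
    fix \<epsilon> :: real assume \<epsilon>: "\<epsilon> > 0"
    define e where "e = \<epsilon> / (2 * n)"
    have e: "e > 0" "e * n < \<epsilon>" using \<epsilon> n by (auto simp: e_def)
    have "\<forall>\<^sub>F s in at t within {0..T'}. s \<in> {0..T'}" by (simp add: eventually_at_filter)
    with C1(2)[OF tI e(1)] show "\<forall>\<^sub>F s in at t within {0..T'}. dist (ang_stream b (radial_limit (\<omega> s)) x) (ang_stream b (radial_limit (\<omega> t)) x) < \<epsilon>"
    proof eventually_elim
      case (elim s)
      let ?g = "radial_limit (\<omega> s)" and ?h = "radial_limit (\<omega> t)"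
      have "admissible b \<alpha> e (\<lambda>\<theta>. ?g \<theta> - ?h \<theta>)" unfolding admissible_def
      proof (intro conjI ballI)
        show "continuous_on {0<..<b} (\<lambda>\<theta>. ?g \<theta> - ?h \<theta>)"
          using adm[OF elim(2)] adm[OF tI] by (intro continuous_intros) (auto simp: admissible_def)
        fix \<theta> assume "\<theta> \<in> {0..b}"
        then consider "\<theta> = 0 \<or> \<theta> = pi / m" | "0 < \<theta>" "\<theta> < pi / m" unfolding b_def by force
        then show "\<bar>?g \<theta> - ?h \<theta>\<bar> \<le> e * \<theta> powr - \<alpha>"
        proof cases
          case 1
          then have "?g \<theta> = 0" "?h \<theta> = 0" using radial_limit_on_rays[of m] C1(3)[OF elim(2)] C1(3)[OF tI] m0 by auto
          then show ?thesis using e by simp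
        next
          case 2
          show ?thesis
            by (rule radial_limit_diff[OF _ _ _ _ \<alpha>(1) elim(1) 2])
               (use N elim(2) tI C1(3)[OF elim(2)] C1(3)[OF tI] in blast)+
        qed
      qed
      then have "\<bar>dirichlet b (\<lambda>\<theta>. ?g \<theta> - ?h \<theta>) x\<bar> \<le> e * n"
        unfolding n_def using x by (intro dirichlet_bound(1)[OF b \<alpha>(2)]) auto
      then have "\<bar>dirichlet b ?g x - dirichlet b ?h x\<bar> \<le> e * n"
        using dirichlet_diff[OF b \<alpha>(2) adm[OF elim(2)] adm[OF tI], of x] x by simp
      then show ?case
        using ang_stream_eq_dirichlet[OF b \<alpha>(2) adm[OF elim(2)], of x] ang_stream_eq_dirichlet[OF b \<alpha>(2) adm[OF tI], of x] x e
        by (simp add: dist_real_def)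
    qed
  qed
qed

lemma ang_stream_lipschitz:
  assumes b: "0 < b" "b \<le> pi / 3" and \<alpha>: "\<alpha> < 1" and g: "admissible b \<alpha> N g"
  shows "\<bar>ang_stream b g x - ang_stream b g y\<bar> \<le> N * dirichlet_norm b \<alpha> * \<bar>x - y\<bar>"
proof -
  have "norm (ang_stream b g x - ang_stream b g y) \<le> N * dirichlet_norm b \<alpha> * norm (x - y)"
  proof (rule field_differentiable_bound[where f = "ang_stream b g" and f' = "ang_slope b g" and x = x and y = y and S = UNIV])
    show "(ang_stream b g has_field_derivative ang_slope b g z) (at z within UNIV)" for z
      using ang_stream_deriv[OF b \<alpha> g] by simp
    show "norm (ang_slope b g z) \<le> N * dirichlet_norm b \<alpha>" for z
      unfolding real_norm_def by (rule ang_slope_bound[OF b \<alpha> g])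
  qed auto
  then show ?thesis by simp
qed

lemma ang_stream_is_angular_stream:
  fixes m :: nat
  assumes m: "m \<ge> 3" and \<alpha>: "\<alpha> < 1" and g: "admissible (pi / m) \<alpha> N g"
    and odd: "\<And>\<theta>. g (- \<theta>) = - g \<theta>" and per: "\<And>\<theta>. g (\<theta> + 2 * pi / m) = g \<theta>"
  shows "angular_stream m g (ang_stream (pi / m) g)"
proof -
  have b: "0 < pi / m" "pi / m \<le> pi / 3"
    using m pi_gt_zero by (auto simp: field_simps intro!: divide_left_mono)
  have per': "g (\<theta> + 2 * (pi / m)) = g \<theta>" for \<theta> using per[of \<theta>] by simp
  note S = ang_stream_symm[OF b \<alpha> g]
  show ?thesis
    unfolding angular_stream_def
  proof (intro conjI exI[of _ "ang_slope (pi / m) g"] allI impI)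
    show "odd_fun (ang_stream (pi / m) g)" "periodic_with (2 * pi / m) (ang_stream (pi / m) g)"
      using S by (auto simp: odd_fun_def periodic_with_def)
    show "continuous_on UNIV (ang_slope (pi / m) g)" by (rule ang_slope_cont[OF b \<alpha> g])
    show "(ang_stream (pi / m) g has_real_derivative ang_slope (pi / m) g \<theta>) (at \<theta>)" for \<theta>
      by (rule ang_stream_deriv[OF b \<alpha> g])
    show "(ang_slope (pi / m) g has_real_derivative g \<theta> - 4 * ang_stream (pi / m) g \<theta>) (at \<theta>)"
      if "\<forall>j::int. \<theta> \<noteq> j * pi / m" for \<theta>
      by (rule ang_slope_deriv[OF b \<alpha> g odd per']) (use that in auto)
  qed
qed

theorem mainTheorem4:
  fixes m :: nat and \<alpha> :: real
    and \<omega>\<^sub>0 :: "complex \<Rightarrow> real" and \<omega> :: "real \<Rightarrow> complex \<Rightarrow> real" and T :: ereal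
  assumes "m \<ge> 3" and "0 \<le> \<alpha>" and "\<alpha> < 1"
    and "\<omega>\<^sub>0 \<in> Comega m \<alpha>"
    and "T = max_time m \<alpha> \<omega>\<^sub>0"
    and "euler_solution m \<alpha> T \<omega>\<^sub>0 \<omega>"
  shows "\<exists>(g :: real \<Rightarrow> real \<Rightarrow> real) (g\<^sub>0 :: real \<Rightarrow> real) (G :: real \<Rightarrow> real \<Rightarrow> real).
    (\<forall>\<theta>\<in>{0<..<pi / m}. ((\<lambda>r. \<omega>\<^sub>0 (rcis r \<theta>)) \<longlongrightarrow> g\<^sub>0 \<theta>) (at_right 0)) \<and>
    (\<forall>t\<in>time_interval T.
       (\<forall>\<theta>\<in>{0<..<pi / m}. ((\<lambda>r. \<omega> t (rcis r \<theta>)) \<longlongrightarrow> g t \<theta>) (at_right 0)) \<and>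
       odd_fun (g t) \<and> periodic_with (2 * pi / m) (g t) \<and>
       set_borel_measurable lborel {0<..<pi / m} (\<lambda>\<theta>. \<bar>\<theta>\<bar> powr \<alpha> * g t \<theta>) \<and>
       (\<exists>C. \<forall>\<theta>\<in>{0<..<pi / m}. \<bar>\<bar>\<theta>\<bar> powr \<alpha> * g t \<theta>\<bar> \<le> C) \<and>
       angular_stream m (g t) (G t)) \<and>
    (\<forall>\<theta>\<in>{0<..<pi / m}. g 0 \<theta> = g\<^sub>0 \<theta>) \<and>
    solves_by_characteristics m T G g\<^sub>0 g"
proof -
  note m = assms(1) and \<alpha> = assms(2,3)
  define b where "b = pi / m"
  let ?J = "time_interval T"
  have b: "0 < b" "b \<le> pi / 3"
    using m pi_gt_zero by (auto simp: b_def field_simps intro!: divide_left_mono)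
  have m0: "m > 0" using m by simp
  have cC: "continuous_Comega m \<alpha> T \<omega>" and \<omega>0: "\<omega> 0 = \<omega>\<^sub>0"
    using assms(6) by (auto simp: euler_solution_def)
  obtain \<psi> where str: "\<And>t. t \<in> ?J \<Longrightarrow> stream_function m (\<omega> t) (\<psi> t)"
    and eul: "\<And>t r \<theta>. t \<in> ?J \<Longrightarrow> (r, \<theta>) \<in> polar_sector m \<Longrightarrow>
        ((\<lambda>s. \<omega> s (rcis r \<theta>)) has_real_derivative - (perp_grad (\<psi> t) (rcis r \<theta>) \<bullet> grad (\<omega> t) (rcis r \<theta>))) (at t within ?J)"
    using assms(6) unfolding euler_solution_def by blast
  define g where "g t = radial_limit (\<omega> t)" for t
  define g0 where "g0 = radial_limit \<omega>\<^sub>0"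
  define G where "G t = ang_stream b (g t)" for t
  have reg: "polar_diff m (\<omega> t)" "odd_mfold m (\<omega> t)" "\<exists>N. C1_bound m \<alpha> N (\<omega> t)" if "t \<in> ?J" for t
    using continuous_Comega_C1(1,3)[OF cC that] that by (auto simp: time_interval_def)
  have adm: "admissible b \<alpha> N (g t)" if "t \<in> ?J" "C1_bound m \<alpha> N (\<omega> t)" for t N
    unfolding b_def g_def by (rule radial_limit_admissible[OF that(2) reg(1,2)[OF that(1)] \<alpha>(1) m0])
  have lim0: "((\<lambda>r. \<omega>\<^sub>0 (rcis r \<theta>)) \<longlongrightarrow> g0 \<theta>) (at_right 0)" if "\<theta> \<in> {0<..<pi / m}" for \<theta>
    using Comega_C1[OF assms(4)] radial_limit_exists(1) \<alpha>(1) that unfolding g0_def by (metis greaterThanLessThan_iff)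
  have at_t: "(\<forall>\<theta>\<in>{0<..<pi / m}. ((\<lambda>r. \<omega> t (rcis r \<theta>)) \<longlongrightarrow> g t \<theta>) (at_right 0)) \<and>
       odd_fun (g t) \<and> periodic_with (2 * pi / m) (g t) \<and>
       set_borel_measurable lborel {0<..<pi / m} (\<lambda>\<theta>. \<bar>\<theta>\<bar> powr \<alpha> * g t \<theta>) \<and>
       (\<exists>C. \<forall>\<theta>\<in>{0<..<pi / m}. \<bar>\<bar>\<theta>\<bar> powr \<alpha> * g t \<theta>\<bar> \<le> C) \<and>
       angular_stream m (g t) (G t)" if t: "t \<in> ?J" for t
  proof (intro conjI)
    obtain N where N: "C1_bound m \<alpha> N (\<omega> t)" using reg(3)[OF t] by blast
    note rl = radial_limit_exists[OF N reg(1)[OF t] \<alpha>(1)]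
    note symm = radial_limit_symm[OF reg(2)[OF t]]
    show "\<forall>\<theta>\<in>{0<..<pi / m}. ((\<lambda>r. \<omega> t (rcis r \<theta>)) \<longlongrightarrow> g t \<theta>) (at_right 0)"
      using rl(1) by (simp add: g_def)
    show "odd_fun (g t)" "periodic_with (2 * pi / m) (g t)"
      using symm by (auto simp: g_def odd_fun_def periodic_with_def)
    have "continuous_on {0<..<pi / m} (\<lambda>\<theta>. \<bar>\<theta>\<bar> powr \<alpha> * g t \<theta>)"
      using adm[OF t N] by (intro continuous_intros) (auto simp: admissible_def b_def)
    then have "(\<lambda>\<theta>. indicator {0<..<pi / m} \<theta> *\<^sub>R (\<bar>\<theta>\<bar> powr \<alpha> * g t \<theta>)) \<in> borel_measurable borel"
      by (intro borel_measurable_continuous_on_indicator) simp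
    then show "set_borel_measurable lborel {0<..<pi / m} (\<lambda>\<theta>. \<bar>\<theta>\<bar> powr \<alpha> * g t \<theta>)"
      unfolding set_borel_measurable_def by simp
    have "\<bar>\<bar>\<theta>\<bar> powr \<alpha> * g t \<theta>\<bar> \<le> N" if \<theta>: "\<theta> \<in> {0<..<pi / m}" for \<theta>
    proof -
      have "\<bar>\<theta>\<bar> powr \<alpha> * \<bar>g t \<theta>\<bar> \<le> \<bar>\<theta>\<bar> powr \<alpha> * (N * \<theta> powr - \<alpha>)"
        unfolding g_def using rl(3) \<theta> by (intro mult_left_mono) auto
      also have "\<dots> = N" using \<theta> by (simp add: powr_minus)
      finally show ?thesis by (simp add: abs_mult)
    qed
    then show "\<exists>C. \<forall>\<theta>\<in>{0<..<pi / m}. \<bar>\<bar>\<theta>\<bar> powr \<alpha> * g t \<theta>\<bar> \<le> C" by blast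
    show "angular_stream m (g t) (G t)"
      unfolding G_def b_def
      by (rule ang_stream_is_angular_stream[OF m \<alpha>(2) adm[OF t N, unfolded b_def]]) (use symm in \<open>simp_all add: g_def\<close>)
  qed
  have G0: "G t 0 = 0" "G t b = 0" if t: "t \<in> ?J" for t
  proof -
    obtain N where N: "C1_bound m \<alpha> N (\<omega> t)" using reg(3)[OF t] by blast
    show "G t 0 = 0" "G t b = 0"
      using ang_stream_eq_dirichlet[OF b \<alpha>(2) adm[OF t N]] dirichlet_boundary[OF b \<alpha>(2)] b by (auto simp: G_def)
  qed
  have char: "\<exists>X. X 0 = \<theta> \<and> (\<forall>t\<in>?J. X t \<in> {0<..<b} \<and> (X has_real_derivative 2 * G t (X t)) (at t within ?J))"
    if \<theta>: "\<theta> \<in> {0<..<b}" for \<theta>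
  proof -
    obtain X where "X 0 = \<theta>" "\<And>t. t \<in> ?J \<Longrightarrow> X t \<in> {0<..<b}"
      "\<And>t. t \<in> ?J \<Longrightarrow> (X has_real_derivative 2 * G t (X t)) (at t within ?J)"
    proof (rule characteristic_exists[of \<theta> b T "\<lambda>t x. 2 * G t x"])
      fix T' assume T': "T' \<in> ?J"
      obtain N where N: "\<forall>t\<in>{0..T'}. C1_bound m \<alpha> N (\<omega> t)" using continuous_Comega_C1(1)[OF cC T'] by blast
      have "\<bar>2 * G t x - 2 * G t y\<bar> \<le> 2 * (N * dirichlet_norm b \<alpha>) * \<bar>x - y\<bar>" if "t \<in> {0..T'}" for t x y
        using ang_stream_lipschitz[OF b \<alpha>(2) adm, of t N x y] N that time_interval_Icc[OF T'] unfolding G_def by fastforce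
      then show "\<exists>L. \<forall>t\<in>{0..T'}. \<forall>x\<in>{0..b}. \<forall>y\<in>{0..b}. \<bar>2 * G t x - 2 * G t y\<bar> \<le> L * \<bar>x - y\<bar>" by blast
    next
      fix x assume "x \<in> {0..b}"
      then show "continuous_on ?J (\<lambda>t. 2 * G t x)"
        unfolding G_def g_def using ang_stream_continuous_in_time[OF m \<alpha> cC, of x] b_def by (intro continuous_intros) auto
    qed (use \<theta> G0 in auto)
    then show ?thesis by blast
  qed
  then obtain Y where Y: "\<And>\<theta>. \<theta> \<in> {0<..<b} \<Longrightarrow> Y \<theta> 0 = \<theta> \<and> (\<forall>t\<in>?J. Y \<theta> t \<in> {0<..<b} \<and> (Y \<theta> has_real_derivative 2 * G t (Y \<theta> t)) (at t within ?J))"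
    by metis
  have "solves_by_characteristics m T G g0 g"
    unfolding solves_by_characteristics_def
  proof (intro exI[of _ "\<lambda>t \<theta>. Y \<theta> t"] ballI conjI)
    fix \<theta> assume "\<theta> \<in> {0<..<pi / m}"
    then have \<theta>: "\<theta> \<in> {0<..<b}" by (simp add: b_def)
    show "Y \<theta> 0 = \<theta>" using Y[OF \<theta>] by simp
    fix t assume t: "t \<in> ?J"
    show "Y \<theta> t \<in> {0<..<pi / m}" "((\<lambda>s. Y \<theta> s) has_real_derivative 2 * G t (Y \<theta> t)) (at t within ?J)"
      using Y[OF \<theta>] t by (auto simp: b_def)
    have "radial_limit (\<omega> t) (Y \<theta> t) = radial_limit (\<omega> 0) (Y \<theta> 0)"
      by (rule radial_limit_transported[OF m \<alpha> cC str eul t]) (use Y[OF \<theta>] in \<open>auto simp: b_def G_def g_def\<close>)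
    then show "g t (Y \<theta> t) = g0 \<theta>" using Y[OF \<theta>] \<omega>0 by (simp add: g_def g0_def)
  qed
  then show ?thesis
    using lim0 at_t \<omega>0 by (intro exI[of _ g] exI[of _ g0] exI[of _ G]) (auto simp: g_def g0_def)
qed

end
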